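(* Let $n\in\mathbb{N}$, $r\in(0,+\infty]$, let $A$ be an Arens-Michael algebra, and let $a=(a_1,\dots,a_n)\in A^n$ be a strictly spectrally $r$-contractive $n$-tuple. Then there exists a unique continuous homomorphism $\gamma_a\colon\mathcal{F}^{\mathrm T}(\mathbb{D}^n_r)\to A$ such that $\gamma_a(\zeta_i)=a_i$ for all $i=1,\dots,n$. Moreover, the assignment $a\mapsto\gamma_a$ determines a bijection, natural in the Arens-Michael algebra $A$, $$\{a\in A^n : a\text{ is strictly spectrally }r\text{-contractive}\}\;\cong\;\mathrm{Hom}(\mathcal{F}^{\mathrm T}(\mathbb{D}^n_r),A),$$ where $\mathrm{Hom}$ denotes the set of continuous (unital) algebra homomorphisms.
   Context: All algebras are complex, associative and unital, and homomorphisms preserve units. An Arens-Michael algebra is a complete (Hausdorff) locally convex algebra whose topology is defined by a family of submultiplicative seminorms ($\|ab\|\le\|a\|\,\|b\|$). Notation: $\mathbb{Z}_+=\{0,1,2,\dots\}$; $W_{n,d}=\{1,\dots,n\}^d$, $W_n=\bigsqcup_{d\ge0}W_{n,d}$; for $\alpha=(\alpha_1,\dots,\alpha_d)\in W_{n,d}$ put $|\alpha|=d$, and for an $n$-tuple $a$ in an algebra put $a_\alpha=a_{\alpha_1}\cdots a_{\alpha_d}$ (and $a_\alpha=1$ if $d=0$). $\mathfrak{F}_n$ is the algebra of all formal series $\sum_{\alpha\in W_n}c_\alpha\zeta_\alpha$ ($c_\alpha\in\mathbb{C}$) in $n$ free (noncommuting) variables $\zeta_1,\dots,\zeta_n$.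 Taylor's free polydisk algebra is $$\mathcal{F}^{\mathrm T}(\mathbb{D}^n_r)=\Bigl\{f=\sum_{\alpha\in W_n}c_\alpha\zeta_\alpha\in\mathfrak{F}_n:\ \|f\|_\rho=\sum_{\alpha}|c_\alpha|\rho^{|\alpha|}<\infty\ \ \forall\rho\in(0,r)\Bigr\},$$ with the multiplication of $\mathfrak{F}_n$ and the topology given by the norms $\|\cdot\|_\rho$ ($0<\rho<r$); it is an Arens-Michael algebra. Joint spectral radius: if $\{\|\cdot\|_\lambda:\lambda\in\Lambda\}$ is a directed defining family of submultiplicative seminorms on an Arens-Michael algebra $A$ and $a\in A^n$, then $$r_\infty(a)=\sup_{\lambda\in\Lambda}\lim_{d\to\infty}\Bigl(\sup_{\alpha\in W_{n,d}}\|a_\alpha\|_\lambda\Bigr)^{1/d}$$ (this does not depend on the choice of the family). An $n$-tuple $a\in A^n$ is strictly spectrally $r$-contractive if for each Banach algebra $B$ and each continuous homomorphism $\varphi\colon A\to B$ we have $r_\infty(\varphi(a_1),\dots,\varphi(a_n))<r$. *)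

theory Defs
  imports "HOL-Analysis.Analysis" "HOL-Algebra.Module"
begin

section \<open>Complex topological algebras\<close>

text \<open>
  Algebras are carrier based, so that "for every Banach algebra" can be expressed inside a
  definition.  HOL-Algebra's locale \<^locale>\<open>algebra\<close> is for commutative algebras only, hence
  the separate notion below.
\<close>

definition complex_ring :: "complex ring" where
  "complex_ring = \<lparr>carrier = UNIV, mult = (*), one = 1, zero = 0, add = (+)\<rparr>"

record 'a top_algebra = "(complex, 'a) module" +
  topo :: "'a topology"

locale complex_algebra = module complex_ring A + ring A for A (structure) +
  assumes smult_mult_left:
      "\<lbrakk>x \<in> carrier A; y \<in> carrier A\<rbrakk> \<Longrightarrow> (c \<odot>\<^bsub>A\<^esub> x) \<otimes>\<^bsub>A\<^esub> y = c \<odot>\<^bsub>A\<^esub> (x \<otimes>\<^bsub>A\<^esub> y)"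
    and smult_mult_right:
      "\<lbrakk>x \<in> carrier A; y \<in> carrier A\<rbrakk> \<Longrightarrow> x \<otimes>\<^bsub>A\<^esub> (c \<odot>\<^bsub>A\<^esub> y) = c \<odot>\<^bsub>A\<^esub> (x \<otimes>\<^bsub>A\<^esub> y)"

definition submult_seminorm :: "'a top_algebra \<Rightarrow> ('a \<Rightarrow> real) \<Rightarrow> bool" where
  "submult_seminorm A p \<longleftrightarrow>
     (\<forall>x\<in>carrier A. 0 \<le> p x) \<and>
     (\<forall>x\<in>carrier A. \<forall>y\<in>carrier A. p (x \<oplus>\<^bsub>A\<^esub> y) \<le> p x + p y) \<and>
     (\<forall>c. \<forall>x\<in>carrier A. p (c \<odot>\<^bsub>A\<^esub> x) = cmod c * p x) \<and>
     (\<forall>x\<in>carrier A. \<forall>y\<in>carrier A. p (x \<otimes>\<^bsub>A\<^esub> y) \<le> p x * p y)"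

text \<open>The carrier is added to the subbase so that it is the whole space also when \<open>P\<close> is empty.\<close>

definition seminorm_topology :: "'a top_algebra \<Rightarrow> ('a \<Rightarrow> real) set \<Rightarrow> 'a topology" where
  "seminorm_topology A P = topology_generated_by
     (insert (carrier A)
       {{y \<in> carrier A. p (y \<ominus>\<^bsub>A\<^esub> x) < e} | p x e. p \<in> P \<and> x \<in> carrier A \<and> 0 < e})"

text \<open>Completeness with respect to the additive uniformity, by Cauchy filters on the carrier.\<close>

definition complete_top_algebra :: "'a top_algebra \<Rightarrow> bool" where
  "complete_top_algebra A \<longleftrightarrow>
     (\<forall>F. F \<noteq> bot \<longrightarrow> F \<le> principal (carrier A) \<longrightarrow>
        (\<forall>U. openin (topo A) U \<and> \<zero>\<^bsub>A\<^esub> \<in> U \<longrightarrow>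
           (\<exists>S. eventually (\<lambda>x. x \<in> S) F \<and> (\<forall>x\<in>S. \<forall>y\<in>S. x \<ominus>\<^bsub>A\<^esub> y \<in> U))) \<longrightarrow>
        (\<exists>x. limitin (topo A) id x F))"

definition arens_michael :: "'a top_algebra \<Rightarrow> bool" where
  "arens_michael A \<longleftrightarrow>
     complex_algebra A \<and>
     (\<exists>P. (\<forall>p\<in>P. submult_seminorm A p) \<and> topo A = seminorm_topology A P) \<and>
     Hausdorff_space (topo A) \<and>
     complete_top_algebra A"

text \<open>The norm of the unit is not required to be \<open>1\<close>; the zero algebra is allowed.\<close>

definition banach_algebra :: "'a top_algebra \<Rightarrow> ('a \<Rightarrow> real) \<Rightarrow> bool" where
  "banach_algebra B N \<longleftrightarrow>
     complex_algebra B \<and>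
     submult_seminorm B N \<and>
     (\<forall>x\<in>carrier B. N x = 0 \<longrightarrow> x = \<zero>\<^bsub>B\<^esub>) \<and>
     topo B = seminorm_topology B {N} \<and>
     (\<forall>s. (\<forall>k. s k \<in> carrier B) \<longrightarrow>
        (\<forall>e>0. \<exists>K. \<forall>j\<ge>K. \<forall>k\<ge>K. N (s j \<ominus>\<^bsub>B\<^esub> s k) < e) \<longrightarrow>
        (\<exists>x\<in>carrier B. (\<lambda>k. N (s k \<ominus>\<^bsub>B\<^esub> x)) \<longlonglongrightarrow> 0))"

text \<open>
  Homomorphisms are taken extensional (\<^const>\<open>undefined\<close> outside the carrier), so that equality
  of functions is equality of homomorphisms.
\<close>

definition cont_hom :: "'a top_algebra \<Rightarrow> 'b top_algebra \<Rightarrow> ('a \<Rightarrow> 'b) set" where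
  "cont_hom A B =
     {\<phi> \<in> ring_hom A B \<inter> extensional (carrier A).
        (\<forall>c. \<forall>x\<in>carrier A. \<phi> (c \<odot>\<^bsub>A\<^esub> x) = c \<odot>\<^bsub>B\<^esub> \<phi> x) \<and>
        continuous_map (topo A) (topo B) \<phi>}"


section \<open>Words and the free polydisk algebra\<close>

definition words :: "nat \<Rightarrow> nat list set" where
  "words n = lists {1..n}"

definition words_len :: "nat \<Rightarrow> nat \<Rightarrow> nat list set" where
  "words_len n d = {\<alpha> \<in> words n. length \<alpha> = d}"

definition word_eval :: "'a top_algebra \<Rightarrow> (nat \<Rightarrow> 'a) \<Rightarrow> nat list \<Rightarrow> 'a" where
  "word_eval A a \<alpha> = foldr (\<lambda>i x. a i \<otimes>\<^bsub>A\<^esub> x) \<alpha> \<one>\<^bsub>A\<^esub>"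

text \<open>The series \<open>\<Sum>\<alpha>. c\<^sub>\<alpha> \<zeta>\<^sub>\<alpha>\<close> is represented by \<open>c\<close>, extended by \<open>0\<close> to all lists.\<close>

definition formal_series :: "nat \<Rightarrow> (nat list \<Rightarrow> complex) set" where
  "formal_series n = {c. \<forall>\<alpha>. \<alpha> \<notin> words n \<longrightarrow> c \<alpha> = 0}"

definition poly_norm :: "nat \<Rightarrow> real \<Rightarrow> (nat list \<Rightarrow> complex) \<Rightarrow> real" where
  "poly_norm n \<rho> c = (\<Sum>\<^sub>\<infinity>\<alpha>\<in>words n. cmod (c \<alpha>) * \<rho> ^ length \<alpha>)"

text \<open>The algebraic part only; its topology is a placeholder, replaced in \<open>taylor_algebra\<close>.\<close>

definition taylor_alg0 :: "nat \<Rightarrow> ereal \<Rightarrow> (nat list \<Rightarrow> complex) top_algebra" where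
  "taylor_alg0 n r = \<lparr>
     carrier = {c \<in> formal_series n. \<forall>\<rho>>0. ereal \<rho> < r \<longrightarrow>
                  (\<lambda>\<alpha>. cmod (c \<alpha>) * \<rho> ^ length \<alpha>) summable_on words n},
     mult = (\<lambda>f g \<alpha>. \<Sum>(\<beta>, \<gamma>) \<in> {(\<beta>, \<gamma>). \<beta> @ \<gamma> = \<alpha>}. f \<beta> * g \<gamma>),
     one = (\<lambda>\<alpha>. if \<alpha> = [] then 1 else 0),
     zero = (\<lambda>\<alpha>. 0),
     add = (\<lambda>f g \<alpha>. f \<alpha> + g \<alpha>),
     smult = (\<lambda>c f \<alpha>. c * f \<alpha>),
     topo = discrete_topology UNIV\<rparr>"

definition taylor_algebra :: "nat \<Rightarrow> ereal \<Rightarrow> (nat list \<Rightarrow> complex) top_algebra" where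
  "taylor_algebra n r = (taylor_alg0 n r)
     \<lparr>topo := seminorm_topology (taylor_alg0 n r) {poly_norm n \<rho> | \<rho>. 0 < \<rho> \<and> ereal \<rho> < r}\<rparr>"

definition zeta :: "nat \<Rightarrow> nat list \<Rightarrow> complex" where
  "zeta i = (\<lambda>\<alpha>. if \<alpha> = [i] then 1 else 0)"


section \<open>Joint spectral radius and spectral contractivity\<close>

text \<open>
  The supremum over words is taken in \<open>[0, \<infinity>)\<close>; inserting \<open>0\<close> only matters when there are no
  words of length \<open>d\<close>, i.e. for \<open>n = 0 < d\<close>.
\<close>

definition joint_spectral_radius ::
    "'a top_algebra \<Rightarrow> ('a \<Rightarrow> real) set \<Rightarrow> nat \<Rightarrow> (nat \<Rightarrow> 'a) \<Rightarrow> ereal" where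
  "joint_spectral_radius A P n a =
     (SUP p\<in>P. ereal (lim (\<lambda>d. root d (Sup (insert 0 ((\<lambda>\<alpha>. p (word_eval A a \<alpha>)) ` words_len n d))))))"

text \<open>
  Tuples are functions in \<open>{1..n} \<rightarrow>\<^sub>E carrier A\<close>.  In a definition one cannot quantify over
  types, so the Banach algebras \<open>B\<close> range over those carried by a subset of \<^typ>\<open>nat \<Rightarrow> 'a\<close>.
  This is no restriction: the closure of the image of \<open>A\<close> in an arbitrary Banach algebra consists
  of limits of sequences, so it has an isometric copy there, and \<open>strictly_spectrally_contractiveD\<close>
  below derives the property for Banach algebras over arbitrary types.
\<close>

definition strictly_spectrally_contractive ::
    "'a top_algebra \<Rightarrow> nat \<Rightarrow> ereal \<Rightarrow> (nat \<Rightarrow> 'a) \<Rightarrow> bool" where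
  "strictly_spectrally_contractive A n r a \<longleftrightarrow>
     a \<in> {1..n} \<rightarrow>\<^sub>E carrier A \<and>
     (\<forall>(B :: (nat \<Rightarrow> 'a) top_algebra) N \<phi>. banach_algebra B N \<longrightarrow> \<phi> \<in> cont_hom A B \<longrightarrow>
        joint_spectral_radius B {N} n (\<phi> \<circ> a) < r)"

definition gamma :: "nat \<Rightarrow> ereal \<Rightarrow> 'a top_algebra \<Rightarrow> (nat \<Rightarrow> 'a) \<Rightarrow> (nat list \<Rightarrow> complex) \<Rightarrow> 'a"
  where "gamma n r A a =
     (THE g. g \<in> cont_hom (taylor_algebra n r) A \<and> (\<forall>i\<in>{1..n}. g (zeta i) = a i))"


section \<open>Independence of the universe\<close>

lemma complex_algebraI:
  assumes "ring A" "\<And>c x. x \<in> carrier A \<Longrightarrow> c \<odot>\<^bsub>A\<^esub> x \<in> carrier A"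
    "\<And>c d x. x \<in> carrier A \<Longrightarrow> (c + d) \<odot>\<^bsub>A\<^esub> x = c \<odot>\<^bsub>A\<^esub> x \<oplus>\<^bsub>A\<^esub> d \<odot>\<^bsub>A\<^esub> x"
    "\<And>c x y. x \<in> carrier A \<Longrightarrow> y \<in> carrier A \<Longrightarrow> c \<odot>\<^bsub>A\<^esub> (x \<oplus>\<^bsub>A\<^esub> y) = c \<odot>\<^bsub>A\<^esub> x \<oplus>\<^bsub>A\<^esub> c \<odot>\<^bsub>A\<^esub> y"
    "\<And>c d x. x \<in> carrier A \<Longrightarrow> (c * d) \<odot>\<^bsub>A\<^esub> x = c \<odot>\<^bsub>A\<^esub> (d \<odot>\<^bsub>A\<^esub> x)"
    "\<And>x. x \<in> carrier A \<Longrightarrow> 1 \<odot>\<^bsub>A\<^esub> x = x"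
    "\<And>c x y. \<lbrakk>x \<in> carrier A; y \<in> carrier A\<rbrakk> \<Longrightarrow> (c \<odot>\<^bsub>A\<^esub> x) \<otimes>\<^bsub>A\<^esub> y = c \<odot>\<^bsub>A\<^esub> (x \<otimes>\<^bsub>A\<^esub> y)"
    "\<And>c x y. \<lbrakk>x \<in> carrier A; y \<in> carrier A\<rbrakk> \<Longrightarrow> x \<otimes>\<^bsub>A\<^esub> (c \<odot>\<^bsub>A\<^esub> y) = c \<odot>\<^bsub>A\<^esub> (x \<otimes>\<^bsub>A\<^esub> y)"
  shows "complex_algebra A"
proof -
  have cr: "cring complex_ring"
    by (rule cringI[OF abelian_groupI comm_monoidI])
       (auto simp: complex_ring_def algebra_simps intro: exI[of _ "- x" for x])
  have "module complex_ring A"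
    using assms by (intro moduleI cr ring.is_abelian_group) (auto simp: complex_ring_def)
  then show ?thesis
    using assms by (simp add: complex_algebra_def complex_algebra_axioms_def)
qed


lemma word_eval_simps [simp]:
  "word_eval A a [] = \<one>\<^bsub>A\<^esub>" "word_eval A a (i # \<alpha>) = a i \<otimes>\<^bsub>A\<^esub> word_eval A a \<alpha>"
  by (simp_all add: word_eval_def)

lemma word_eval_closed:
  assumes "ring A" "\<alpha> \<in> words n" "\<And>i. i \<in> {1..n} \<Longrightarrow> a i \<in> carrier A"
  shows "word_eval A a \<alpha> \<in> carrier A"
proof -
  interpret ring A by fact
  show ?thesis using assms(2) unfolding words_def
    by (induction \<alpha> rule: lists.induct) (auto simp: assms(3))
qed

locale banach_alg = complex_algebra B for B (structure) +
  fixes N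
  assumes B: "banach_algebra B N"
begin

lemma smult_closed' [simp]: "x \<in> carrier B \<Longrightarrow> c \<odot> x \<in> carrier B"
  using smult_closed by (auto simp: complex_ring_def)

lemma smult_rules:
  "x \<in> carrier B \<Longrightarrow> (c + d) \<odot> x = c \<odot> x \<oplus> d \<odot> x"
  "\<lbrakk>x \<in> carrier B; y \<in> carrier B\<rbrakk> \<Longrightarrow> c \<odot> (x \<oplus> y) = c \<odot> x \<oplus> c \<odot> y"
  "x \<in> carrier B \<Longrightarrow> (c * d) \<odot> x = c \<odot> (d \<odot> x)"
  "x \<in> carrier B \<Longrightarrow> 1 \<odot> x = x"
  using smult_l_distr[of c d x] smult_r_distr[of c x y] smult_assoc1[of c d x] smult_one[of x]
  by (auto simp: complex_ring_def)

lemma smult_zero_left: "x \<in> carrier B \<Longrightarrow> 0 \<odot> x = \<zero>"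
  using smult_l_null[of x] by (simp add: complex_ring_def)

lemma smult_minus_one: "x \<in> carrier B \<Longrightarrow> (-1) \<odot> x = \<ominus> x"
proof -
  assume x: "x \<in> carrier B"
  have "(-1) \<odot> x \<oplus> x = (-1 + 1) \<odot> x"
    using x by (simp only: smult_rules)
  also have "\<dots> = \<zero>" using x by (simp add: smult_zero_left)
  finally show ?thesis using x by (metis M.minus_equality smult_closed')
qed

lemma N_rules:
  "x \<in> carrier B \<Longrightarrow> 0 \<le> N x"
  "\<lbrakk>x \<in> carrier B; y \<in> carrier B\<rbrakk> \<Longrightarrow> N (x \<oplus> y) \<le> N x + N y"
  "x \<in> carrier B \<Longrightarrow> N (c \<odot> x) = cmod c * N x"
  "\<lbrakk>x \<in> carrier B; y \<in> carrier B\<rbrakk> \<Longrightarrow> N (x \<otimes> y) \<le> N x * N y"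
  "x \<in> carrier B \<Longrightarrow> N x = 0 \<Longrightarrow> x = \<zero>"
  using B by (auto simp: banach_algebra_def submult_seminorm_def)

lemma N_zero: "N \<zero> = 0"
  using N_rules(3)[of \<zero> 0] by (simp add: smult_zero_left)

lemma N_uminus: "x \<in> carrier B \<Longrightarrow> N (\<ominus> x) = N x"
  using N_rules(3)[of x "-1"] by (simp add: smult_minus_one)

lemma N_minus_commute:
  assumes "x \<in> carrier B" "y \<in> carrier B" shows "N (x \<ominus> y) = N (y \<ominus> x)"
proof -
  have "\<ominus> (x \<ominus> y) = y \<ominus> x"
    using assms by (simp add: minus_eq minus_add a_comm)
  then show ?thesis using assms N_uminus[of "x \<ominus> y"] by simp
qed

lemma N_triangle:
  assumes "x \<in> carrier B" "y \<in> carrier B" "z \<in> carrier B"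
  shows "N (x \<ominus> z) \<le> N (x \<ominus> y) + N (y \<ominus> z)"
proof -
  have "x \<ominus> z = (x \<ominus> y) \<oplus> (y \<ominus> z)"
    using assms by (simp add: minus_eq a_assoc r_neg1)
  then show ?thesis using assms N_rules(2)[of "x \<ominus> y" "y \<ominus> z"] by simp
qed

lemma N_add_diff:
  assumes "x \<in> carrier B" "y \<in> carrier B" "x' \<in> carrier B" "y' \<in> carrier B"
  shows "N ((x \<oplus> y) \<ominus> (x' \<oplus> y')) \<le> N (x \<ominus> x') + N (y \<ominus> y')"
proof -
  have "(x \<oplus> y) \<ominus> (x' \<oplus> y') = (x \<ominus> x') \<oplus> (y \<ominus> y')"
    using assms by (simp add: minus_eq minus_add M.add.m_ac)
  then show ?thesis using assms N_rules(2)[of "x \<ominus> x'" "y \<ominus> y'"] by simp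
qed

lemma N_smult_diff:
  assumes "x \<in> carrier B" "x' \<in> carrier B"
  shows "N (c \<odot> x \<ominus> c \<odot> x') = cmod c * N (x \<ominus> x')"
proof -
  have "\<ominus> (c \<odot> x') = c \<odot> (\<ominus> x')"
    using assms by (simp add: smult_minus_one[symmetric] smult_rules(3)[symmetric])
  then have "c \<odot> x \<ominus> c \<odot> x' = c \<odot> (x \<ominus> x')"
    using assms by (simp add: minus_eq smult_rules)
  then show ?thesis using assms N_rules(3)[of "x \<ominus> x'" c] by simp
qed

lemma N_mult_diff:
  assumes "x \<in> carrier B" "y \<in> carrier B" "x' \<in> carrier B" "y' \<in> carrier B"
  shows "N ((x \<otimes> y) \<ominus> (x' \<otimes> y')) \<le> N (x \<ominus> x') * (N (y \<ominus> y') + N y') + N x' * N (y \<ominus> y')"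
proof -
  have "(x \<otimes> y) \<ominus> (x' \<otimes> y') = (x \<ominus> x') \<otimes> y \<oplus> x' \<otimes> (y \<ominus> y')"
    using assms by (simp add: minus_eq l_distr r_distr l_minus r_minus a_assoc r_neg1)
  then have "N ((x \<otimes> y) \<ominus> (x' \<otimes> y')) = N ((x \<ominus> x') \<otimes> y \<oplus> x' \<otimes> (y \<ominus> y'))"
    by simp
  moreover have "N ((x \<ominus> x') \<otimes> y \<oplus> x' \<otimes> (y \<ominus> y')) \<le> N ((x \<ominus> x') \<otimes> y) + N (x' \<otimes> (y \<ominus> y'))"
    using assms by (intro N_rules) auto
  moreover have "N ((x \<ominus> x') \<otimes> y) \<le> N (x \<ominus> x') * N y" "N (x' \<otimes> (y \<ominus> y')) \<le> N x' * N (y \<ominus> y')"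
    using assms by (auto intro!: N_rules)
  moreover have "N y \<le> N (y \<ominus> y') + N y'"
    using N_triangle[of y y' \<zero>] assms by (simp add: minus_eq)
  then have "N (x \<ominus> x') * N y \<le> N (x \<ominus> x') * (N (y \<ominus> y') + N y')"
    using assms by (intro mult_left_mono N_rules) auto
  ultimately show ?thesis by linarith
qed

end

locale banach_alg_hom = banach_alg B N for B :: "'b top_algebra" (structure) and N +
  fixes A :: "'a top_algebra" and \<phi>
  assumes A: "arens_michael A" and \<phi>: "\<phi> \<in> cont_hom A B"
begin

definition approx :: "'b \<Rightarrow> (nat \<Rightarrow> 'a) \<Rightarrow> bool" where
  "approx y s \<longleftrightarrow> (\<forall>k. s k \<in> carrier A) \<and> (\<lambda>k. N (\<phi> (s k) \<ominus> y)) \<longlonglongrightarrow> 0"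

definition C :: "'b set" where "C = {y \<in> carrier B. \<exists>s. approx y s}"

definition enc :: "'b \<Rightarrow> nat \<Rightarrow> 'a" where "enc y = (SOME s. approx y s)"

definition dec :: "(nat \<Rightarrow> 'a) \<Rightarrow> 'b" where "dec = inv_into C enc"

lemma \<phi>_closed: "x \<in> carrier A \<Longrightarrow> \<phi> x \<in> carrier B"
  and \<phi>_add: "\<lbrakk>x \<in> carrier A; y \<in> carrier A\<rbrakk> \<Longrightarrow> \<phi> (x \<oplus>\<^bsub>A\<^esub> y) = \<phi> x \<oplus> \<phi> y"
  and \<phi>_mult: "\<lbrakk>x \<in> carrier A; y \<in> carrier A\<rbrakk> \<Longrightarrow> \<phi> (x \<otimes>\<^bsub>A\<^esub> y) = \<phi> x \<otimes> \<phi> y"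
  and \<phi>_one: "\<phi> \<one>\<^bsub>A\<^esub> = \<one>"
  and \<phi>_smult: "x \<in> carrier A \<Longrightarrow> \<phi> (c \<odot>\<^bsub>A\<^esub> x) = c \<odot> \<phi> x"
  using \<phi> by (auto simp: cont_hom_def ring_hom_def)

lemma A_closed:
  "\<lbrakk>x \<in> carrier A; y \<in> carrier A\<rbrakk> \<Longrightarrow> x \<oplus>\<^bsub>A\<^esub> y \<in> carrier A"
  "\<lbrakk>x \<in> carrier A; y \<in> carrier A\<rbrakk> \<Longrightarrow> x \<otimes>\<^bsub>A\<^esub> y \<in> carrier A"
  "\<one>\<^bsub>A\<^esub> \<in> carrier A" "\<zero>\<^bsub>A\<^esub> \<in> carrier A"
  "x \<in> carrier A \<Longrightarrow> c \<odot>\<^bsub>A\<^esub> x \<in> carrier A"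
proof -
  interpret A: complex_algebra A using A by (simp add: arens_michael_def)
  show
  "\<lbrakk>x \<in> carrier A; y \<in> carrier A\<rbrakk> \<Longrightarrow> x \<oplus>\<^bsub>A\<^esub> y \<in> carrier A"
  "\<lbrakk>x \<in> carrier A; y \<in> carrier A\<rbrakk> \<Longrightarrow> x \<otimes>\<^bsub>A\<^esub> y \<in> carrier A"
  "\<one>\<^bsub>A\<^esub> \<in> carrier A" "\<zero>\<^bsub>A\<^esub> \<in> carrier A" by auto
  show "x \<in> carrier A \<Longrightarrow> c \<odot>\<^bsub>A\<^esub> x \<in> carrier A"
    using A.smult_closed by (auto simp: complex_ring_def)
qed

lemma C_carrier: "y \<in> C \<Longrightarrow> y \<in> carrier B"
  by (simp add: C_def)

lemma \<phi>_in_C: "x \<in> carrier A \<Longrightarrow> \<phi> x \<in> C"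
proof -
  assume x: "x \<in> carrier A"
  have "approx (\<phi> x) (\<lambda>_. x)"
    using x \<phi>_closed[OF x] by (simp add: approx_def minus_eq r_neg N_zero)
  then show ?thesis using \<phi>_closed[OF x] by (auto simp: C_def)
qed

lemma C_limit:
  assumes "y \<in> carrier B" "\<And>k. s k \<in> carrier A" "\<And>k. N (\<phi> (s k) \<ominus> y) \<le> g k" "g \<longlonglongrightarrow> 0"
  shows "y \<in> C"
proof -
  have "(\<lambda>k. N (\<phi> (s k) \<ominus> y)) \<longlonglongrightarrow> 0"
    by (rule tendsto_sandwich[OF _ _ tendsto_const assms(4)])
       (use assms \<phi>_closed in \<open>auto intro!: always_eventually N_rules\<close>)
  then show ?thesis using assms by (auto simp: C_def approx_def)
qed

lemma C_obtain:
  assumes "y \<in> C"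
  obtains s where "\<And>k. s k \<in> carrier A" "(\<lambda>k. N (\<phi> (s k) \<ominus> y)) \<longlonglongrightarrow> 0"
  using assms by (auto simp: C_def approx_def)

lemma C_add: assumes "x \<in> C" "y \<in> C" shows "x \<oplus> y \<in> C"
proof -
  obtain s where s: "\<And>k. s k \<in> carrier A" "(\<lambda>k. N (\<phi> (s k) \<ominus> x)) \<longlonglongrightarrow> 0"
    using C_obtain[OF assms(1)] by metis
  obtain t where t: "\<And>k. t k \<in> carrier A" "(\<lambda>k. N (\<phi> (t k) \<ominus> y)) \<longlonglongrightarrow> 0"
    using C_obtain[OF assms(2)] by metis
  note xy = assms[THEN C_carrier]
  show ?thesis
  proof (rule C_limit[where s = "\<lambda>k. s k \<oplus>\<^bsub>A\<^esub> t k"])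
    show "N (\<phi> (s k \<oplus>\<^bsub>A\<^esub> t k) \<ominus> (x \<oplus> y)) \<le> N (\<phi> (s k) \<ominus> x) + N (\<phi> (t k) \<ominus> y)" for k
      using s t xy by (simp add: \<phi>_add N_add_diff \<phi>_closed)
    show "(\<lambda>k. N (\<phi> (s k) \<ominus> x) + N (\<phi> (t k) \<ominus> y)) \<longlonglongrightarrow> 0"
      using tendsto_add[OF s(2) t(2)] by simp
  qed (use s t xy A_closed in auto)
qed

lemma C_mult: assumes "x \<in> C" "y \<in> C" shows "x \<otimes> y \<in> C"
proof -
  obtain s where s: "\<And>k. s k \<in> carrier A" "(\<lambda>k. N (\<phi> (s k) \<ominus> x)) \<longlonglongrightarrow> 0"
    using C_obtain[OF assms(1)] by metis
  obtain t where t: "\<And>k. t k \<in> carrier A" "(\<lambda>k. N (\<phi> (t k) \<ominus> y)) \<longlonglongrightarrow> 0"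
    using C_obtain[OF assms(2)] by metis
  note xy = assms[THEN C_carrier]
  let ?g = "\<lambda>k. N (\<phi> (s k) \<ominus> x) * (N (\<phi> (t k) \<ominus> y) + N y) + N x * N (\<phi> (t k) \<ominus> y)"
  show ?thesis
  proof (rule C_limit[where s = "\<lambda>k. s k \<otimes>\<^bsub>A\<^esub> t k"])
    show "N (\<phi> (s k \<otimes>\<^bsub>A\<^esub> t k) \<ominus> (x \<otimes> y)) \<le> ?g k" for k
      using s t xy by (simp add: \<phi>_mult N_mult_diff \<phi>_closed)
    have "?g \<longlonglongrightarrow> 0 * (0 + N y) + N x * 0"
      by (intro tendsto_intros s t)
    then show "?g \<longlonglongrightarrow> 0" by simp
  qed (use s t xy A_closed in auto)
qed

lemma C_smult: assumes "x \<in> C" shows "c \<odot> x \<in> C"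
proof -
  obtain s where s: "\<And>k. s k \<in> carrier A" "(\<lambda>k. N (\<phi> (s k) \<ominus> x)) \<longlonglongrightarrow> 0"
    using C_obtain[OF assms(1)] by metis
  note x = assms[THEN C_carrier]
  show ?thesis
  proof (rule C_limit[where s = "\<lambda>k. c \<odot>\<^bsub>A\<^esub> s k"])
    show "N (\<phi> (c \<odot>\<^bsub>A\<^esub> s k) \<ominus> (c \<odot> x)) \<le> cmod c * N (\<phi> (s k) \<ominus> x)" for k
      using s x by (simp add: \<phi>_smult N_smult_diff \<phi>_closed)
    show "(\<lambda>k. cmod c * N (\<phi> (s k) \<ominus> x)) \<longlonglongrightarrow> 0"
      using tendsto_mult_left[OF s(2), of "cmod c"] by simp
  qed (use s x A_closed in auto)
qed

lemma C_one: "\<one> \<in> C"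
  using \<phi>_in_C[OF A_closed(3)] by (simp add: \<phi>_one)

lemma C_zero: "\<zero> \<in> C"
  using C_smult[OF C_one, of 0] by (simp add: smult_zero_left)

lemma C_uminus: "x \<in> C \<Longrightarrow> \<ominus> x \<in> C"
  using C_smult[of x "-1"] C_carrier[of x] by (simp add: smult_minus_one)

lemma C_minus: "\<lbrakk>x \<in> C; y \<in> C\<rbrakk> \<Longrightarrow> x \<ominus> y \<in> C"
  by (simp add: minus_eq C_add C_uminus)

lemma C_complete:
  assumes s: "\<And>k. s k \<in> C" and cauchy: "\<forall>e>0. \<exists>K. \<forall>j\<ge>K. \<forall>k\<ge>K. N (s j \<ominus> s k) < e"
  shows "\<exists>x\<in>C. (\<lambda>k. N (s k \<ominus> x)) \<longlonglongrightarrow> 0"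
proof -
  obtain x where x: "x \<in> carrier B" "(\<lambda>k. N (s k \<ominus> x)) \<longlonglongrightarrow> 0"
    using B s[THEN C_carrier] cauchy unfolding banach_algebra_def by blast
  have "\<exists>t. t \<in> carrier A \<and> N (\<phi> t \<ominus> s k) < 1 / real (Suc k)" for k
  proof -
    obtain u where u: "\<And>j. u j \<in> carrier A" "(\<lambda>j. N (\<phi> (u j) \<ominus> s k)) \<longlonglongrightarrow> 0"
      using C_obtain[OF s] by metis
    have "eventually (\<lambda>j. N (\<phi> (u j) \<ominus> s k) < 1 / real (Suc k)) sequentially"
      by (rule order_tendstoD(2)[OF u(2)]) simp
    then obtain j where "N (\<phi> (u j) \<ominus> s k) < 1 / real (Suc k)"
      by (auto simp: eventually_sequentially)
    then show ?thesis using u(1) by blast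
  qed
  then obtain t where t: "\<And>k. t k \<in> carrier A" "\<And>k. N (\<phi> (t k) \<ominus> s k) < 1 / real (Suc k)"
    by metis
  have "x \<in> C"
  proof (rule C_limit[OF x(1) t(1)])
    show "N (\<phi> (t k) \<ominus> x) \<le> 1 / real (Suc k) + N (s k \<ominus> x)" for k
      using N_triangle[of "\<phi> (t k)" "s k" x] t[of k] s[THEN C_carrier, of k] x \<phi>_closed by auto
    show "(\<lambda>k. 1 / real (Suc k) + N (s k \<ominus> x)) \<longlonglongrightarrow> 0"
      using tendsto_add[OF LIMSEQ_inverse_real_of_nat x(2)] by (simp add: inverse_eq_divide)
  qed
  then show ?thesis using x by blast
qed

lemma enc_approx: "y \<in> C \<Longrightarrow> approx y (enc y)"
  unfolding C_def enc_def using someI_ex[of "approx y"] by blast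

lemma inj_enc: "inj_on enc C"
proof (rule inj_onI)
  fix x y assume xy: "x \<in> C" "y \<in> C" "enc x = enc y"
  let ?s = "enc x"
  note c = xy(1,2)[THEN C_carrier]
  have s: "\<And>k. ?s k \<in> carrier A" "(\<lambda>k. N (\<phi> (?s k) \<ominus> x)) \<longlonglongrightarrow> 0" "(\<lambda>k. N (\<phi> (?s k) \<ominus> y)) \<longlonglongrightarrow> 0"
    using enc_approx[OF xy(1)] enc_approx[OF xy(2)] xy(3) by (auto simp: approx_def)
  have "N (x \<ominus> y) \<le> N (\<phi> (?s k) \<ominus> x) + N (\<phi> (?s k) \<ominus> y)" for k
    using N_triangle[of x "\<phi> (?s k)" y] N_minus_commute[of x "\<phi> (?s k)"] c s(1) \<phi>_closed by simp
  then have "N (x \<ominus> y) \<le> 0 + 0"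
    by (intro tendsto_lowerbound[OF tendsto_add[OF s(2,3)]] always_eventually) auto
  then have "N (x \<ominus> y) = 0" using N_rules(1)[of "x \<ominus> y"] c by simp
  then have "x \<ominus> y = \<zero>" using N_rules(5)[of "x \<ominus> y"] c by simp
  then have "x \<oplus> \<ominus> y = \<zero>" by (simp add: minus_eq)
  then have "\<ominus> (\<ominus> y) = x" using c by (intro minus_equality) auto
  then show "x = y" using c by simp
qed

lemma dec_enc [simp]: "y \<in> C \<Longrightarrow> dec (enc y) = y"
  by (simp add: dec_def inv_into_f_f[OF inj_enc])

text \<open>An isometric copy of the closure of the image of \<open>\<phi>\<close>.\<close>

definition D0 :: "(nat \<Rightarrow> 'a) top_algebra" where
  "D0 = \<lparr>carrier = enc ` C, mult = (\<lambda>s t. enc (dec s \<otimes> dec t)), one = enc \<one>, zero = enc \<zero>,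
     add = (\<lambda>s t. enc (dec s \<oplus> dec t)), smult = (\<lambda>c s. enc (c \<odot> dec s)), topo = discrete_topology UNIV\<rparr>"

definition D :: "(nat \<Rightarrow> 'a) top_algebra" where
  "D = D0 \<lparr>topo := seminorm_topology D0 {N \<circ> dec}\<rparr>"

lemma D_simps [simp]:
  "carrier D = enc ` C" "\<one>\<^bsub>D\<^esub> = enc \<one>" "\<zero>\<^bsub>D\<^esub> = enc \<zero>"
  "s \<otimes>\<^bsub>D\<^esub> t = enc (dec s \<otimes> dec t)" "s \<oplus>\<^bsub>D\<^esub> t = enc (dec s \<oplus> dec t)" "c \<odot>\<^bsub>D\<^esub> s = enc (c \<odot> dec s)"
  by (simp_all add: D_def D0_def)

lemma ring_D: "ring D"
proof (rule ringI[OF abelian_groupI monoidI])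
  show "\<exists>y\<in>carrier D. y \<oplus>\<^bsub>D\<^esub> x = \<zero>\<^bsub>D\<^esub>" if "x \<in> carrier D" for x
    using that by (auto simp: C_uminus C_carrier l_neg intro!: bexI[of _ "\<ominus> dec x"])
qed (auto simp: C_add C_mult C_one C_zero C_carrier a_ac m_assoc l_distr r_distr)

lemma complex_algebra_D: "complex_algebra D"
  by (rule complex_algebraI[OF ring_D])
     (auto simp: C_add C_mult C_smult C_carrier smult_rules smult_mult_left smult_mult_right)

lemma D_minus: assumes "x \<in> C" "y \<in> C" shows "enc x \<ominus>\<^bsub>D\<^esub> enc y = enc (x \<ominus> y)"
proof -
  interpret D: ring D by (rule ring_D)
  have "\<ominus>\<^bsub>D\<^esub> enc y = enc (\<ominus> y)"
    by (rule D.minus_equality) (use assms in \<open>auto simp: C_uminus C_carrier l_neg\<close>)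
  then show ?thesis using assms by (simp add: a_minus_def C_uminus)
qed

lemma topo_D: "topo D = seminorm_topology D {N \<circ> dec}"
proof -
  have "a_inv D0 = a_inv D" by (simp add: fun_eq_iff a_inv_def m_inv_def D_def)
  then show ?thesis
    by (simp add: D_def seminorm_topology_def a_minus_def)
qed

lemma banach_D: "banach_algebra D (N \<circ> dec)"
  unfolding banach_algebra_def
proof (intro conjI allI impI)
  show "submult_seminorm D (N \<circ> dec)"
    by (auto simp: submult_seminorm_def C_add C_mult C_smult C_carrier N_rules)
  show "\<forall>x\<in>carrier D. (N \<circ> dec) x = 0 \<longrightarrow> x = \<zero>\<^bsub>D\<^esub>"
    by (auto dest: N_rules(5)[OF C_carrier])
  fix s :: "nat \<Rightarrow> nat \<Rightarrow> 'a"
  assume s: "\<forall>k. s k \<in> carrier D"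
    and "\<forall>e>0. \<exists>K. \<forall>j\<ge>K. \<forall>k\<ge>K. (N \<circ> dec) (s j \<ominus>\<^bsub>D\<^esub> s k) < e"
  define u where "u k = dec (s k)" for k :: nat
  have u: "u k \<in> C" "s k = enc (u k)" for k
    using s by (auto simp: u_def image_iff dest!: spec[of _ k])
  have "\<exists>x\<in>C. (\<lambda>k. N (u k \<ominus> x)) \<longlonglongrightarrow> 0"
    using \<open>\<forall>e>0. _\<close> by (intro C_complete u) (simp add: u D_minus C_minus)
  then obtain x where "x \<in> C" "(\<lambda>k. N (u k \<ominus> x)) \<longlonglongrightarrow> 0" by blast
  then show "\<exists>x\<in>carrier D. (\<lambda>k. (N \<circ> dec) (s k \<ominus>\<^bsub>D\<^esub> x)) \<longlonglongrightarrow> 0"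
    by (auto simp: u D_minus C_minus)
qed (simp_all add: complex_algebra_D topo_D)

definition \<phi>' :: "'a \<Rightarrow> nat \<Rightarrow> 'a" where
  "\<phi>' = restrict (enc \<circ> \<phi>) (carrier A)"

lemma topspace_topo: "topspace (topo B) = carrier B" "topspace (topo A) = carrier A"
proof -
  show "topspace (topo B) = carrier B"
    using B by (auto simp: banach_algebra_def seminorm_topology_def)
  show "topspace (topo A) = carrier A"
    using A by (auto simp: arens_michael_def seminorm_topology_def)
qed

lemma cont_\<phi>': "continuous_map (topo A) (topo D) \<phi>'"
  unfolding topo_D seminorm_topology_def
proof (rule continuous_on_generated_topo)
  have cont: "continuous_map (topo A) (topo B) \<phi>" using \<phi> by (simp add: cont_hom_def)
  show "\<phi>' ` topspace (topo A) \<subseteq> \<Union> (insert (carrier D)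
     {{y \<in> carrier D. p (y \<ominus>\<^bsub>D\<^esub> x) < e} |p x e. p \<in> {N \<circ> dec} \<and> x \<in> carrier D \<and> 0 < e})"
    by (auto simp: \<phi>'_def topspace_topo \<phi>_in_C)
  fix U assume "U \<in> insert (carrier D)
     {{y \<in> carrier D. p (y \<ominus>\<^bsub>D\<^esub> x) < e} |p x e. p \<in> {N \<circ> dec} \<and> x \<in> carrier D \<and> 0 < e}"
  then consider "U = carrier D" | x e where "x \<in> C" "0 < e"
      "U = {y \<in> carrier D. (N \<circ> dec) (y \<ominus>\<^bsub>D\<^esub> enc x) < e}"
    by auto
  then show "openin (topo A) (\<phi>' -` U \<inter> topspace (topo A))"
  proof cases
    case 1
    then have "\<phi>' -` U \<inter> topspace (topo A) = topspace (topo A)"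
      by (auto simp: \<phi>'_def topspace_topo \<phi>_in_C)
    then show ?thesis by simp
  next
    case 2
    define V where "V = {y \<in> carrier B. N (y \<ominus> x) < e}"
    have "openin (topo B) V"
    proof -
      have "topo B = seminorm_topology B {N}" using B by (simp add: banach_algebra_def)
      then show ?thesis
        using 2 C_carrier[of x] unfolding seminorm_topology_def V_def
        by (auto intro!: topology_generated_by_Basis)
    qed
    then have "openin (topo A) {a \<in> topspace (topo A). \<phi> a \<in> V}"
      by (rule openin_continuous_map_preimage[OF cont])
    moreover have "{a \<in> topspace (topo A). \<phi> a \<in> V} = \<phi>' -` U \<inter> topspace (topo A)"
      using 2 by (auto simp: \<phi>'_def topspace_topo V_def \<phi>_in_C \<phi>_closed D_minus C_minus)
    ultimately show ?thesis by simp
  qed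
qed

lemma \<phi>'_hom: "\<phi>' \<in> cont_hom A D"
  using cont_\<phi>'
  by (auto simp: cont_hom_def ring_hom_def \<phi>'_def \<phi>_in_C \<phi>_add \<phi>_mult \<phi>_one \<phi>_smult A_closed)

lemma word_eval_D:
  assumes "a \<in> {1..n} \<rightarrow> carrier A" "\<alpha> \<in> words n"
  shows "word_eval B (\<phi> \<circ> a) \<alpha> \<in> C \<and> word_eval D (\<phi>' \<circ> a) \<alpha> = enc (word_eval B (\<phi> \<circ> a) \<alpha>)"
  using assms(2) unfolding words_def
proof (induction \<alpha> rule: lists.induct)
  case (Cons i \<alpha>)
  then have "a i \<in> carrier A" using assms(1) by auto
  then show ?case using Cons by (auto simp: C_mult \<phi>_in_C \<phi>'_def)
qed (simp add: C_one)

lemma joint_spectral_radius_D: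
  assumes "a \<in> {1..n} \<rightarrow> carrier A"
  shows "joint_spectral_radius D {N \<circ> dec} n (\<phi>' \<circ> a) = joint_spectral_radius B {N} n (\<phi> \<circ> a)"
proof -
  have "(\<lambda>\<alpha>. (N \<circ> dec) (word_eval D (\<phi>' \<circ> a) \<alpha>)) ` words_len n d =
        (\<lambda>\<alpha>. N (word_eval B (\<phi> \<circ> a) \<alpha>)) ` words_len n d" for d
    using word_eval_D[OF assms] by (intro image_cong) (auto simp: words_len_def)
  then show ?thesis by (simp add: joint_spectral_radius_def)
qed

end

lemma strictly_spectrally_contractiveD:
  fixes A :: "'a top_algebra" and B :: "'b top_algebra"
  assumes "arens_michael A" "strictly_spectrally_contractive A n r a"
    and "banach_algebra B N" "\<phi> \<in> cont_hom A B"
  shows "joint_spectral_radius B {N} n (\<phi> \<circ> a) < r"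
proof -
  interpret B: complex_algebra B using assms by (simp add: banach_algebra_def)
  interpret banach_alg_hom B N A \<phi>
    by unfold_locales (use assms in auto)
  have "a \<in> {1..n} \<rightarrow> carrier A"
    using assms(2) by (auto simp: strictly_spectrally_contractive_def)
  then show ?thesis
    using assms(2) banach_D \<phi>'_hom
    by (simp add: strictly_spectrally_contractive_def joint_spectral_radius_D[symmetric])
qed

end

theory Submission
  imports Defs
begin

text \<open>
  For a continuous seminorm \<open>p\<close> of \<open>A\<close>, let \<open>A\<^sub>p\<close> be the Banach algebra completing \<open>A / ker p\<close>.
  If \<open>a\<close> is strictly spectrally \<open>r\<close>-contractive, the joint spectral radius of \<open>a\<close> in \<open>A\<^sub>p\<close> is below
  some \<open>\<rho> < r\<close>, hence \<open>p a\<^sub>\<alpha> \<le> K \<rho>\<^sup>|\<^sup>\<alpha>\<^sup>|\<close>.  Thus \<open>\<Sum>\<alpha>. c\<^sub>\<alpha> a\<^sub>\<alpha>\<close> converges absolutely in \<open>A\<close> and is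
  bounded by \<open>K \<parallel>f\<parallel>\<^sub>\<rho>\<close>; multiplicativity and uniqueness hold on words, which span a dense subspace.
  Conversely, a continuous homomorphism to a Banach algebra is dominated by a single norm
  \<open>\<parallel>\<cdot>\<parallel>\<^sub>\<rho>\<close> with \<open>\<rho> < r\<close>, which bounds the joint spectral radius of the images of the variables by \<open>\<rho>\<close>.
\<close>

section \<open>Seminormed algebras\<close>

text \<open>The radius \<rho> depends on p, and in general no common \<rho> < r works for all of A;
  what the strict inequality buys is, for each p separately, room for a real number between the
  spectral radius and r. Since the spectral radius is an infimum over word lengths, one length m
  whose supremum is at most \<open>\<rho> ^ m\<close> already controls all words, and K absorbs the
  remainders modulo m. The Banach algebras in \<open>strictly_spectrally_contractive\<close> live on
  the type \<open>nat \<Rightarrow> 'a\<close>. This dictates the form of the completion: its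
  elements have to be sequences in A, so the quotient of the Cauchy sequences is carried by chosen
  representatives and not by equivalence classes. The series is summed along an enumeration of
  words. A direct proof of multiplicativity would rearrange a double series in A; the density
  argument replaces this by a bound on the defect and its vanishing on monomials, and the same
  density lemma gives uniqueness.\<close>

context complex_algebra
begin

text \<open>The module axioms are phrased with the carrier and operations of
  \<open>complex_ring\<close>. Unfolded here once, they become rules for scalars in the type
  \<open>complex\<close> with its usual arithmetic.\<close>

lemma csmult_closed [simp]: "x \<in> carrier A \<Longrightarrow> c \<odot> x \<in> carrier A"
  using smult_closed by (auto simp: complex_ring_def)

lemma csmult_rules:
  "x \<in> carrier A \<Longrightarrow> (c + d) \<odot> x = c \<odot> x \<oplus> d \<odot> x"
  "\<lbrakk>x \<in> carrier A; y \<in> carrier A\<rbrakk> \<Longrightarrow> c \<odot> (x \<oplus> y) = c \<odot> x \<oplus> c \<odot> y"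
  "x \<in> carrier A \<Longrightarrow> (c * d) \<odot> x = c \<odot> (d \<odot> x)"
  "x \<in> carrier A \<Longrightarrow> 1 \<odot> x = x"
  using smult_l_distr[of c d x] smult_r_distr[of c x y] smult_assoc1[of c d x] smult_one[of x]
  by (auto simp: complex_ring_def)

lemma csmult_zero_left: "x \<in> carrier A \<Longrightarrow> 0 \<odot> x = \<zero>"
  using smult_l_null[of x] by (simp add: complex_ring_def)

lemma csmult_zero_right: "c \<odot> \<zero> = \<zero>"
  using smult_r_null[of c] by (simp add: complex_ring_def)

lemma csmult_minus_one: "x \<in> carrier A \<Longrightarrow> (-1) \<odot> x = \<ominus> x"
proof -
  assume x: "x \<in> carrier A"
  have "(-1) \<odot> x \<oplus> x = (-1 + 1) \<odot> x"
    using x by (simp only: csmult_rules)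
  also have "\<dots> = \<zero>" using x by (simp add: csmult_zero_left)
  finally show ?thesis using x by (metis M.minus_equality csmult_closed)
qed

lemma csmult_uminus: "x \<in> carrier A \<Longrightarrow> c \<odot> (\<ominus> x) = \<ominus> (c \<odot> x)"
  by (metis csmult_closed csmult_minus_one csmult_rules(3) mult.commute)

lemma csmult_minus:
  "\<lbrakk>x \<in> carrier A; y \<in> carrier A\<rbrakk> \<Longrightarrow> c \<odot> (x \<ominus> y) = c \<odot> x \<ominus> c \<odot> y"
  by (simp add: minus_eq csmult_rules csmult_uminus)

lemma add_minus_add:
  "\<lbrakk>x \<in> carrier A; y \<in> carrier A; x' \<in> carrier A; y' \<in> carrier A\<rbrakk>
    \<Longrightarrow> (x \<oplus> y) \<ominus> (x' \<oplus> y') = (x \<ominus> x') \<oplus> (y \<ominus> y')"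
  by (simp add: minus_eq minus_add M.add.m_ac)

lemma minus_eq_zeroD: "\<lbrakk>x \<in> carrier A; y \<in> carrier A; x \<ominus> y = \<zero>\<rbrakk> \<Longrightarrow> x = y"
  by (metis a_inv_closed minus_eq minus_equality minus_minus)

end

locale seminormed_algebra = complex_algebra A for A (structure) +
  fixes p :: "'a \<Rightarrow> real"
  assumes submult: "submult_seminorm A p"
begin

lemma p_nonneg: "x \<in> carrier A \<Longrightarrow> 0 \<le> p x"
  and p_add: "\<lbrakk>x \<in> carrier A; y \<in> carrier A\<rbrakk> \<Longrightarrow> p (x \<oplus> y) \<le> p x + p y"
  and p_smult: "x \<in> carrier A \<Longrightarrow> p (c \<odot> x) = cmod c * p x"
  and p_mult: "\<lbrakk>x \<in> carrier A; y \<in> carrier A\<rbrakk> \<Longrightarrow> p (x \<otimes> y) \<le> p x * p y"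
  using submult by (auto simp: submult_seminorm_def)

lemma p_zero [simp]: "p \<zero> = 0"
  using p_smult[of \<zero> 0] by (simp add: csmult_zero_left)

lemma p_uminus: "x \<in> carrier A \<Longrightarrow> p (\<ominus> x) = p x"
  using p_smult[of x "-1"] by (simp add: csmult_minus_one)

lemma p_minus_commute:
  assumes "x \<in> carrier A" "y \<in> carrier A" shows "p (x \<ominus> y) = p (y \<ominus> x)"
proof -
  have "\<ominus> (x \<ominus> y) = y \<ominus> x"
    using assms by (simp add: minus_eq minus_add a_comm)
  then show ?thesis using assms p_uminus[of "x \<ominus> y"] by simp
qed

lemma p_triangle:
  assumes "x \<in> carrier A" "y \<in> carrier A" "z \<in> carrier A"
  shows "p (x \<ominus> z) \<le> p (x \<ominus> y) + p (y \<ominus> z)"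
proof -
  have "x \<ominus> z = (x \<ominus> y) \<oplus> (y \<ominus> z)"
    using assms by (simp add: minus_eq a_assoc r_neg1)
  then show ?thesis using assms p_add[of "x \<ominus> y" "y \<ominus> z"] by simp
qed

lemma p_le_add_diff: "\<lbrakk>x \<in> carrier A; y \<in> carrier A\<rbrakk> \<Longrightarrow> p x \<le> p (x \<ominus> y) + p y"
  using p_triangle[of x y \<zero>] by (simp add: minus_eq)

lemma p_abs_diff:
  "\<lbrakk>x \<in> carrier A; y \<in> carrier A\<rbrakk> \<Longrightarrow> \<bar>p x - p y\<bar> \<le> p (x \<ominus> y)"
  using p_le_add_diff[of x y] p_le_add_diff[of y x] p_minus_commute[of x y] by auto

text \<open>This makes p well defined modulo the elements on which it vanishes.\<close>

lemma p_eq_if_diff_zero: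
  "\<lbrakk>x \<in> carrier A; y \<in> carrier A; p (x \<ominus> y) = 0\<rbrakk> \<Longrightarrow> p x = p y"
  using p_abs_diff[of x y] by simp

lemma p_add_diff:
  "\<lbrakk>x \<in> carrier A; y \<in> carrier A; x' \<in> carrier A; y' \<in> carrier A\<rbrakk>
    \<Longrightarrow> p ((x \<oplus> y) \<ominus> (x' \<oplus> y')) \<le> p (x \<ominus> x') + p (y \<ominus> y')"
  using p_add[of "x \<ominus> x'" "y \<ominus> y'"] by (simp add: add_minus_add)

lemma p_smult_diff:
  "\<lbrakk>x \<in> carrier A; x' \<in> carrier A\<rbrakk> \<Longrightarrow> p (c \<odot> x \<ominus> c \<odot> x') = cmod c * p (x \<ominus> x')"
  using p_smult[of "x \<ominus> x'" c] by (simp add: csmult_minus)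

text \<open>Used twice: products of Cauchy sequences are Cauchy, and multiplication passes to the
  quotient by the kernel of p.\<close>

lemma p_mult_diff:
  assumes "x \<in> carrier A" "y \<in> carrier A" "x' \<in> carrier A" "y' \<in> carrier A"
  shows "p ((x \<otimes> y) \<ominus> (x' \<otimes> y')) \<le> p (x \<ominus> x') * p y + p x' * p (y \<ominus> y')"
proof -
  have "(x \<otimes> y) \<ominus> (x' \<otimes> y') = (x \<ominus> x') \<otimes> y \<oplus> x' \<otimes> (y \<ominus> y')"
    using assms by (simp add: minus_eq l_distr r_distr l_minus r_minus a_assoc r_neg1)
  then have "p ((x \<otimes> y) \<ominus> (x' \<otimes> y')) \<le> p ((x \<ominus> x') \<otimes> y) + p (x' \<otimes> (y \<ominus> y'))"
    using assms p_add[of "(x \<ominus> x') \<otimes> y" "x' \<otimes> (y \<ominus> y')"] by simp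
  also have "\<dots> \<le> p (x \<ominus> x') * p y + p x' * p (y \<ominus> y')"
    using assms by (intro add_mono p_mult) auto
  finally show ?thesis .
qed

end

section \<open>Topologies defined by seminorms\<close>

text \<open>Meant for finite F. One radius serves all members of F, so that these sets form
  neighbourhood bases although P need not be directed. For empty F the ball is the whole
  carrier.\<close>

definition seminorm_ball :: "'a top_algebra \<Rightarrow> ('a \<Rightarrow> real) set \<Rightarrow> 'a \<Rightarrow> real \<Rightarrow> 'a set" where
  "seminorm_ball A F x e = {y \<in> carrier A. \<forall>p\<in>F. p (y \<ominus>\<^bsub>A\<^esub> x) < e}"

locale multinormed_algebra = complex_algebra A for A (structure) +
  fixes P :: "('a \<Rightarrow> real) set"
  assumes submult: "p \<in> P \<Longrightarrow> submult_seminorm A p"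
    and topo_eq: "topo A = seminorm_topology A P"
begin

lemma seminormed: "p \<in> P \<Longrightarrow> seminormed_algebra A p"
  by unfold_locales (rule submult)

lemma topspace_topo [simp]: "topspace (topo A) = carrier A"
  by (auto simp: topo_eq seminorm_topology_def)

lemma ball_self: "\<lbrakk>x \<in> carrier A; F \<subseteq> P; 0 < e\<rbrakk> \<Longrightarrow> x \<in> seminorm_ball A F x e"
  using seminormed_algebra.p_zero[OF seminormed]
  by (auto simp: seminorm_ball_def minus_eq r_neg subset_iff) metis

lemma openin_ball:
  assumes "finite F" "F \<subseteq> P" "x \<in> carrier A" "0 < e"
  shows "openin (topo A) (seminorm_ball A F x e)"
proof -
  have "openin (topo A) {y \<in> carrier A. p (y \<ominus> x) < e}" if "p \<in> F" for p
    using that assms unfolding topo_eq seminorm_topology_def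
    by (intro topology_generated_by_Basis) auto
  then have "openin (topo A) (carrier A \<inter> (\<Inter>p\<in>F. {y \<in> carrier A. p (y \<ominus> x) < e}))"
    if "F \<noteq> {}"
    using that assms openin_topspace[of "topo A"] by (intro openin_Int openin_INT2) auto
  moreover have "seminorm_ball A F x e = carrier A \<inter> (\<Inter>p\<in>F. {y \<in> carrier A. p (y \<ominus> x) < e})"
    by (auto simp: seminorm_ball_def)
  ultimately show ?thesis
    using openin_topspace[of "topo A"] by (cases "F = {}") auto
qed

text \<open>Induction over the generation of the topology: an intersection takes the union of the
  two finite sets and the smaller radius, and a subbasic set centred at z is recentred at x by the
  triangle inequality.\<close>

lemma openin_contains_ball:
  assumes "openin (topo A) U" "x \<in> U"
  shows "\<exists>F e. finite F \<and> F \<subseteq> P \<and> 0 < e \<and> seminorm_ball A F x e \<subseteq> U"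
proof -
  have "generate_topology_on (insert (carrier A)
      {{y \<in> carrier A. p (y \<ominus> x) < e} | p x e. p \<in> P \<and> x \<in> carrier A \<and> 0 < e}) U"
    using assms(1) by (simp add: topo_eq seminorm_topology_def openin_topology_generated_by_iff)
  then show ?thesis using assms(2)
  proof (induction arbitrary: x rule: generate_topology_on.induct)
    case (Int a b)
    obtain F e where F: "finite F" "F \<subseteq> P" "0 < e" "seminorm_ball A F x e \<subseteq> a"
      using Int by (metis IntD1)
    obtain G d where G: "finite G" "G \<subseteq> P" "0 < d" "seminorm_ball A G x d \<subseteq> b"
      using Int by (metis IntD2)
    have "seminorm_ball A (F \<union> G) x (min e d) \<subseteq> a \<inter> b"
      using F(4) G(4) by (fastforce simp: seminorm_ball_def)
    then show ?case
      using F G by (intro exI[of _ "F \<union> G"] exI[of _ "min e d"]) auto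
  next
    case (UN K)
    then obtain k where "k \<in> K" "x \<in> k" by blast
    with UN.IH[of k x] show ?case by (metis Union_upper subset_trans)
  next
    case (Basis s)
    show ?case
    proof (cases "s = carrier A")
      case True
      then show ?thesis by (intro exI[of _ "{}"] exI[of _ 1]) (auto simp: seminorm_ball_def)
    next
      case False
      then obtain p z e where s: "s = {y \<in> carrier A. p (y \<ominus> z) < e}" "p \<in> P" "z \<in> carrier A"
        using Basis by blast
      interpret p: seminormed_algebra A p by (rule seminormed) fact
      \<comment> \<open>The new radius is the slack that x leaves in the subbasic set.\<close>
      have "seminorm_ball A {p} x (e - p (x \<ominus> z)) \<subseteq> s"
        using Basis(2) s p.p_triangle[of _ x z] by (fastforce simp: seminorm_ball_def)
      then show ?thesis
        using Basis(2) s by (intro exI[of _ "{p}"] exI[of _ "e - p (x \<ominus> z)"]) auto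
    qed
  qed simp
qed

lemma openin_iff_ball:
  "openin (topo A) U \<longleftrightarrow> U \<subseteq> carrier A \<and>
     (\<forall>x\<in>U. \<exists>F e. finite F \<and> F \<subseteq> P \<and> 0 < e \<and> seminorm_ball A F x e \<subseteq> U)"
proof
  assume "openin (topo A) U"
  then show "U \<subseteq> carrier A \<and>
     (\<forall>x\<in>U. \<exists>F e. finite F \<and> F \<subseteq> P \<and> 0 < e \<and> seminorm_ball A F x e \<subseteq> U)"
    using openin_contains_ball openin_subset[of "topo A" U] by auto
next
  assume U: "U \<subseteq> carrier A \<and>
     (\<forall>x\<in>U. \<exists>F e. finite F \<and> F \<subseteq> P \<and> 0 < e \<and> seminorm_ball A F x e \<subseteq> U)"
  show "openin (topo A) U"
  proof (subst openin_subopen, intro ballI)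
    fix x assume x: "x \<in> U"
    then obtain F e where "finite F" "F \<subseteq> P" "0 < e" "seminorm_ball A F x e \<subseteq> U"
      using U by blast
    then show "\<exists>T. openin (topo A) T \<and> x \<in> T \<and> T \<subseteq> U"
      using x U openin_ball ball_self by (intro exI[of _ "seminorm_ball A F x e"]) auto
  qed
qed

text \<open>An element on which all of P vanishes lies in every ball around \<zero>, so no open sets
  can separate it from \<zero>.\<close>

lemma separated:
  assumes "Hausdorff_space (topo A)" "x \<in> carrier A" "\<And>p. p \<in> P \<Longrightarrow> p x = 0"
  shows "x = \<zero>"
proof (rule ccontr)
  assume "x \<noteq> \<zero>"
  then obtain U V where UV: "openin (topo A) U" "\<zero> \<in> U" "x \<in> V" "disjnt U V"
    using assms by (metis Hausdorff_space_def topspace_topo zero_closed)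
  then obtain F e where F: "F \<subseteq> P" "0 < e" "seminorm_ball A F \<zero> e \<subseteq> U"
    using openin_contains_ball by meson
  have "p x < e" if "p \<in> F" for p
    using that F assms(3)[of p] by auto
  then have "x \<in> seminorm_ball A F \<zero> e"
    using assms(2) by (auto simp: seminorm_ball_def minus_eq)
  then show False using F UV by (auto simp: disjnt_def)
qed

text \<open>\<open>complete_top_algebra\<close> speaks of Cauchy filters. The image filter of s is
  one, because a neighbourhood of \<zero> constrains only finitely many seminorms; its limit is then
  tested on the balls of a single seminorm.\<close>

lemma sequentially_complete:
  assumes "complete_top_algebra A" and s: "\<And>k. s k \<in> carrier A"
    and cauchy: "\<And>p e. \<lbrakk>p \<in> P; 0 < e\<rbrakk> \<Longrightarrow> \<exists>K::nat. \<forall>j\<ge>K. \<forall>k\<ge>K. p (s j \<ominus> s k) < e"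
  shows "\<exists>x\<in>carrier A. \<forall>p\<in>P. (\<lambda>k. p (s k \<ominus> x)) \<longlonglongrightarrow> 0"
proof -
  let ?F = "filtermap s sequentially"
  have "\<exists>S. eventually (\<lambda>x. x \<in> S) ?F \<and> (\<forall>x\<in>S. \<forall>y\<in>S. x \<ominus> y \<in> U)"
    if U: "openin (topo A) U" "\<zero> \<in> U" for U
  proof -
    obtain F e where F: "finite F" "F \<subseteq> P" "0 < e" "seminorm_ball A F \<zero> e \<subseteq> U"
      using openin_contains_ball[OF U] by meson
    have "\<exists>K. \<forall>p\<in>F. \<forall>j\<ge>K. \<forall>k\<ge>K. p (s j \<ominus> s k) < e"
    proof -
      have "\<forall>p\<in>F. \<exists>K. \<forall>j\<ge>K. \<forall>k\<ge>K. p (s j \<ominus> s k) < e" using cauchy F by blast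
      then obtain K where K: "\<forall>p\<in>F. \<forall>j\<ge>K p. \<forall>k\<ge>K p. p (s j \<ominus> s k) < e"
        using bchoice[of F "\<lambda>p K. \<forall>j\<ge>K. \<forall>k\<ge>K. p (s j \<ominus> s k) < e"] by blast
      \<comment> \<open>The maximum of the finitely many thresholds works for all of F. For empty F
        its value is unspecified, but then nothing is claimed.\<close>
      have le: "K p \<le> j" if "p \<in> F" "Max (K ` F) \<le> j" for p j
        using F(1) that(1) by (intro order_trans[OF Max_ge that(2)]) auto
      show ?thesis
        using K le by (intro exI[of _ "Max (K ` F)"] ballI allI impI) blast
    qed
    then obtain K where K: "\<And>p j k. \<lbrakk>p \<in> F; K \<le> j; K \<le> k\<rbrakk> \<Longrightarrow> p (s j \<ominus> s k) < e"
      by blast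
    show ?thesis
    proof (intro exI[of _ "s ` {K..}"] conjI ballI)
      show "eventually (\<lambda>x. x \<in> s ` {K..}) ?F"
        unfolding eventually_filtermap by (rule eventually_sequentiallyI[of K]) auto
      fix x y assume "x \<in> s ` {K..}" "y \<in> s ` {K..}"
      then obtain j k where jk: "K \<le> j" "K \<le> k" "x = s j" "y = s k" by auto
      have "(x \<ominus> y) \<ominus> \<zero> = x \<ominus> y" using s jk by (simp add: minus_eq)
      moreover have "p (x \<ominus> y) < e" if "p \<in> F" for p
        using K[OF that jk(1,2)] by (simp only: jk(3,4))
      ultimately have "x \<ominus> y \<in> seminorm_ball A F \<zero> e"
        using s jk(3,4) by (simp add: seminorm_ball_def)
      then show "x \<ominus> y \<in> U" using F by blast
    qed
  qed
  moreover have "?F \<noteq> bot" by (simp add: filtermap_bot_iff)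
  moreover have "?F \<le> principal (carrier A)"
    by (simp add: le_principal eventually_filtermap s)
  ultimately obtain x where x: "limitin (topo A) id x ?F"
    using assms(1)[unfolded complete_top_algebra_def, rule_format, of ?F] by metis
  then have xA: "x \<in> carrier A" by (simp add: limitin_def)
  have "(\<lambda>k. p (s k \<ominus> x)) \<longlonglongrightarrow> 0" if p: "p \<in> P" for p
  proof (rule order_tendstoI)
    fix a :: real assume "a < 0"
    then show "eventually (\<lambda>k. a < p (s k \<ominus> x)) sequentially"
      using seminormed_algebra.p_nonneg[OF seminormed[OF p] minus_closed[OF s xA]]
      by (intro always_eventually allI) (rule order_less_le_trans)
  next
    fix e :: real assume "0 < e"
    then have "openin (topo A) (seminorm_ball A {p} x e)" "x \<in> seminorm_ball A {p} x e"
      using openin_ball[of "{p}" x e] ball_self[of x "{p}" e] xA p by simp_all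
    then have "eventually (\<lambda>y. id y \<in> seminorm_ball A {p} x e) ?F"
      using x by (simp add: limitin_def)
    then show "eventually (\<lambda>k. p (s k \<ominus> x) < e) sequentially"
      unfolding eventually_filtermap by (rule eventually_mono) (simp add: seminorm_ball_def)
  qed
  then show ?thesis using xA by blast
qed

end

lemma arens_michael_multinormed:
  "arens_michael A \<Longrightarrow> \<exists>P. multinormed_algebra A P"
  by (auto simp: arens_michael_def multinormed_algebra_def multinormed_algebra_axioms_def)

lemma banach_multinormed: "banach_algebra B N \<Longrightarrow> multinormed_algebra B {N}"
  by (auto simp: banach_algebra_def multinormed_algebra_def multinormed_algebra_axioms_def)

lemma banach_seminormed: "banach_algebra B N \<Longrightarrow> seminormed_algebra B N"
  by (auto simp: banach_algebra_def seminormed_algebra_def seminormed_algebra_axioms_def)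

section \<open>Continuous homomorphisms\<close>

lemma cont_hom_rules:
  assumes "\<phi> \<in> cont_hom A B"
  shows "x \<in> carrier A \<Longrightarrow> \<phi> x \<in> carrier B"
    and "\<lbrakk>x \<in> carrier A; y \<in> carrier A\<rbrakk> \<Longrightarrow> \<phi> (x \<oplus>\<^bsub>A\<^esub> y) = \<phi> x \<oplus>\<^bsub>B\<^esub> \<phi> y"
    and "\<lbrakk>x \<in> carrier A; y \<in> carrier A\<rbrakk> \<Longrightarrow> \<phi> (x \<otimes>\<^bsub>A\<^esub> y) = \<phi> x \<otimes>\<^bsub>B\<^esub> \<phi> y"
    and "\<phi> \<one>\<^bsub>A\<^esub> = \<one>\<^bsub>B\<^esub>"
    and "x \<in> carrier A \<Longrightarrow> \<phi> (c \<odot>\<^bsub>A\<^esub> x) = c \<odot>\<^bsub>B\<^esub> \<phi> x"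
    and "continuous_map (topo A) (topo B) \<phi>"
    and "\<phi> \<in> extensional (carrier A)"
  using assms by (auto simp: cont_hom_def ring_hom_def)

text \<open>\<open>compose\<close> is undefined outside the carrier, as \<open>cont_hom\<close>
  demands; on the topological space it agrees with the ordinary composition, from which continuity
  is inherited.\<close>

lemma cont_hom_compose:
  assumes "multinormed_algebra A P" "\<phi> \<in> cont_hom A B" "\<psi> \<in> cont_hom B C"
  shows "compose (carrier A) \<psi> \<phi> \<in> cont_hom A C"
proof -
  interpret A: multinormed_algebra A P by fact
  have "continuous_map (topo A) (topo C) (compose (carrier A) \<psi> \<phi>)"
    using continuous_map_compose[OF cont_hom_rules(6)[OF assms(2)] cont_hom_rules(6)[OF assms(3)]]
    by (rule continuous_map_eq) (simp add: compose_def)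
  then show ?thesis
    using cont_hom_rules[OF assms(2)] cont_hom_rules[OF assms(3)]
    by (auto simp: cont_hom_def ring_hom_def compose_def)
qed

text \<open>Scaling the preimage of the unit ball.\<close>

lemma cont_hom_bounded:
  assumes "multinormed_algebra A P" "multinormed_algebra B Q" "\<phi> \<in> cont_hom A B" "q \<in> Q"
  obtains F C where "finite F" "F \<subseteq> P" "0 \<le> C"
    "\<And>x. x \<in> carrier A \<Longrightarrow> q (\<phi> x) \<le> C * (\<Sum>p\<in>F. p x)"
proof -
  interpret A: multinormed_algebra A P by fact
  interpret B: multinormed_algebra B Q by fact
  interpret q: seminormed_algebra B q by (rule B.seminormed) fact
  note \<phi> = cont_hom_rules[OF assms(3)]
  have \<phi>0: "\<phi> \<zero>\<^bsub>A\<^esub> = \<zero>\<^bsub>B\<^esub>"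
    using \<phi>(5)[of "\<zero>\<^bsub>A\<^esub>" 0] \<phi>(1)[of "\<zero>\<^bsub>A\<^esub>"] by (simp add: A.csmult_zero_left B.csmult_zero_left)
  let ?U = "{x \<in> topspace (topo A). \<phi> x \<in> seminorm_ball B {q} \<zero>\<^bsub>B\<^esub> 1}"
  have "openin (topo A) ?U"
    using \<phi>(6) B.openin_ball[of "{q}" "\<zero>\<^bsub>B\<^esub>" 1] assms(4)
    by (intro openin_continuous_map_preimage) auto
  moreover have "\<zero>\<^bsub>A\<^esub> \<in> ?U" using assms(4) by (simp add: \<phi>0 B.ball_self)
  ultimately obtain F e where F: "finite F" "F \<subseteq> P" "0 < e" "seminorm_ball A F \<zero>\<^bsub>A\<^esub> e \<subseteq> ?U"
    using A.openin_contains_ball by meson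
  have unit: "q (\<phi> x) < 1" if "x \<in> carrier A" "\<And>p. p \<in> F \<Longrightarrow> p x < e" for x
  proof -
    have "x \<in> seminorm_ball A F \<zero>\<^bsub>A\<^esub> e" using that by (auto simp: seminorm_ball_def A.minus_eq)
    then have "\<phi> x \<in> seminorm_ball B {q} \<zero>\<^bsub>B\<^esub> 1" using F by blast
    then show ?thesis using \<phi>(1) that by (simp add: seminorm_ball_def B.minus_eq)
  qed
  show thesis
  proof (rule that[OF F(1,2), of "1 / e"])
    show "0 \<le> 1 / e" using F by simp
    fix x assume x: "x \<in> carrier A"
    \<comment> \<open>As P need not be directed, the sum over F takes the place of a seminorm
      dominating all members of F.\<close>
    define m where "m = (\<Sum>p\<in>F. p x)"
    have nonneg: "0 \<le> p x" if "p \<in> F" for p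
      using seminormed_algebra.p_nonneg[OF A.seminormed[of p] x] that F by blast
    have m: "0 \<le> m" "\<And>p. p \<in> F \<Longrightarrow> p x \<le> m"
      unfolding m_def using nonneg F(1) by (auto intro!: sum_nonneg member_le_sum)
    have "q (\<phi> x) \<le> m / e + d" if d: "0 < d" for d
    proof -
      \<comment> \<open>The factor t moves x into the ball of radius e. The summand
        \<open>e * d\<close> keeps the denominator positive when m = 0, and costs exactly d in the
        resulting bound \<open>1 / t = m / e + d\<close>.\<close>
      define t where "t = e / (m + e * d)"
      have pos: "0 < m + e * d" using d F m by (simp add: add_nonneg_pos)
      have t: "0 < t" using F pos by (simp add: t_def)
      have "q (\<phi> (complex_of_real t \<odot>\<^bsub>A\<^esub> x)) < 1"
      proof (rule unit)
        fix p assume p: "p \<in> F"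
        interpret p: seminormed_algebra A p using A.seminormed p F by blast
        have "p (complex_of_real t \<odot>\<^bsub>A\<^esub> x) = t * p x" using x t by (simp add: p.p_smult)
        also have "\<dots> \<le> t * m" using m(2)[OF p] t by simp
        also have "\<dots> < t * (m + e * d)" using t d F by simp
        also have "\<dots> = e" using pos by (simp add: t_def)
        finally show "p (complex_of_real t \<odot>\<^bsub>A\<^esub> x) < e" .
      qed (use x in simp)
      then have "t * q (\<phi> x) < 1" using x t \<phi> by (simp add: q.p_smult)
      then have "q (\<phi> x) < 1 / t" using t by (simp add: field_simps)
      also have "1 / t = m / e + d" using F by (simp add: t_def field_simps)
      finally show ?thesis by simp
    qed
    then have "q (\<phi> x) \<le> m / e" by (rule field_le_epsilon)
    then show "q (\<phi> x) \<le> 1 / e * (\<Sum>p\<in>F. p x)" by (simp add: m_def)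
  qed
qed

text \<open>Because \<phi> respects subtraction, a bound on its values bounds its differences. It is
  enough to treat subbasic sets of B, around each point of whose preimage a ball of one seminorm
  fits.\<close>

lemma continuous_map_if_bounded:
  assumes "multinormed_algebra A P" "multinormed_algebra B Q"
    and closed: "\<And>x. x \<in> carrier A \<Longrightarrow> \<phi> x \<in> carrier B"
    and minus: "\<And>x y. \<lbrakk>x \<in> carrier A; y \<in> carrier A\<rbrakk> \<Longrightarrow> \<phi> (x \<ominus>\<^bsub>A\<^esub> y) = \<phi> x \<ominus>\<^bsub>B\<^esub> \<phi> y"
    and bounded: "\<And>q. q \<in> Q \<Longrightarrow> \<exists>p\<in>P. \<exists>C. \<forall>x\<in>carrier A. q (\<phi> x) \<le> C * p x"
  shows "continuous_map (topo A) (topo B) \<phi>"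
proof -
  interpret A: multinormed_algebra A P by fact
  interpret B: multinormed_algebra B Q by fact
  show ?thesis
    unfolding B.topo_eq seminorm_topology_def
  proof (rule continuous_on_generated_topo)
    show "\<phi> ` topspace (topo A) \<subseteq> \<Union> (insert (carrier B)
      {{y \<in> carrier B. p (y \<ominus>\<^bsub>B\<^esub> x) < e} |p x e. p \<in> Q \<and> x \<in> carrier B \<and> 0 < e})"
      using closed by auto
    fix U assume "U \<in> insert (carrier B)
      {{y \<in> carrier B. p (y \<ominus>\<^bsub>B\<^esub> x) < e} |p x e. p \<in> Q \<and> x \<in> carrier B \<and> 0 < e}"
    then consider "U = carrier B" | q b e where "q \<in> Q" "b \<in> carrier B"
        "U = {y \<in> carrier B. q (y \<ominus>\<^bsub>B\<^esub> b) < e}"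
      by auto
    then show "openin (topo A) (\<phi> -` U \<inter> topspace (topo A))"
    proof cases
      case 1
      then have "\<phi> -` U \<inter> topspace (topo A) = topspace (topo A)" using closed by auto
      then show ?thesis using openin_topspace[of "topo A"] by simp
    next
      case 2
      interpret q: seminormed_algebra B q by (rule B.seminormed) fact
      obtain p C0 where p: "p \<in> P" "\<And>x. x \<in> carrier A \<Longrightarrow> q (\<phi> x) \<le> C0 * p x"
        using bounded[OF 2(1)] by blast
      interpret p: seminormed_algebra A p by (rule A.seminormed) fact
      \<comment> \<open>The given constant may be zero or negative; the new one is positive, as the
        division in d requires.\<close>
      define C where "C = \<bar>C0\<bar> + 1"
      have C: "0 < C" "q (\<phi> x) \<le> C * p x" if "x \<in> carrier A" for x
      proof -
        have "C0 * p x \<le> C * p x"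
          using p.p_nonneg that by (intro mult_right_mono) (auto simp: C_def)
        then show "0 < C" "q (\<phi> x) \<le> C * p x" using p(2)[OF that] by (auto simp: C_def)
      qed
      show ?thesis
        unfolding A.openin_iff_ball
      proof (intro conjI ballI)
        fix x assume "x \<in> \<phi> -` U \<inter> topspace (topo A)"
        then have x: "x \<in> carrier A" "q (\<phi> x \<ominus>\<^bsub>B\<^esub> b) < e" using 2 by auto
        define d where "d = (e - q (\<phi> x \<ominus>\<^bsub>B\<^esub> b)) / C"
        have "seminorm_ball A {p} x d \<subseteq> \<phi> -` U \<inter> topspace (topo A)"
        proof
          fix y assume "y \<in> seminorm_ball A {p} x d"
          then have y: "y \<in> carrier A" "p (y \<ominus>\<^bsub>A\<^esub> x) < d" by (auto simp: seminorm_ball_def)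
          have "q (\<phi> y \<ominus>\<^bsub>B\<^esub> b) \<le> q (\<phi> y \<ominus>\<^bsub>B\<^esub> \<phi> x) + q (\<phi> x \<ominus>\<^bsub>B\<^esub> b)"
            using x y closed 2 by (intro q.p_triangle) auto
          also have "q (\<phi> y \<ominus>\<^bsub>B\<^esub> \<phi> x) \<le> C * p (y \<ominus>\<^bsub>A\<^esub> x)"
            using C(2)[of "y \<ominus>\<^bsub>A\<^esub> x"] x y minus by simp
          also have "C * p (y \<ominus>\<^bsub>A\<^esub> x) < C * d" using C(1)[OF x(1)] y by simp
          also have "C * d = e - q (\<phi> x \<ominus>\<^bsub>B\<^esub> b)" using C(1)[OF x(1)] by (simp add: d_def)
          finally show "y \<in> \<phi> -` U \<inter> topspace (topo A)" using y closed 2 by auto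
        qed
        then show "\<exists>F e. finite F \<and> F \<subseteq> P \<and> 0 < e \<and>
            seminorm_ball A F x e \<subseteq> \<phi> -` U \<inter> topspace (topo A)"
          using p(1) x C(1)[OF x(1)]
          by (intro exI[of _ "{p}"] exI[of _ d]) (auto simp: d_def)
      qed auto
    qed
  qed
qed

section \<open>Completion of a seminormed algebra\<close>

context seminormed_algebra
begin

definition cauchy_seqs :: "(nat \<Rightarrow> 'a) set" where
  "cauchy_seqs = {s. (\<forall>k. s k \<in> carrier A) \<and> (\<forall>e>0. \<exists>K. \<forall>j\<ge>K. \<forall>k\<ge>K. p (s j \<ominus> s k) < e)}"

definition seq_algebra :: "(nat \<Rightarrow> 'a) top_algebra" where
  "seq_algebra = \<lparr>carrier = cauchy_seqs, mult = (\<lambda>s t k. s k \<otimes> t k), one = (\<lambda>k. \<one>),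
     zero = (\<lambda>k. \<zero>), add = (\<lambda>s t k. s k \<oplus> t k), smult = (\<lambda>c s k. c \<odot> s k),
     topo = discrete_topology UNIV\<rparr>"

definition seq_norm :: "(nat \<Rightarrow> 'a) \<Rightarrow> real" where
  "seq_norm s = lim (\<lambda>k. p (s k))"

lemma seq_simps [simp]:
  "carrier seq_algebra = cauchy_seqs" "\<one>\<^bsub>seq_algebra\<^esub> = (\<lambda>k. \<one>)" "\<zero>\<^bsub>seq_algebra\<^esub> = (\<lambda>k. \<zero>)"
  "s \<otimes>\<^bsub>seq_algebra\<^esub> t = (\<lambda>k. s k \<otimes> t k)" "s \<oplus>\<^bsub>seq_algebra\<^esub> t = (\<lambda>k. s k \<oplus> t k)"
  "c \<odot>\<^bsub>seq_algebra\<^esub> s = (\<lambda>k. c \<odot> s k)"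
  by (simp_all add: seq_algebra_def)

lemma cauchy_seqs_closed: "s \<in> cauchy_seqs \<Longrightarrow> s k \<in> carrier A"
  by (simp add: cauchy_seqs_def)

lemma cauchy_seqsD:
  "\<lbrakk>s \<in> cauchy_seqs; 0 < e\<rbrakk> \<Longrightarrow> \<exists>K. \<forall>j\<ge>K. \<forall>k\<ge>K. p (s j \<ominus> s k) < e"
  by (simp add: cauchy_seqs_def)

text \<open>With the Cauchy condition written as a limit along the product filter, sums, multiples
  and products of Cauchy sequences are handled by the limit rules, without any choice of
  epsilons.\<close>

lemma cauchy_seqs_iff_null:
  "s \<in> cauchy_seqs \<longleftrightarrow> (\<forall>k. s k \<in> carrier A) \<and>
     ((\<lambda>(j, k). p (s j \<ominus> s k)) \<longlongrightarrow> 0) (sequentially \<times>\<^sub>F sequentially)"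
proof (cases "\<forall>k. s k \<in> carrier A")
  case True
  then have "\<bar>p (s j \<ominus> s k)\<bar> = p (s k \<ominus> s j)" for j k
    using p_minus_commute[of "s j" "s k"] by (simp add: p_nonneg)
  then show ?thesis
    using True by (simp add: cauchy_seqs_def tendsto_iff eventually_prod_sequentially)
qed (auto simp: cauchy_seqs_def)

lemma cauchy_seqsI:
  assumes "\<And>k. s k \<in> carrier A" "\<And>j k. p (s j \<ominus> s k) \<le> g j k"
    "((\<lambda>(j, k). g j k) \<longlongrightarrow> 0) (sequentially \<times>\<^sub>F sequentially)"
  shows "s \<in> cauchy_seqs"
  unfolding cauchy_seqs_iff_null
proof
  show "((\<lambda>(j, k). p (s j \<ominus> s k)) \<longlongrightarrow> 0) (sequentially \<times>\<^sub>F sequentially)"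
    by (rule tendsto_sandwich[OF _ _ tendsto_const assms(3)])
       (use assms in \<open>auto intro!: always_eventually p_nonneg\<close>)
qed (simp add: assms)

text \<open>By the reverse triangle inequality the reals \<open>p (s k)\<close> form a Cauchy
  sequence, so the \<open>lim\<close> in \<open>seq_norm\<close> is a genuine limit.\<close>

lemma seq_norm_lim: assumes "s \<in> cauchy_seqs" shows "(\<lambda>k. p (s k)) \<longlonglongrightarrow> seq_norm s"
proof -
  have "Cauchy (\<lambda>k. p (s k))"
  proof (rule metric_CauchyI)
    fix e :: real assume "0 < e"
    then obtain K where "\<And>j k. \<lbrakk>K \<le> j; K \<le> k\<rbrakk> \<Longrightarrow> p (s j \<ominus> s k) < e"
      using cauchy_seqsD[OF assms] by blast
    then have "dist (p (s m)) (p (s n)) < e" if "K \<le> m" "K \<le> n" for m n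
      using le_less_trans[OF p_abs_diff[of "s m" "s n"]] cauchy_seqs_closed[OF assms] that
      by (simp add: dist_real_def)
    then show "\<exists>M. \<forall>m\<ge>M. \<forall>n\<ge>M. dist (p (s m)) (p (s n)) < e" by blast
  qed
  then show ?thesis
    unfolding seq_norm_def by (simp add: Cauchy_convergent convergent_LIMSEQ_iff[symmetric])
qed

lemma seq_norm_eqI: "(\<lambda>k. p (s k)) \<longlonglongrightarrow> l \<Longrightarrow> seq_norm s = l"
  by (simp add: seq_norm_def limI)

lemma cauchy_seqs_const: "x \<in> carrier A \<Longrightarrow> (\<lambda>k. x) \<in> cauchy_seqs"
  by (auto simp: cauchy_seqs_def minus_eq r_neg)

lemma seq_norm_const [simp]: "seq_norm (\<lambda>k. x) = p x"
  by (simp add: seq_norm_eqI)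

lemma cauchy_seqs_add:
  assumes "s \<in> cauchy_seqs" "t \<in> cauchy_seqs" shows "(\<lambda>k. s k \<oplus> t k) \<in> cauchy_seqs"
proof (rule cauchy_seqsI)
  show "p ((s j \<oplus> t j) \<ominus> (s k \<oplus> t k)) \<le> p (s j \<ominus> s k) + p (t j \<ominus> t k)" for j k
    using assms by (intro p_add_diff cauchy_seqs_closed)
  show "((\<lambda>(j, k). p (s j \<ominus> s k) + p (t j \<ominus> t k)) \<longlongrightarrow> 0) (sequentially \<times>\<^sub>F sequentially)"
    using tendsto_add[of "\<lambda>(j, k). p (s j \<ominus> s k)" 0 _ "\<lambda>(j, k). p (t j \<ominus> t k)" 0] assms
    by (simp add: cauchy_seqs_iff_null case_prod_beta')
qed (use assms cauchy_seqs_closed in auto)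

lemma cauchy_seqs_smult: assumes "s \<in> cauchy_seqs" shows "(\<lambda>k. c \<odot> s k) \<in> cauchy_seqs"
proof (rule cauchy_seqsI)
  show "p ((c \<odot> s j) \<ominus> (c \<odot> s k)) \<le> cmod c * p (s j \<ominus> s k)" for j k
    using assms by (simp add: p_smult_diff cauchy_seqs_closed)
  show "((\<lambda>(j, k). cmod c * p (s j \<ominus> s k)) \<longlongrightarrow> 0) (sequentially \<times>\<^sub>F sequentially)"
    using tendsto_mult_right_zero[of "\<lambda>(j, k). p (s j \<ominus> s k)" _ "cmod c"] assms
    by (simp add: cauchy_seqs_iff_null case_prod_beta')
qed (use assms cauchy_seqs_closed in auto)

lemma cauchy_seqs_bounded:
  assumes "s \<in> cauchy_seqs" obtains M where "\<And>k. p (s k) \<le> M"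
proof -
  have "Bseq (\<lambda>k. p (s k))"
    using seq_norm_lim[OF assms] by (intro convergent_imp_Bseq) (auto simp: convergent_def)
  then obtain M where "\<And>k. \<bar>p (s k)\<bar> \<le> M" by (auto simp: Bseq_def)
  then show thesis by (intro that[of M]) (meson abs_le_D1)
qed

lemma cauchy_seqs_mult:
  assumes "s \<in> cauchy_seqs" "t \<in> cauchy_seqs" shows "(\<lambda>k. s k \<otimes> t k) \<in> cauchy_seqs"
proof -
  obtain M where M: "\<And>k. p (s k) \<le> M" using cauchy_seqs_bounded[OF assms(1)] by blast
  obtain L where L: "\<And>k. p (t k) \<le> L" using cauchy_seqs_bounded[OF assms(2)] by blast
  note closed = assms[THEN cauchy_seqs_closed]
  show ?thesis
  proof (rule cauchy_seqsI)
    show "p ((s j \<otimes> t j) \<ominus> (s k \<otimes> t k)) \<le> p (s j \<ominus> s k) * L + M * p (t j \<ominus> t k)" for j k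
    proof -
      have "p ((s j \<otimes> t j) \<ominus> (s k \<otimes> t k)) \<le> p (s j \<ominus> s k) * p (t j) + p (s k) * p (t j \<ominus> t k)"
        using closed by (intro p_mult_diff)
      also have "\<dots> \<le> p (s j \<ominus> s k) * L + M * p (t j \<ominus> t k)"
        using closed by (intro add_mono mult_left_mono mult_right_mono M L p_nonneg) auto
      finally show ?thesis .
    qed
    have "((\<lambda>(j, k). p (s j \<ominus> s k) * L + M * p (t j \<ominus> t k)) \<longlongrightarrow> 0 * L + M * 0)
        (sequentially \<times>\<^sub>F sequentially)"
      using assms unfolding cauchy_seqs_iff_null case_prod_beta' by (intro tendsto_intros) auto
    then show "((\<lambda>(j, k). p (s j \<ominus> s k) * L + M * p (t j \<ominus> t k)) \<longlongrightarrow> 0)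
        (sequentially \<times>\<^sub>F sequentially)" by simp
  qed (use closed in auto)
qed

lemma cauchy_seqs_uminus: "s \<in> cauchy_seqs \<Longrightarrow> (\<lambda>k. \<ominus> s k) \<in> cauchy_seqs"
  using cauchy_seqs_smult[of s "-1"] by (simp add: csmult_minus_one cauchy_seqs_closed)

lemma ring_seq: "ring seq_algebra"
proof (rule ringI[OF abelian_groupI monoidI])
  show "\<exists>y\<in>carrier seq_algebra. y \<oplus>\<^bsub>seq_algebra\<^esub> x = \<zero>\<^bsub>seq_algebra\<^esub>"
    if "x \<in> carrier seq_algebra" for x
    using that
    by (auto simp: cauchy_seqs_uminus cauchy_seqs_closed l_neg intro!: bexI[of _ "\<lambda>k. \<ominus> x k"])
qed (auto simp: cauchy_seqs_add cauchy_seqs_mult cauchy_seqs_const cauchy_seqs_closed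
  a_ac m_assoc l_distr r_distr)

lemma complex_algebra_seq: "complex_algebra seq_algebra"
  by (rule complex_algebraI[OF ring_seq])
     (auto simp: cauchy_seqs_smult cauchy_seqs_closed csmult_rules smult_mult_left smult_mult_right)

lemma seq_minus:
  assumes "s \<in> cauchy_seqs" "t \<in> cauchy_seqs"
  shows "s \<ominus>\<^bsub>seq_algebra\<^esub> t = (\<lambda>k. s k \<ominus> t k)"
proof -
  interpret S: ring seq_algebra by (rule ring_seq)
  have "\<ominus>\<^bsub>seq_algebra\<^esub> t = (\<lambda>k. \<ominus> t k)"
    by (rule S.minus_equality)
       (use assms in \<open>auto simp: cauchy_seqs_uminus cauchy_seqs_closed l_neg\<close>)
  then show ?thesis by (simp add: a_minus_def)
qed

lemma cauchy_seqs_minus: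
  "\<lbrakk>s \<in> cauchy_seqs; t \<in> cauchy_seqs\<rbrakk> \<Longrightarrow> (\<lambda>k. s k \<ominus> t k) \<in> cauchy_seqs"
  by (simp add: minus_eq cauchy_seqs_add cauchy_seqs_uminus)

lemma seminormed_seq: "seminormed_algebra seq_algebra seq_norm"
proof -
  have "0 \<le> seq_norm s" if s: "s \<in> cauchy_seqs" for s
    by (rule LIMSEQ_le_const[OF seq_norm_lim[OF s]]) (simp add: p_nonneg cauchy_seqs_closed s)
  moreover have "seq_norm (\<lambda>k. s k \<oplus> t k) \<le> seq_norm s + seq_norm t"
    if st: "s \<in> cauchy_seqs" "t \<in> cauchy_seqs" for s t
    by (rule LIMSEQ_le[OF seq_norm_lim tendsto_add[OF seq_norm_lim seq_norm_lim]])
       (simp_all add: st p_add cauchy_seqs_closed cauchy_seqs_add)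
  moreover have "seq_norm (\<lambda>k. s k \<otimes> t k) \<le> seq_norm s * seq_norm t"
    if st: "s \<in> cauchy_seqs" "t \<in> cauchy_seqs" for s t
    by (rule LIMSEQ_le[OF seq_norm_lim tendsto_mult[OF seq_norm_lim seq_norm_lim]])
       (simp_all add: st p_mult cauchy_seqs_closed cauchy_seqs_mult)
  moreover have "seq_norm (\<lambda>k. c \<odot> s k) = cmod c * seq_norm s" if s: "s \<in> cauchy_seqs" for s c
    using tendsto_mult_left[OF seq_norm_lim[OF s], of "cmod c"]
    by (intro seq_norm_eqI) (simp add: p_smult cauchy_seqs_closed s)
  ultimately have "submult_seminorm seq_algebra seq_norm"
    by (simp add: submult_seminorm_def)
  then show ?thesis
    by (simp add: seminormed_algebra_def seminormed_algebra_axioms_def complex_algebra_seq)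
qed

text \<open>A Cauchy sequence is the limit of its own terms, each viewed as a constant sequence.
  Hence the constants are dense in the algebra of Cauchy sequences.\<close>

lemma seq_norm_const_minus_tendsto:
  assumes t: "t \<in> cauchy_seqs"
  shows "(\<lambda>j. seq_norm (\<lambda>k. t j \<ominus> t k)) \<longlonglongrightarrow> 0"
proof (rule LIMSEQ_I)
  fix e :: real assume e: "0 < e"
  \<comment> \<open>The limit in k turns a strict inequality into a weak one, hence
    \<open>e / 2\<close>.\<close>
  then obtain K where K: "\<And>j k. \<lbrakk>K \<le> j; K \<le> k\<rbrakk> \<Longrightarrow> p (t j \<ominus> t k) < e / 2"
    using cauchy_seqsD[OF t, of "e / 2"] by auto
  have "norm (seq_norm (\<lambda>k. t j \<ominus> t k) - 0) < e" if j: "K \<le> j" for j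
  proof -
    have m: "(\<lambda>k. t j \<ominus> t k) \<in> cauchy_seqs"
      using t by (intro cauchy_seqs_minus cauchy_seqs_const cauchy_seqs_closed)
    have "seq_norm (\<lambda>k. t j \<ominus> t k) \<le> e / 2"
      by (rule LIMSEQ_le_const2[OF seq_norm_lim[OF m]]) (use K j in \<open>auto intro!: exI[of _ K] less_imp_le\<close>)
    moreover have "0 \<le> seq_norm (\<lambda>k. t j \<ominus> t k)"
      using seminormed_algebra.p_nonneg[OF seminormed_seq] m by simp
    ultimately show ?thesis using e by simp
  qed
  then show "\<exists>K. \<forall>j\<ge>K. norm (seq_norm (\<lambda>k. t j \<ominus> t k) - 0) < e" by blast
qed

text \<open>The \<open>j\<close>-th sequence is approximated by a constant \<open>t j\<close> up to \<open>1 / (j + 1)\<close>;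
  the sequence \<open>t\<close> of these constants is the limit.\<close>

lemma seq_complete:
  assumes s: "\<And>k. s k \<in> cauchy_seqs"
    and cauchy: "\<forall>e>0. \<exists>K::nat. \<forall>j\<ge>K. \<forall>k\<ge>K. seq_norm (s j \<ominus>\<^bsub>seq_algebra\<^esub> s k) < e"
  shows "\<exists>t\<in>cauchy_seqs. (\<lambda>k. seq_norm (s k \<ominus>\<^bsub>seq_algebra\<^esub> t)) \<longlonglongrightarrow> 0"
proof -
  interpret S: seminormed_algebra seq_algebra seq_norm by (rule seminormed_seq)
  have "\<exists>x\<in>carrier A. seq_norm (s j \<ominus>\<^bsub>seq_algebra\<^esub> (\<lambda>k. x)) < 1 / real (Suc j)" for j
  proof -
    have "eventually (\<lambda>m. seq_norm (\<lambda>k. s j m \<ominus> s j k) < 1 / real (Suc j)) sequentially"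
      by (rule order_tendstoD(2)[OF seq_norm_const_minus_tendsto[OF s]]) simp
    then obtain m where "seq_norm (\<lambda>k. s j m \<ominus> s j k) < 1 / real (Suc j)"
      by (auto simp: eventually_sequentially)
    then show ?thesis
      using S.p_minus_commute[of "\<lambda>k. s j m" "s j"] s[of j]
      by (intro bexI[of _ "s j m"]) (auto simp: seq_minus cauchy_seqs_const cauchy_seqs_closed)
  qed
  then obtain t where t: "\<And>j. t j \<in> carrier A"
      "\<And>j. seq_norm (s j \<ominus>\<^bsub>seq_algebra\<^esub> (\<lambda>k. t j)) < 1 / real (Suc j)"
    by metis
  have null: "(\<lambda>j. 1 / real (Suc j)) \<longlonglongrightarrow> 0"
    using LIMSEQ_inverse_real_of_nat by (simp add: inverse_eq_divide)
  have tC: "(\<lambda>k. t j) \<in> cauchy_seqs" for j using t by (simp add: cauchy_seqs_const)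
  have "t \<in> cauchy_seqs"
  proof -
    have "\<exists>K. \<forall>i\<ge>K. \<forall>j\<ge>K. p (t i \<ominus> t j) < e" if e: "0 < e" for e
    proof -
      \<comment> \<open>One third of e for each of the comparisons t i with s i, s i with s j, and s
        j with t j.\<close>
      obtain K where K: "\<And>i j. \<lbrakk>K \<le> i; K \<le> j\<rbrakk> \<Longrightarrow> seq_norm (s i \<ominus>\<^bsub>seq_algebra\<^esub> s j) < e / 3"
        using cauchy e by (meson divide_pos_pos zero_less_numeral)
      obtain L where L: "\<And>i. L \<le> i \<Longrightarrow> 1 / real (Suc i) < e / 3"
        using order_tendstoD(2)[OF null, of "e / 3"] e by (auto simp: eventually_sequentially)
      have "p (t i \<ominus> t j) < e" if ij: "max K L \<le> i" "max K L \<le> j" for i j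
      proof -
        have "p (t i \<ominus> t j) = seq_norm ((\<lambda>k. t i) \<ominus>\<^bsub>seq_algebra\<^esub> (\<lambda>k. t j))"
          by (simp add: seq_minus tC)
        also have "\<dots> \<le> seq_norm ((\<lambda>k. t i) \<ominus>\<^bsub>seq_algebra\<^esub> s i) +
            (seq_norm (s i \<ominus>\<^bsub>seq_algebra\<^esub> s j) + seq_norm (s j \<ominus>\<^bsub>seq_algebra\<^esub> (\<lambda>k. t j)))"
          using s tC S.p_triangle[of "\<lambda>k. t i" "s i" "\<lambda>k. t j"]
            S.p_triangle[of "s i" "s j" "\<lambda>k. t j"] by auto
        also have "seq_norm ((\<lambda>k. t i) \<ominus>\<^bsub>seq_algebra\<^esub> s i) = seq_norm (s i \<ominus>\<^bsub>seq_algebra\<^esub> (\<lambda>k. t i))"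
          using s tC by (intro S.p_minus_commute) auto
        finally show ?thesis using t(2)[of i] t(2)[of j] K[of i j] L[of i] L[of j] ij by simp
      qed
      then show ?thesis by blast
    qed
    then show ?thesis using t by (simp add: cauchy_seqs_def)
  qed
  moreover have "(\<lambda>j. seq_norm (s j \<ominus>\<^bsub>seq_algebra\<^esub> t)) \<longlonglongrightarrow> 0"
  proof (rule tendsto_sandwich[OF _ _ tendsto_const])
    show "(\<lambda>j. 1 / real (Suc j) + seq_norm (\<lambda>k. t j \<ominus> t k)) \<longlonglongrightarrow> 0"
      using tendsto_add[OF null seq_norm_const_minus_tendsto[OF \<open>t \<in> cauchy_seqs\<close>]] by simp
    have "seq_norm (s j \<ominus>\<^bsub>seq_algebra\<^esub> t) \<le> 1 / real (Suc j) + seq_norm (\<lambda>k. t j \<ominus> t k)" for j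
      using S.p_triangle[of "s j" "\<lambda>k. t j" t] t(2)[of j] s[of j] tC[of j] \<open>t \<in> cauchy_seqs\<close>
      by (simp add: seq_minus)
    then show "eventually (\<lambda>j. seq_norm (s j \<ominus>\<^bsub>seq_algebra\<^esub> t) \<le>
        1 / real (Suc j) + seq_norm (\<lambda>k. t j \<ominus> t k)) sequentially"
      by (intro always_eventually) auto
    have "0 \<le> seq_norm (s j \<ominus>\<^bsub>seq_algebra\<^esub> t)" for j
      using s \<open>t \<in> cauchy_seqs\<close> S.minus_closed[of "s j" t] by (intro S.p_nonneg) simp
    then show "eventually (\<lambda>j. 0 \<le> seq_norm (s j \<ominus>\<^bsub>seq_algebra\<^esub> t)) sequentially"
      by (intro always_eventually) auto
  qed
  ultimately show ?thesis by blast
qed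

text \<open>The quotient by the ideal \<open>{x. p x = 0}\<close>, carried by a set of representatives.\<close>

definition rep :: "'a \<Rightarrow> 'a" where
  "rep x = (SOME y. y \<in> carrier A \<and> p (x \<ominus> y) = 0)"

definition quot0 :: "'a top_algebra" where
  "quot0 = \<lparr>carrier = rep ` carrier A, mult = (\<lambda>x y. rep (x \<otimes> y)), one = rep \<one>, zero = rep \<zero>,
     add = (\<lambda>x y. rep (x \<oplus> y)), smult = (\<lambda>c x. rep (c \<odot> x)), topo = discrete_topology UNIV\<rparr>"

text \<open>Two stages are used because \<open>seminorm_topology\<close> takes the algebra itself as
  an argument.\<close>

definition quot :: "'a top_algebra" where
  "quot = quot0 \<lparr>topo := seminorm_topology quot0 {p}\<rparr>"

lemma quot_simps [simp]:
  "carrier quot = rep ` carrier A" "\<one>\<^bsub>quot\<^esub> = rep \<one>" "\<zero>\<^bsub>quot\<^esub> = rep \<zero>"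
  "x \<otimes>\<^bsub>quot\<^esub> y = rep (x \<otimes> y)" "x \<oplus>\<^bsub>quot\<^esub> y = rep (x \<oplus> y)" "c \<odot>\<^bsub>quot\<^esub> x = rep (c \<odot> x)"
  by (simp_all add: quot_def quot0_def)

lemma rep:
  assumes "x \<in> carrier A" shows rep_closed [simp]: "rep x \<in> carrier A" and p_minus_rep: "p (x \<ominus> rep x) = 0"
proof -
  have "\<exists>y. y \<in> carrier A \<and> p (x \<ominus> y) = 0"
    using assms by (intro exI[of _ x]) (simp add: minus_eq r_neg)
  then show "rep x \<in> carrier A" "p (x \<ominus> rep x) = 0"
    unfolding rep_def by (metis (mono_tags, lifting) someI_ex)+
qed

lemma p_rep [simp]: "x \<in> carrier A \<Longrightarrow> p (rep x) = p x"
  using p_eq_if_diff_zero[of x "rep x"] by (simp add: p_minus_rep)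

text \<open>Elements that agree modulo the kernel of p offer the same candidates to
  \<open>SOME\<close>, so the choices coincide.\<close>

lemma rep_eqI:
  assumes "x \<in> carrier A" "y \<in> carrier A" "p (x \<ominus> y) = 0" shows "rep x = rep y"
proof -
  have "p (x \<ominus> z) = p (y \<ominus> z)" if "z \<in> carrier A" for z
    using p_triangle[of x y z] p_triangle[of y x z] p_minus_commute[of x y] assms that by simp
  then show ?thesis unfolding rep_def by (metis (no_types, lifting))
qed

text \<open>This is the fact that the kernel of p is a two-sided ideal, in rewriting form: inner
  occurrences of \<open>rep\<close> are dropped, after which the axioms of the quotient are those of
  A under one outer \<open>rep\<close>.\<close>

lemma rep_ops [simp]:
  assumes "x \<in> carrier A"
  shows "rep (rep x) = rep x"
    and "y \<in> carrier A \<Longrightarrow> rep (rep x \<oplus> y) = rep (x \<oplus> y)"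
    and "y \<in> carrier A \<Longrightarrow> rep (y \<oplus> rep x) = rep (y \<oplus> x)"
    and "y \<in> carrier A \<Longrightarrow> rep (rep x \<otimes> y) = rep (x \<otimes> y)"
    and "y \<in> carrier A \<Longrightarrow> rep (y \<otimes> rep x) = rep (y \<otimes> x)"
    and "rep (c \<odot> rep x) = rep (c \<odot> x)"
proof -
  have *: "p (rep x \<ominus> x) = 0" using assms by (metis p_minus_commute p_minus_rep rep_closed)
  have p_self: "p (y \<ominus> y) = 0" if "y \<in> carrier A" for y using that by (simp add: minus_eq r_neg)
  have eqI: "rep u = rep v" if "p (u \<ominus> v) \<le> 0" "u \<in> carrier A" "v \<in> carrier A" for u v
    using that p_nonneg[of "u \<ominus> v"] by (intro rep_eqI) auto
  show "rep (rep x) = rep x" by (rule rep_eqI) (use * assms in auto)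
  show "rep (c \<odot> rep x) = rep (c \<odot> x)" using * assms by (intro eqI) (simp_all add: p_smult_diff)
  assume y: "y \<in> carrier A"
  show "rep (rep x \<oplus> y) = rep (x \<oplus> y)"
    by (rule eqI) (use p_add_diff[of "rep x" y x y] * p_self assms y in auto)
  show "rep (y \<oplus> rep x) = rep (y \<oplus> x)"
    by (rule eqI) (use p_add_diff[of y "rep x" y x] * p_self assms y in auto)
  show "rep (rep x \<otimes> y) = rep (x \<otimes> y)"
    by (rule eqI) (use p_mult_diff[of "rep x" y x y] * p_self assms y in auto)
  show "rep (y \<otimes> rep x) = rep (y \<otimes> x)"
    by (rule eqI) (use p_mult_diff[of y "rep x" y x] * p_self assms y in auto)
qed

lemma ring_quot: "ring quot"
proof (rule ringI[OF abelian_groupI monoidI])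
  show "\<exists>y\<in>carrier quot. y \<oplus>\<^bsub>quot\<^esub> x = \<zero>\<^bsub>quot\<^esub>" if x: "x \<in> carrier quot" for x
  proof -
    obtain u where u: "u \<in> carrier A" "x = rep u" using x by auto
    then show ?thesis by (intro bexI[of _ "rep (\<ominus> u)"]) (auto simp: l_neg)
  qed
qed (auto; simp add: a_ac m_assoc l_distr r_distr)+

lemma complex_algebra_quot: "complex_algebra quot"
  by (rule complex_algebraI[OF ring_quot])
     (auto; simp add: csmult_rules smult_mult_left smult_mult_right)+

lemma quot_minus:
  assumes "x \<in> carrier A" "y \<in> carrier A" shows "rep x \<ominus>\<^bsub>quot\<^esub> rep y = rep (x \<ominus> y)"
proof -
  interpret Q: ring quot by (rule ring_quot)
  have "\<ominus>\<^bsub>quot\<^esub> rep y = rep (\<ominus> y)"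
    by (rule Q.minus_equality) (use assms in \<open>auto simp: l_neg\<close>)
  then show ?thesis using assms by (simp add: a_minus_def)
qed

text \<open>\<open>seminorm_topology\<close> reads only the carrier and subtraction, in which
  \<open>quot0\<close> and \<open>quot\<close> agree.\<close>

lemma topo_quot: "topo quot = seminorm_topology quot {p}"
proof -
  have "a_inv quot0 = a_inv quot" by (simp add: fun_eq_iff a_inv_def m_inv_def quot_def)
  then show ?thesis by (simp add: quot_def seminorm_topology_def a_minus_def)
qed

text \<open>Sequences in the quotient lift to A, and \<open>p_rep\<close> preserves the seminorms of
  differences; hence completeness for p suffices, even if limits in A are not unique. For
  definiteness: once p vanishes at u, the elements u and \<zero> have the same
  representative.\<close>

lemma banach_quot:
  assumes complete: "\<And>s. \<lbrakk>\<And>k. s k \<in> carrier A; \<forall>e>0. \<exists>K::nat. \<forall>j\<ge>K. \<forall>k\<ge>K. p (s j \<ominus> s k) < e\<rbrakk>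
      \<Longrightarrow> \<exists>x\<in>carrier A. (\<lambda>k. p (s k \<ominus> x)) \<longlonglongrightarrow> 0"
  shows "banach_algebra quot p"
  unfolding banach_algebra_def
proof (intro conjI allI impI ballI)
  show "submult_seminorm quot p"
    by (auto simp: submult_seminorm_def p_nonneg p_add p_mult p_smult)
  show "x = \<zero>\<^bsub>quot\<^esub>" if x: "x \<in> carrier quot" "p x = 0" for x
  proof -
    obtain u where u: "u \<in> carrier A" "x = rep u" using x by auto
    then have "rep u = rep \<zero>" using x by (intro rep_eqI) (auto simp: minus_eq)
    then show ?thesis using u by simp
  qed
  fix s :: "nat \<Rightarrow> 'a"
  assume s: "\<forall>k. s k \<in> carrier quot"
    and cauchy: "\<forall>e>0. \<exists>K. \<forall>j\<ge>K. \<forall>k\<ge>K. p (s j \<ominus>\<^bsub>quot\<^esub> s k) < e"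
  have "\<forall>k. \<exists>u. u \<in> carrier A \<and> s k = rep u" using s by auto
  then obtain u where u: "\<And>k. u k \<in> carrier A" "\<And>k. s k = rep (u k)" by metis
  have "\<exists>x\<in>carrier A. (\<lambda>k. p (u k \<ominus> x)) \<longlonglongrightarrow> 0"
    using cauchy by (intro complete u) (simp add: u quot_minus)
  then obtain x where "x \<in> carrier A" "(\<lambda>k. p (u k \<ominus> x)) \<longlonglongrightarrow> 0" by blast
  then show "\<exists>x\<in>carrier quot. (\<lambda>k. p (s k \<ominus>\<^bsub>quot\<^esub> x)) \<longlonglongrightarrow> 0"
    by (intro bexI[of _ "rep x"]) (auto simp: u quot_minus)
qed (simp_all add: complex_algebra_quot topo_quot)

end

text \<open>Cauchy sequences are formed before anything is divided out, so that a single quotient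
  removes the kernel of p and the null sequences together. To this end the locale of seminormed
  algebras is interpreted a second time, at the algebra of sequences. The map \<phi> sends x to the
  class of the constant sequence x.\<close>

lemma banach_completion:
  fixes A :: "'a top_algebra"
  assumes "multinormed_algebra A P" "p \<in> P"
  obtains B :: "(nat \<Rightarrow> 'a) top_algebra" and N \<phi>
  where "banach_algebra B N" "\<phi> \<in> cont_hom A B" "\<And>x. x \<in> carrier A \<Longrightarrow> N (\<phi> x) = p x"
proof -
  interpret A: multinormed_algebra A P by fact
  interpret p: seminormed_algebra A p by (rule A.seminormed) fact
  interpret S: seminormed_algebra p.seq_algebra p.seq_norm by (rule p.seminormed_seq)
  have banach: "banach_algebra S.quot p.seq_norm"
    using p.seq_complete by (intro S.banach_quot) auto
  define \<phi> where "\<phi> = restrict (\<lambda>x. S.rep (\<lambda>k. x)) (carrier A)"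
  note const = p.cauchy_seqs_const
  have \<phi>_minus: "\<phi> (x \<ominus>\<^bsub>A\<^esub> y) = \<phi> x \<ominus>\<^bsub>S.quot\<^esub> \<phi> y" if "x \<in> carrier A" "y \<in> carrier A" for x y
    using that const S.quot_minus[of "\<lambda>k. x" "\<lambda>k. y"] by (simp add: \<phi>_def p.seq_minus)
  have norm: "p.seq_norm (\<phi> x) = p x" if "x \<in> carrier A" for x
    using that const S.p_rep[of "\<lambda>k. x"] by (simp add: \<phi>_def)
  have closed: "\<phi> x \<in> carrier S.quot" if "x \<in> carrier A" for x
    using that const by (simp add: \<phi>_def)
  have "continuous_map (topo A) (topo S.quot) \<phi>"
    by (rule continuous_map_if_bounded[OF assms(1) banach_multinormed[OF banach] closed \<phi>_minus])
       (use norm assms(2) in \<open>auto intro!: bexI[of _ p] exI[of _ 1]\<close>)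
  moreover have "\<phi> (x \<oplus>\<^bsub>A\<^esub> y) = \<phi> x \<oplus>\<^bsub>S.quot\<^esub> \<phi> y"
    "\<phi> (x \<otimes>\<^bsub>A\<^esub> y) = \<phi> x \<otimes>\<^bsub>S.quot\<^esub> \<phi> y" "\<phi> (c \<odot>\<^bsub>A\<^esub> x) = c \<odot>\<^bsub>S.quot\<^esub> \<phi> x"
    if "x \<in> carrier A" "y \<in> carrier A" for x y c
    using that const[of x] const[of y] S.rep_closed[of "\<lambda>k. x"] S.rep_closed[of "\<lambda>k. y"]
      S.rep_ops(2)[of "\<lambda>k. x" "S.rep (\<lambda>k. y)"] S.rep_ops(3)[of "\<lambda>k. y" "\<lambda>k. x"]
      S.rep_ops(4)[of "\<lambda>k. x" "S.rep (\<lambda>k. y)"] S.rep_ops(5)[of "\<lambda>k. y" "\<lambda>k. x"]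
      S.rep_ops(6)[of "\<lambda>k. x" c]
    by (simp_all add: \<phi>_def)
  moreover have "\<phi> \<one>\<^bsub>A\<^esub> = \<one>\<^bsub>S.quot\<^esub>" by (simp add: \<phi>_def)
  ultimately have "\<phi> \<in> cont_hom A S.quot"
    using closed by (auto simp: cont_hom_def ring_hom_def \<phi>_def)
  then show thesis using that[OF banach _ norm] by blast
qed

section \<open>Joint spectral radius\<close>

text \<open>Writing d = q * m + t with t < m gives \<open>s d \<le> s m ^ q * s t\<close>, and the
  first factor is at most \<open>\<rho> ^ (q * m)\<close>. The constant K dominates
  \<open>s t / \<rho> ^ t\<close> for all remainders t; its summand 1 makes it positive. The
  induction removes one block of length m at a time.\<close>

lemma submultiplicative_geometric_bound:
  fixes s :: "nat \<Rightarrow> real"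
  assumes nonneg: "\<And>d. 0 \<le> s d" and submult: "\<And>d e. s (d + e) \<le> s d * s e"
    and m: "0 < m" and \<rho>: "0 < \<rho>" and le: "s m \<le> \<rho> ^ m"
  obtains K where "0 < K" "\<And>d. s d \<le> K * \<rho> ^ d"
proof -
  define K where "K = 1 + (\<Sum>t<m. s t / \<rho> ^ t)"
  have "0 \<le> (\<Sum>t<m. s t / \<rho> ^ t)" using nonneg \<rho> by (intro sum_nonneg) simp
  then have "0 < K" by (simp add: K_def)
  moreover have "s d \<le> K * \<rho> ^ d" for d
  proof (induction d rule: less_induct)
    case (less d)
    show ?case
    proof (cases "d < m")
      case True
      have "s d / \<rho> ^ d \<le> (\<Sum>t<m. s t / \<rho> ^ t)"
        using True nonneg \<rho> by (intro member_le_sum) auto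
      then have "s d / \<rho> ^ d \<le> K" by (simp add: K_def)
      then show ?thesis using \<rho> by (simp add: field_simps)
    next
      case False
      have "s d \<le> s m * s (d - m)" using submult[of m "d - m"] False by simp
      also have "\<dots> \<le> \<rho> ^ m * (K * \<rho> ^ (d - m))"
        using less[of "d - m"] False m nonneg le \<rho> by (intro mult_mono) auto
      also have "\<dots> = K * \<rho> ^ d" using False by (simp flip: power_add)
      finally show ?thesis .
    qed
  qed
  ultimately show thesis using that by blast
qed

lemma root_geometric_bound_tendsto:
  fixes K \<rho> :: real
  assumes "0 < K" "0 < \<rho>" shows "(\<lambda>d. root d (K * \<rho> ^ d)) \<longlonglongrightarrow> \<rho>"
proof -
  have "(\<lambda>d. root d K * \<rho>) \<longlonglongrightarrow> 1 * \<rho>"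
    using assms by (intro tendsto_intros LIMSEQ_root_const)
  moreover have "eventually (\<lambda>d. root d K * \<rho> = root d (K * \<rho> ^ d)) sequentially"
    using eventually_gt_at_top[of 0]
    by eventually_elim (use assms in \<open>simp add: real_root_mult real_root_power_cancel\<close>)
  ultimately show ?thesis by (simp add: tendsto_cong)
qed

text \<open>Fekete's lemma in multiplicative form.\<close>

lemma submultiplicative_root_tendsto:
  fixes s :: "nat \<Rightarrow> real"
  assumes nonneg: "\<And>d. 0 \<le> s d" and submult: "\<And>d e. s (d + e) \<le> s d * s e"
  shows "(\<lambda>d. root d (s d)) \<longlonglongrightarrow> (INF d\<in>{0<..}. root d (s d))"
proof (rule order_tendstoI)
  \<comment> \<open>The index 0 stays outside the infimum: \<open>root 0\<close> is constantly 0 and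
    would make the infimum 0.\<close>
  have bdd: "bdd_below ((\<lambda>d. root d (s d)) ` {0<..})"
    using nonneg by (intro bdd_belowI[of _ 0]) auto
  fix a :: real
  {
    assume a: "a < (INF d\<in>{0<..}. root d (s d))"
    show "eventually (\<lambda>d. a < root d (s d)) sequentially"
      using eventually_gt_at_top[of 0]
      by eventually_elim (use a in \<open>auto intro: less_le_trans cINF_lower[OF bdd]\<close>)
  next
    assume "(INF d\<in>{0<..}. root d (s d)) < a"
    then obtain m where m: "0 < m" "root m (s m) < a"
      using cINF_less_iff[OF _ bdd] by auto
    \<comment> \<open>The gap between \<rho> and a pays for the constant K, since the d-th roots of
      \<open>K * \<rho> ^ d\<close> tend to \<rho>.\<close>
    then obtain \<rho> where \<rho>: "root m (s m) < \<rho>" "\<rho> < a" using dense by blast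
    have "0 \<le> root m (s m)" using nonneg[of m] m by simp
    then have pos: "0 < \<rho>" using \<rho> by simp
    have "s m = root m (s m) ^ m" using m nonneg by simp
    also have "\<dots> \<le> \<rho> ^ m" using \<rho> \<open>0 \<le> root m (s m)\<close> by (intro power_mono) auto
    finally obtain K where K: "0 < K" "\<And>d. s d \<le> K * \<rho> ^ d"
      using submultiplicative_geometric_bound[OF nonneg submult m(1) pos] by metis
    have "eventually (\<lambda>d. root d (K * \<rho> ^ d) < a) sequentially"
      using order_tendstoD(2)[OF root_geometric_bound_tendsto[OF K(1) pos] \<rho>(2)] .
    then show "eventually (\<lambda>d. root d (s d) < a) sequentially"
      using eventually_gt_at_top[of 0]
      by eventually_elim (use K in \<open>auto intro: le_less_trans real_root_le_mono\<close>)
  }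
qed

section \<open>Words and their values in an algebra\<close>

lemma finite_words_len: "finite (words_len n d)"
proof -
  have "words_len n d = {xs. set xs \<subseteq> {1..n} \<and> length xs = d}"
    by (auto simp: words_len_def words_def lists_eq_set)
  then show ?thesis by (simp add: finite_lists_length_eq)
qed

lemma word_eval_Pi:
  "\<lbrakk>ring A; a \<in> {1..n} \<rightarrow> carrier A; \<alpha> \<in> words n\<rbrakk> \<Longrightarrow> word_eval A a \<alpha> \<in> carrier A"
  by (rule word_eval_closed) auto

lemma word_eval_append:
  fixes A (structure)
  assumes "ring A" "a \<in> {1..n} \<rightarrow> carrier A" "\<alpha> \<in> words n" "\<beta> \<in> words n"
  shows "word_eval A a (\<alpha> @ \<beta>) = word_eval A a \<alpha> \<otimes> word_eval A a \<beta>"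
proof -
  interpret ring A by fact
  have \<beta>: "word_eval A a \<beta> \<in> carrier A"
    using assms by (intro word_eval_Pi)
  show ?thesis using assms(3) unfolding words_def
  proof (induction \<alpha> rule: lists.induct)
    case (Cons i \<alpha>)
    then have "word_eval A a \<alpha> \<in> carrier A" "a i \<in> carrier A"
      using assms(2) word_eval_Pi[OF assms(1,2), of \<alpha>] by (auto simp: words_def)
    then show ?case using Cons \<beta> by (simp add: m_assoc)
  qed (use \<beta> in simp)
qed

lemma word_eval_hom:
  assumes "complex_algebra A" "\<phi> \<in> cont_hom A B" "a \<in> {1..n} \<rightarrow> carrier A" "\<alpha> \<in> words n"
  shows "word_eval B (\<phi> \<circ> a) \<alpha> = \<phi> (word_eval A a \<alpha>)"
proof -
  interpret complex_algebra A by fact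
  show ?thesis using assms(4) unfolding words_def
  proof (induction \<alpha> rule: lists.induct)
    case (Cons i \<alpha>)
    then have "word_eval A a \<alpha> \<in> carrier A" "a i \<in> carrier A"
      using assms(3) word_eval_Pi[OF ring_axioms assms(3), of \<alpha>] by (auto simp: words_def)
    then show ?case using Cons cont_hom_rules(3)[OF assms(2)] by simp
  qed (simp add: cont_hom_rules(4)[OF assms(2)])
qed

section \<open>The joint spectral radius as growth rate of words\<close>

context seminormed_algebra
begin

text \<open>The quantity whose d-th root enters \<open>joint_spectral_radius\<close>. Cutting a word
  after d letters shows below that it is submultiplicative in d.\<close>

definition word_sup :: "nat \<Rightarrow> (nat \<Rightarrow> 'a) \<Rightarrow> nat \<Rightarrow> real" where
  "word_sup n a d = Sup (insert 0 ((\<lambda>\<alpha>. p (word_eval A a \<alpha>)) ` words_len n d))"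

lemma le_word_sup: "\<alpha> \<in> words_len n d \<Longrightarrow> p (word_eval A a \<alpha>) \<le> word_sup n a d"
  unfolding word_sup_def by (rule cSup_upper) (auto simp: finite_words_len)

lemma word_sup_nonneg: "0 \<le> word_sup n a d"
  unfolding word_sup_def by (rule cSup_upper) (auto simp: finite_words_len)

lemma word_sup_le:
  "\<lbrakk>0 \<le> c; \<And>\<alpha>. \<alpha> \<in> words_len n d \<Longrightarrow> p (word_eval A a \<alpha>) \<le> c\<rbrakk> \<Longrightarrow> word_sup n a d \<le> c"
  unfolding word_sup_def by (rule cSup_least) auto

lemma word_sup_submult:
  assumes a: "a \<in> {1..n} \<rightarrow> carrier A"
  shows "word_sup n a (d + e) \<le> word_sup n a d * word_sup n a e"
proof (rule word_sup_le)
  fix \<alpha> assume "\<alpha> \<in> words_len n (d + e)"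
  then have w: "take d \<alpha> \<in> words_len n d" "drop d \<alpha> \<in> words_len n e"
    by (auto simp: words_len_def words_def dest: in_set_takeD in_set_dropD)
  then have w': "take d \<alpha> \<in> words n" "drop d \<alpha> \<in> words n" by (auto simp: words_len_def)
  then have closed: "word_eval A a (take d \<alpha>) \<in> carrier A" "word_eval A a (drop d \<alpha>) \<in> carrier A"
    using word_eval_Pi[OF ring_axioms a] by auto
  have "p (word_eval A a \<alpha>) = p (word_eval A a (take d \<alpha>) \<otimes> word_eval A a (drop d \<alpha>))"
    using word_eval_append[OF ring_axioms a w'] by simp
  also have "\<dots> \<le> p (word_eval A a (take d \<alpha>)) * p (word_eval A a (drop d \<alpha>))"
    using closed by (rule p_mult)
  also have "\<dots> \<le> word_sup n a d * word_sup n a e"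
    using w closed by (intro mult_mono le_word_sup word_sup_nonneg p_nonneg)
  finally show "p (word_eval A a \<alpha>) \<le> word_sup n a d * word_sup n a e" .
qed (simp add: word_sup_nonneg)

text \<open>The operator \<open>lim\<close> in \<open>joint_spectral_radius\<close> carries
  information only for convergent sequences; Fekete's lemma supplies the convergence.\<close>

lemma joint_spectral_radius_lim:
  assumes "a \<in> {1..n} \<rightarrow> carrier A"
  obtains L where "(\<lambda>d. root d (word_sup n a d)) \<longlonglongrightarrow> L" "joint_spectral_radius A {p} n a = ereal L"
    "L = (INF d\<in>{0<..}. root d (word_sup n a d))"
proof (rule that[OF _ _ refl])
  show lim: "(\<lambda>d. root d (word_sup n a d)) \<longlonglongrightarrow> (INF d\<in>{0<..}. root d (word_sup n a d))"
    by (rule submultiplicative_root_tendsto[OF word_sup_nonneg word_sup_submult[OF assms]])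
  show "joint_spectral_radius A {p} n a = ereal (INF d\<in>{0<..}. root d (word_sup n a d))"
    using limI[OF lim] by (simp add: joint_spectral_radius_def word_sup_def)
qed

lemma joint_spectral_radius_lessD:
  assumes a: "a \<in> {1..n} \<rightarrow> carrier A" and less: "joint_spectral_radius A {p} n a < r"
  obtains \<rho> K where "0 < \<rho>" "ereal \<rho> < r" "0 < K"
    "\<And>\<alpha>. \<alpha> \<in> words n \<Longrightarrow> p (word_eval A a \<alpha>) \<le> K * \<rho> ^ length \<alpha>"
proof -
  obtain L where L: "(\<lambda>d. root d (word_sup n a d)) \<longlonglongrightarrow> L" "joint_spectral_radius A {p} n a = ereal L"
    using joint_spectral_radius_lim[OF a] by metis
  have "0 \<le> L" by (rule LIMSEQ_le_const[OF L(1)]) (auto simp: word_sup_nonneg intro!: exI[of _ 0] real_root_ge_zero)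
  \<comment> \<open>L is real even when r is infinite, so a real number fits strictly between the
    two.\<close>
  obtain \<rho> where \<rho>: "L < \<rho>" "ereal \<rho> < r" using less L(2) ereal_dense2[of "ereal L" r] by auto
  have pos: "0 < \<rho>" using \<rho> \<open>0 \<le> L\<close> by simp
  obtain m where m: "0 < m" "root m (word_sup n a m) < \<rho>"
    using eventually_conj[OF order_tendstoD(2)[OF L(1) \<rho>(1)] eventually_gt_at_top[of 0]]
    by (auto simp: eventually_sequentially)
  have "word_sup n a m = root m (word_sup n a m) ^ m" using m word_sup_nonneg by simp
  also have "\<dots> \<le> \<rho> ^ m" using m(2) word_sup_nonneg by (intro power_mono real_root_ge_zero) auto
  finally obtain K where K: "0 < K" "\<And>d. word_sup n a d \<le> K * \<rho> ^ d"
    using submultiplicative_geometric_bound[OF word_sup_nonneg word_sup_submult[OF a] m(1) pos]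
    by metis
  show thesis
  proof (rule that[OF pos \<rho>(2) K(1)])
    fix \<alpha> assume "\<alpha> \<in> words n"
    then show "p (word_eval A a \<alpha>) \<le> K * \<rho> ^ length \<alpha>"
      using le_word_sup[of \<alpha> n "length \<alpha>" a] K(2)[of "length \<alpha>"] by (simp add: words_len_def)
  qed
qed

lemma joint_spectral_radius_less:
  assumes a: "a \<in> {1..n} \<rightarrow> carrier A" and \<rho>: "0 < \<rho>" "ereal \<rho> < r" and K: "0 < K"
    and bound: "\<And>\<alpha>. \<alpha> \<in> words n \<Longrightarrow> p (word_eval A a \<alpha>) \<le> K * \<rho> ^ length \<alpha>"
  shows "joint_spectral_radius A {p} n a < r"
proof -
  obtain L where L: "(\<lambda>d. root d (word_sup n a d)) \<longlonglongrightarrow> L" "joint_spectral_radius A {p} n a = ereal L"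
    using joint_spectral_radius_lim[OF a] by metis
  have "word_sup n a d \<le> K * \<rho> ^ d" for d
    using K \<rho> bound by (intro word_sup_le) (auto simp: words_len_def)
  then have "L \<le> \<rho>"
    \<comment> \<open>Roots are compared from d = 1 on, since monotonicity of \<open>root d\<close>
      is used for positive d.\<close>
    by (intro LIMSEQ_le[OF L(1) root_geometric_bound_tendsto[OF K \<rho>(1)]] exI[of _ 1])
       (auto intro: real_root_le_mono)
  then have "joint_spectral_radius A {p} n a \<le> ereal \<rho>" by (simp add: L(2))
  then show ?thesis using \<rho>(2) by (rule le_less_trans)
qed

end

section \<open>The algebra structure of the free polydisk algebra\<close>

definition splits :: "nat list \<Rightarrow> (nat list \<times> nat list) set" where
  "splits \<alpha> = {(\<beta>, \<gamma>). \<beta> @ \<gamma> = \<alpha>}"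

lemma in_splits [simp]: "x \<in> splits \<alpha> \<longleftrightarrow> fst x @ snd x = \<alpha>"
  by (auto simp: splits_def)

definition conv :: "(nat list \<Rightarrow> complex) \<Rightarrow> (nat list \<Rightarrow> complex) \<Rightarrow> nat list \<Rightarrow> complex" where
  "conv f g \<alpha> = (\<Sum>x\<in>splits \<alpha>. f (fst x) * g (snd x))"

text \<open>The monomial \<open>\<zeta>\<^sub>\<alpha>\<close>; thus \<open>delta []\<close> is the
  unit and \<open>delta [i]\<close> is \<open>zeta i\<close>.\<close>

definition delta :: "nat list \<Rightarrow> nat list \<Rightarrow> complex" where
  "delta \<alpha> = (\<lambda>\<beta>. if \<beta> = \<alpha> then 1 else 0)"

lemma finite_splits [simp]: "finite (splits \<alpha>)"
proof -
  have "x \<in> (\<lambda>i. (take i \<alpha>, drop i \<alpha>)) ` {..length \<alpha>}" if "x \<in> splits \<alpha>" for x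
    by (rule image_eqI[of _ _ "length (fst x)"]) (use that in auto)
  then have "splits \<alpha> \<subseteq> (\<lambda>i. (take i \<alpha>, drop i \<alpha>)) ` {..length \<alpha>}" by blast
  then show ?thesis by (rule finite_subset) simp
qed

text \<open>Both sides sum over the factorisations of \<alpha> into three words; the two witnesses
  translate between the bracketings.\<close>

lemma conv_assoc: "conv (conv f g) h = conv f (conv g h)"
proof
  fix \<alpha>
  have "conv (conv f g) h \<alpha> =
      (\<Sum>(x, y)\<in>(SIGMA x:splits \<alpha>. splits (fst x)). f (fst y) * g (snd y) * h (snd x))"
    by (simp add: conv_def sum_distrib_right sum.Sigma)
  also have "\<dots> = (\<Sum>(x, y)\<in>(SIGMA x:splits \<alpha>. splits (snd x)). f (fst x) * (g (fst y) * h (snd y)))"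
    by (rule sum.reindex_bij_witness[where
          i = "\<lambda>((\<beta>, \<epsilon>), (\<beta>', \<gamma>)). ((\<beta> @ \<beta>', \<gamma>), (\<beta>, \<beta>'))" and
          j = "\<lambda>((\<delta>, \<gamma>), (\<beta>, \<beta>')). ((\<beta>, \<beta>' @ \<gamma>), (\<beta>', \<gamma>))"]) auto
  also have "\<dots> = conv f (conv g h) \<alpha>"
    by (simp add: conv_def sum_distrib_left sum.Sigma)
  finally show "conv (conv f g) h \<alpha> = conv f (conv g h) \<alpha>" .
qed

lemma conv_distrib:
  "conv (\<lambda>\<alpha>. f \<alpha> + g \<alpha>) h = (\<lambda>\<alpha>. conv f h \<alpha> + conv g h \<alpha>)"
  "conv h (\<lambda>\<alpha>. f \<alpha> + g \<alpha>) = (\<lambda>\<alpha>. conv h f \<alpha> + conv h g \<alpha>)"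
  "conv (\<lambda>\<alpha>. c * f \<alpha>) h = (\<lambda>\<alpha>. c * conv f h \<alpha>)"
  "conv h (\<lambda>\<alpha>. c * f \<alpha>) = (\<lambda>\<alpha>. c * conv h f \<alpha>)"
  by (simp_all add: fun_eq_iff conv_def algebra_simps sum.distrib sum_distrib_left)

lemma conv_delta_delta: "conv (delta \<alpha>) (delta \<beta>) = delta (\<alpha> @ \<beta>)"
proof
  fix \<gamma>
  have "conv (delta \<alpha>) (delta \<beta>) \<gamma> = (\<Sum>x\<in>splits \<gamma>. if x = (\<alpha>, \<beta>) then 1 else 0)"
    unfolding conv_def by (intro sum.cong) (auto simp: delta_def prod_eq_iff)
  then show "conv (delta \<alpha>) (delta \<beta>) \<gamma> = delta (\<alpha> @ \<beta>) \<gamma>"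
    by (simp add: delta_def eq_commute)
qed

lemma conv_delta_Nil: "conv (delta []) f = f" "conv f (delta []) = f"
proof -
  have "conv (delta []) f \<alpha> = (\<Sum>x\<in>splits \<alpha>. if x = ([], \<alpha>) then f \<alpha> else 0)" for \<alpha>
    unfolding conv_def by (intro sum.cong) (auto simp: delta_def prod_eq_iff)
  moreover have "conv f (delta []) \<alpha> = (\<Sum>x\<in>splits \<alpha>. if x = (\<alpha>, []) then f \<alpha> else 0)" for \<alpha>
    unfolding conv_def by (intro sum.cong) (auto simp: delta_def prod_eq_iff)
  ultimately show "conv (delta []) f = f" "conv f (delta []) = f" by (simp_all add: fun_eq_iff)
qed

lemma append_in_words [simp]: "\<alpha> @ \<beta> \<in> words n \<longleftrightarrow> \<alpha> \<in> words n \<and> \<beta> \<in> words n"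
  by (simp add: words_def)

section \<open>Weighted absolutely summable norms\<close>

definition weighted :: "real \<Rightarrow> (nat list \<Rightarrow> complex) \<Rightarrow> nat list \<Rightarrow> real" where
  "weighted \<rho> f \<alpha> = cmod (f \<alpha>) * \<rho> ^ length \<alpha>"

lemma weighted_nonneg [simp]: "0 < \<rho> \<Longrightarrow> 0 \<le> weighted \<rho> f \<alpha>"
  by (simp add: weighted_def)

lemma poly_norm_weighted: "poly_norm n \<rho> f = infsum (weighted \<rho> f) (words n)"
  by (simp add: poly_norm_def weighted_def[abs_def])

text \<open>All terms are nonnegative, so a uniform bound on finite sums yields summability and the
  norm estimate at once. The inequalities below are therefore checked on finite sets of
  words.\<close>

lemma weighted_boundI:
  assumes "0 < \<rho>" "\<And>F. \<lbrakk>finite F; F \<subseteq> words n\<rbrakk> \<Longrightarrow> sum (weighted \<rho> f) F \<le> M"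
  shows "weighted \<rho> f summable_on words n \<and> poly_norm n \<rho> f \<le> M"
proof
  show "weighted \<rho> f summable_on words n"
    using assms by (intro nonneg_bdd_above_summable_on) (auto intro!: bdd_aboveI[of _ M])
  then show "poly_norm n \<rho> f \<le> M"
    unfolding poly_norm_weighted using assms by (intro infsum_le_finite_sums) auto
qed

lemma sum_weighted_le:
  "\<lbrakk>0 < \<rho>; weighted \<rho> f summable_on words n; finite F; F \<subseteq> words n\<rbrakk>
    \<Longrightarrow> sum (weighted \<rho> f) F \<le> poly_norm n \<rho> f"
  unfolding poly_norm_weighted by (intro finite_sum_le_infsum) auto

lemma poly_norm_nonneg: "0 < \<rho> \<Longrightarrow> 0 \<le> poly_norm n \<rho> f"
  unfolding poly_norm_weighted by (intro infsum_nonneg) simp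

lemma weighted_add:
  assumes "0 < \<rho>" "weighted \<rho> f summable_on words n" "weighted \<rho> g summable_on words n"
  shows "weighted \<rho> (\<lambda>\<alpha>. f \<alpha> + g \<alpha>) summable_on words n \<and>
    poly_norm n \<rho> (\<lambda>\<alpha>. f \<alpha> + g \<alpha>) \<le> poly_norm n \<rho> f + poly_norm n \<rho> g"
proof (rule weighted_boundI[OF assms(1)])
  fix F assume F: "finite F" "F \<subseteq> words n"
  have "sum (weighted \<rho> (\<lambda>\<alpha>. f \<alpha> + g \<alpha>)) F \<le> (\<Sum>\<alpha>\<in>F. weighted \<rho> f \<alpha> + weighted \<rho> g \<alpha>)"
    unfolding weighted_def using assms(1)
    by (intro sum_mono) (simp add: norm_triangle_ineq flip: distrib_right)
  also have "\<dots> \<le> poly_norm n \<rho> f + poly_norm n \<rho> g"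
    unfolding sum.distrib using assms F by (intro add_mono sum_weighted_le)
  finally show "sum (weighted \<rho> (\<lambda>\<alpha>. f \<alpha> + g \<alpha>)) F \<le> poly_norm n \<rho> f + poly_norm n \<rho> g" .
qed

lemma weighted_smult:
  assumes "weighted \<rho> f summable_on words n"
  shows "weighted \<rho> (\<lambda>\<alpha>. c * f \<alpha>) summable_on words n"
    and "poly_norm n \<rho> (\<lambda>\<alpha>. c * f \<alpha>) = cmod c * poly_norm n \<rho> f"
proof -
  have *: "weighted \<rho> (\<lambda>\<alpha>. c * f \<alpha>) = (\<lambda>\<alpha>. cmod c * weighted \<rho> f \<alpha>)"
    by (simp add: fun_eq_iff weighted_def norm_mult)
  show "weighted \<rho> (\<lambda>\<alpha>. c * f \<alpha>) summable_on words n"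
    unfolding * using assms by (rule summable_on_cmult_right)
  show "poly_norm n \<rho> (\<lambda>\<alpha>. c * f \<alpha>) = cmod c * poly_norm n \<rho> f"
    unfolding poly_norm_weighted * using assms by (simp add: infsum_cmult_right')
qed

text \<open>The factorisations of different words are disjoint, since a pair determines its
  concatenation. Their finite union over F lies in the product of its two projections, and a sum
  over that product factors.\<close>

lemma weighted_conv:
  assumes \<rho>: "0 < \<rho>" and "weighted \<rho> f summable_on words n" "weighted \<rho> g summable_on words n"
  shows "weighted \<rho> (conv f g) summable_on words n \<and>
    poly_norm n \<rho> (conv f g) \<le> poly_norm n \<rho> f * poly_norm n \<rho> g"
proof (rule weighted_boundI[OF \<rho>])
  fix F assume F: "finite F" "F \<subseteq> words n"
  let ?T = "\<Union>\<alpha>\<in>F. splits \<alpha>"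
  have T: "finite ?T" "fst ` ?T \<subseteq> words n" "snd ` ?T \<subseteq> words n"
    using F(1) by (auto dest!: subsetD[OF F(2)])
  have "weighted \<rho> (conv f g) \<alpha> \<le> (\<Sum>x\<in>splits \<alpha>. weighted \<rho> f (fst x) * weighted \<rho> g (snd x))" for \<alpha>
  proof -
    have "cmod (conv f g \<alpha>) \<le> (\<Sum>x\<in>splits \<alpha>. cmod (f (fst x)) * cmod (g (snd x)))"
      unfolding conv_def by (rule order_trans[OF norm_sum]) (simp add: norm_mult)
    then have "weighted \<rho> (conv f g) \<alpha> \<le>
        (\<Sum>x\<in>splits \<alpha>. cmod (f (fst x)) * cmod (g (snd x))) * \<rho> ^ length \<alpha>"
      unfolding weighted_def using \<rho> by (intro mult_right_mono) auto
    also have "\<dots> = (\<Sum>x\<in>splits \<alpha>. weighted \<rho> f (fst x) * weighted \<rho> g (snd x))"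
      unfolding sum_distrib_right weighted_def
      by (intro sum.cong) (auto simp: power_add)
    finally show ?thesis .
  qed
  then have "sum (weighted \<rho> (conv f g)) F \<le>
      (\<Sum>\<alpha>\<in>F. \<Sum>x\<in>splits \<alpha>. weighted \<rho> f (fst x) * weighted \<rho> g (snd x))"
    by (rule sum_mono)
  also have "\<dots> = (\<Sum>x\<in>?T. weighted \<rho> f (fst x) * weighted \<rho> g (snd x))"
    using F by (intro sum.UNION_disjoint[symmetric]) auto
  also have "\<dots> \<le> (\<Sum>x\<in>fst ` ?T \<times> snd ` ?T. weighted \<rho> f (fst x) * weighted \<rho> g (snd x))"
    using T(1) \<rho> by (intro sum_mono2 subset_fst_snd) auto
  also have "\<dots> = sum (weighted \<rho> f) (fst ` ?T) * sum (weighted \<rho> g) (snd ` ?T)"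
    by (simp add: sum_product sum.cartesian_product case_prod_unfold)
  also have "\<dots> \<le> poly_norm n \<rho> f * poly_norm n \<rho> g"
    using assms T by (intro mult_mono sum_weighted_le sum_nonneg poly_norm_nonneg) auto
  finally show "sum (weighted \<rho> (conv f g)) F \<le> poly_norm n \<rho> f * poly_norm n \<rho> g" .
qed

text \<open>An inequality because \<alpha> is arbitrary: outside \<open>words n\<close> the norm is
  0.\<close>

lemma weighted_delta:
  assumes "0 < \<rho>"
  shows "weighted \<rho> (delta \<alpha>) summable_on words n \<and> poly_norm n \<rho> (delta \<alpha>) \<le> \<rho> ^ length \<alpha>"
proof (rule weighted_boundI[OF assms])
  fix F :: "nat list set" assume "finite F"
  have "sum (weighted \<rho> (delta \<alpha>)) F = (\<Sum>\<beta>\<in>F. if \<beta> = \<alpha> then \<rho> ^ length \<alpha> else 0)"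
    by (intro sum.cong) (auto simp: weighted_def delta_def)
  then show "sum (weighted \<rho> (delta \<alpha>)) F \<le> \<rho> ^ length \<alpha>" using \<open>finite F\<close> assms by simp
qed

lemma poly_norm_mono:
  assumes "0 < \<rho>" "\<rho> \<le> \<sigma>" "weighted \<sigma> f summable_on words n"
  shows "poly_norm n \<rho> f \<le> poly_norm n \<sigma> f"
proof -
  have "sum (weighted \<rho> f) F \<le> poly_norm n \<sigma> f" if F: "finite F" "F \<subseteq> words n" for F
  proof -
    have "sum (weighted \<rho> f) F \<le> sum (weighted \<sigma> f) F"
      unfolding weighted_def using assms by (intro sum_mono mult_left_mono power_mono) auto
    also have "\<dots> \<le> poly_norm n \<sigma> f" using assms F by (intro sum_weighted_le) auto
    finally show ?thesis .
  qed
  then show ?thesis using weighted_boundI[OF assms(1)] by blast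
qed

text \<open>Some finite sum comes within e of the norm, as otherwise \<open>weighted_boundI\<close>
  would bound the norm by itself minus e. All words outside such an F together contribute at most
  e.\<close>

lemma poly_norm_truncate:
  assumes \<rho>: "0 < \<rho>" and f: "weighted \<rho> f summable_on words n" and e: "0 < e"
  obtains F where "finite F" "F \<subseteq> words n" "poly_norm n \<rho> (\<lambda>\<alpha>. if \<alpha> \<in> F then 0 else f \<alpha>) \<le> e"
proof -
  have "\<exists>F. finite F \<and> F \<subseteq> words n \<and> poly_norm n \<rho> f - e < sum (weighted \<rho> f) F"
  proof (rule ccontr)
    assume "\<nexists>F. finite F \<and> F \<subseteq> words n \<and> poly_norm n \<rho> f - e < sum (weighted \<rho> f) F"
    then have "poly_norm n \<rho> f \<le> poly_norm n \<rho> f - e"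
      using weighted_boundI[OF \<rho>, of n f "poly_norm n \<rho> f - e"] by (meson not_less)
    then show False using e by simp
  qed
  then obtain F where F: "finite F" "F \<subseteq> words n" "poly_norm n \<rho> f - e < sum (weighted \<rho> f) F"
    by blast
  have "sum (weighted \<rho> (\<lambda>\<alpha>. if \<alpha> \<in> F then 0 else f \<alpha>)) G \<le> e" if G: "finite G" "G \<subseteq> words n" for G
  proof -
    have "sum (weighted \<rho> (\<lambda>\<alpha>. if \<alpha> \<in> F then 0 else f \<alpha>)) G = sum (weighted \<rho> f) (G - F)"
      using G by (intro sum.mono_neutral_cong_right) (auto simp: weighted_def)
    moreover have "sum (weighted \<rho> f) (G - F) + sum (weighted \<rho> f) F = sum (weighted \<rho> f) (G \<union> F)"
      using G F by (subst sum.union_disjoint[symmetric]) auto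
    moreover have "sum (weighted \<rho> f) (G \<union> F) \<le> poly_norm n \<rho> f"
      using G F by (intro sum_weighted_le[OF \<rho> f]) auto
    ultimately show ?thesis using F(3) by linarith
  qed
  then show thesis using that[OF F(1,2)] weighted_boundI[OF \<rho>] by blast
qed

section \<open>The free polydisk algebra as a multinormed algebra\<close>

abbreviation poly_norms :: "nat \<Rightarrow> ereal \<Rightarrow> ((nat list \<Rightarrow> complex) \<Rightarrow> real) set" where
  "poly_norms n r \<equiv> {poly_norm n \<rho> | \<rho>. 0 < \<rho> \<and> ereal \<rho> < r}"

lemma in_taylor_iff:
  "f \<in> carrier (taylor_algebra n r) \<longleftrightarrow> f \<in> formal_series n \<and>
     (\<forall>\<rho>>0. ereal \<rho> < r \<longrightarrow> weighted \<rho> f summable_on words n)"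
  by (simp add: taylor_algebra_def taylor_alg0_def weighted_def[abs_def])

lemma taylor_simps [simp]:
  "\<one>\<^bsub>taylor_algebra n r\<^esub> = delta []" "\<zero>\<^bsub>taylor_algebra n r\<^esub> = (\<lambda>\<alpha>. 0)"
  "f \<otimes>\<^bsub>taylor_algebra n r\<^esub> g = conv f g" "f \<oplus>\<^bsub>taylor_algebra n r\<^esub> g = (\<lambda>\<alpha>. f \<alpha> + g \<alpha>)"
  "c \<odot>\<^bsub>taylor_algebra n r\<^esub> f = (\<lambda>\<alpha>. c * f \<alpha>)"
  by (simp_all add: taylor_algebra_def taylor_alg0_def conv_def[abs_def] splits_def delta_def
    case_prod_unfold)

lemma taylor_add:
  "\<lbrakk>f \<in> carrier (taylor_algebra n r); g \<in> carrier (taylor_algebra n r)\<rbrakk>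
    \<Longrightarrow> (\<lambda>\<alpha>. f \<alpha> + g \<alpha>) \<in> carrier (taylor_algebra n r)"
  by (simp add: in_taylor_iff weighted_add formal_series_def)

lemma taylor_smult:
  "f \<in> carrier (taylor_algebra n r) \<Longrightarrow> (\<lambda>\<alpha>. c * f \<alpha>) \<in> carrier (taylor_algebra n r)"
  by (simp add: in_taylor_iff weighted_smult formal_series_def)

lemma taylor_conv:
  assumes "f \<in> carrier (taylor_algebra n r)" "g \<in> carrier (taylor_algebra n r)"
  shows "conv f g \<in> carrier (taylor_algebra n r)"
proof -
  have "conv f g \<alpha> = 0" if "\<alpha> \<notin> words n" for \<alpha>
    unfolding conv_def
    by (rule sum.neutral) (use that assms in \<open>auto simp: in_taylor_iff formal_series_def\<close>)
  then show ?thesis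
    using assms weighted_conv by (auto simp: in_taylor_iff formal_series_def)
qed

lemma taylor_delta: "\<alpha> \<in> words n \<Longrightarrow> delta \<alpha> \<in> carrier (taylor_algebra n r)"
  using weighted_delta by (auto simp: in_taylor_iff formal_series_def delta_def)

lemma taylor_ring: "ring (taylor_algebra n r)"
proof (rule ringI[OF abelian_groupI monoidI])
  let ?T = "taylor_algebra n r"
  show "\<exists>y\<in>carrier ?T. y \<oplus>\<^bsub>?T\<^esub> x = \<zero>\<^bsub>?T\<^esub>" if "x \<in> carrier ?T" for x
    using taylor_smult[OF that, of "-1"] by (intro bexI[of _ "\<lambda>\<alpha>. -1 * x \<alpha>"]) auto
  show "\<one>\<^bsub>?T\<^esub> \<in> carrier ?T" by (simp add: taylor_delta words_def)
  show "\<zero>\<^bsub>?T\<^esub> \<in> carrier ?T"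
    using taylor_smult[OF taylor_delta[of "[]" n], of 0] by (simp add: words_def)
qed (auto simp: taylor_add taylor_conv conv_assoc conv_distrib conv_delta_Nil algebra_simps)

lemma taylor_complex_algebra: "complex_algebra (taylor_algebra n r)"
  by (rule complex_algebraI[OF taylor_ring])
     (auto simp: taylor_smult conv_distrib algebra_simps)

lemma taylor_multinormed: "multinormed_algebra (taylor_algebra n r) (poly_norms n r)"
proof -
  have "submult_seminorm (taylor_algebra n r) (poly_norm n \<rho>)" if "0 < \<rho>" "ereal \<rho> < r" for \<rho>
    using that
    by (auto simp: submult_seminorm_def in_taylor_iff poly_norm_nonneg weighted_add weighted_conv
        weighted_smult)
  moreover have "topo (taylor_algebra n r) = seminorm_topology (taylor_algebra n r) (poly_norms n r)"
  proof -
    \<comment> \<open>The seminorm topology was formed in the algebra with the provisional topology;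
      both algebras have the same additive structure, so it is the same topology.\<close>
    have "a_inv (taylor_alg0 n r) = a_inv (taylor_algebra n r)"
      by (simp add: fun_eq_iff a_inv_def m_inv_def taylor_algebra_def)
    then show ?thesis
      by (simp add: taylor_algebra_def seminorm_topology_def a_minus_def)
  qed
  ultimately show ?thesis
    by (auto simp: multinormed_algebra_def multinormed_algebra_axioms_def taylor_complex_algebra)
qed

lemma word_eval_zeta:
  "\<alpha> \<in> words n \<Longrightarrow> word_eval (taylor_algebra n r) zeta \<alpha> = delta \<alpha>"
  by (induction \<alpha>) (auto simp: conv_delta_delta zeta_def words_def simp flip: delta_def)

lemma zeta_delta: "zeta i = delta [i]"
  by (simp add: zeta_def delta_def)

text \<open>Finitely supported series are dense, so \<open>L\<close> is determined by its values on words.\<close>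

lemma taylor_seminorm_zero:
  assumes "seminormed_algebra A p" and \<rho>: "0 < \<rho>" "ereal \<rho> < r"
    and closed: "\<And>f. f \<in> carrier (taylor_algebra n r) \<Longrightarrow> L f \<in> carrier A"
    and add: "\<And>f g. \<lbrakk>f \<in> carrier (taylor_algebra n r); g \<in> carrier (taylor_algebra n r)\<rbrakk>
      \<Longrightarrow> L (\<lambda>\<alpha>. f \<alpha> + g \<alpha>) = L f \<oplus>\<^bsub>A\<^esub> L g"
    and smult: "\<And>c f. f \<in> carrier (taylor_algebra n r) \<Longrightarrow> L (\<lambda>\<alpha>. c * f \<alpha>) = c \<odot>\<^bsub>A\<^esub> L f"
    and bound: "\<And>f. f \<in> carrier (taylor_algebra n r) \<Longrightarrow> p (L f) \<le> C * poly_norm n \<rho> f"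
    and delta: "\<And>\<alpha>. \<alpha> \<in> words n \<Longrightarrow> p (L (delta \<alpha>)) = 0"
    and f: "f \<in> carrier (taylor_algebra n r)"
  shows "p (L f) = 0"
proof -
  interpret seminormed_algebra A p by fact
  let ?T = "taylor_algebra n r"
  have restr: "(\<lambda>\<alpha>. if \<alpha> \<in> F then f \<alpha> else 0) \<in> carrier ?T \<and>
      p (L (\<lambda>\<alpha>. if \<alpha> \<in> F then f \<alpha> else 0)) = 0" if "finite F" "F \<subseteq> words n" for F
    using that
  proof (induction F)
    case empty
    \<comment> \<open>The zero series is written as 0 times f, so that homogeneity determines its
      image.\<close>
    have "L (\<lambda>\<alpha>. 0) = 0 \<odot>\<^bsub>A\<^esub> L f" using smult[OF f, of 0] by simp
    then show ?case using f taylor_smult[OF f, of 0] closed by (simp add: p_smult)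
  next
    case (insert \<beta> F)
    let ?g = "\<lambda>\<alpha>. if \<alpha> \<in> F then f \<alpha> else 0"
    have eq: "(\<lambda>\<alpha>. if \<alpha> \<in> insert \<beta> F then f \<alpha> else 0) = (\<lambda>\<alpha>. ?g \<alpha> + f \<beta> * delta \<beta> \<alpha>)"
      using insert by (auto simp: fun_eq_iff delta_def)
    have d: "delta \<beta> \<in> carrier ?T" "(\<lambda>\<alpha>. f \<beta> * delta \<beta> \<alpha>) \<in> carrier ?T"
      using insert by (auto intro: taylor_delta taylor_smult)
    have g: "?g \<in> carrier ?T" "p (L ?g) = 0" using insert by auto
    have L: "L (\<lambda>\<alpha>. ?g \<alpha> + f \<beta> * delta \<beta> \<alpha>) = L ?g \<oplus>\<^bsub>A\<^esub> f \<beta> \<odot>\<^bsub>A\<^esub> L (delta \<beta>)"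
      using add[OF g(1) d(2)] smult[OF d(1), of "f \<beta>"] by simp
    have "p (L ?g \<oplus>\<^bsub>A\<^esub> f \<beta> \<odot>\<^bsub>A\<^esub> L (delta \<beta>)) \<le> p (L ?g) + cmod (f \<beta>) * p (L (delta \<beta>))"
      using p_add[of "L ?g" "f \<beta> \<odot>\<^bsub>A\<^esub> L (delta \<beta>)"] closed g d by (simp add: p_smult)
    then have "p (L ?g \<oplus>\<^bsub>A\<^esub> f \<beta> \<odot>\<^bsub>A\<^esub> L (delta \<beta>)) \<le> 0" using g delta insert by simp
    moreover have "0 \<le> p (L ?g \<oplus>\<^bsub>A\<^esub> f \<beta> \<odot>\<^bsub>A\<^esub> L (delta \<beta>))"
      using closed g d by (intro p_nonneg) auto
    ultimately show ?case unfolding eq L using taylor_add[OF g(1) d(2)] by simp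
  qed
  have "p (L f) \<le> 0 + e" if e: "0 < e" for e
  proof -
    have "weighted \<rho> f summable_on words n" using f \<rho> by (simp add: in_taylor_iff)
    \<comment> \<open>The constant C has no prescribed sign; \<bar>C\<bar> + 1 is positive and
      dominates it.\<close>
    then obtain F where F: "finite F" "F \<subseteq> words n"
        "poly_norm n \<rho> (\<lambda>\<alpha>. if \<alpha> \<in> F then 0 else f \<alpha>) \<le> e / (\<bar>C\<bar> + 1)"
      using poly_norm_truncate[OF \<rho>(1), of f n "e / (\<bar>C\<bar> + 1)"] e by auto
    let ?g = "\<lambda>\<alpha>. if \<alpha> \<in> F then f \<alpha> else 0" and ?h = "\<lambda>\<alpha>. if \<alpha> \<in> F then 0 else f \<alpha>"
    have g: "?g \<in> carrier ?T" "p (L ?g) = 0" using restr[OF F(1,2)] by auto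
    have h_eq: "?h = (\<lambda>\<alpha>. f \<alpha> + (-1) * ?g \<alpha>)" by auto
    have h: "?h \<in> carrier ?T" unfolding h_eq by (intro taylor_add taylor_smult f g)
    have "L f = L (\<lambda>\<alpha>. ?h \<alpha> + ?g \<alpha>)" by (rule arg_cong[where f = L]) auto
    also have "\<dots> = L ?h \<oplus>\<^bsub>A\<^esub> L ?g" by (rule add[OF h g(1)])
    finally have "p (L f) \<le> p (L ?h)" using p_add[OF closed[OF h] closed[OF g(1)]] g(2) by simp
    also have "\<dots> \<le> C * poly_norm n \<rho> ?h" by (rule bound[OF h])
    also have "\<dots> \<le> (\<bar>C\<bar> + 1) * (e / (\<bar>C\<bar> + 1))"
      using F(3) poly_norm_nonneg[OF \<rho>(1)] by (intro mult_mono) auto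
    finally show ?thesis by simp
  qed
  then have "p (L f) \<le> 0" by (rule field_le_epsilon)
  then show ?thesis using p_nonneg[OF closed[OF f]] by simp
qed

section \<open>Absolutely convergent series\<close>

primrec (in complex_algebra) psum :: "(nat \<Rightarrow> 'a) \<Rightarrow> nat \<Rightarrow> 'a" where
  "psum s 0 = \<zero>" |
  "psum s (Suc k) = psum s k \<oplus> s k"

context complex_algebra
begin

lemma psum_closed: "(\<And>k. s k \<in> carrier A) \<Longrightarrow> psum s k \<in> carrier A"
  by (induction k) auto

lemma psum_add:
  "\<lbrakk>\<And>k. s k \<in> carrier A; \<And>k. t k \<in> carrier A\<rbrakk>
    \<Longrightarrow> psum (\<lambda>k. s k \<oplus> t k) k = psum s k \<oplus> psum t k"
  by (induction k) (auto simp: psum_closed a_ac)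

lemma psum_smult: "(\<And>k. s k \<in> carrier A) \<Longrightarrow> psum (\<lambda>k. c \<odot> s k) k = c \<odot> psum s k"
  by (induction k) (auto simp: psum_closed csmult_rules csmult_zero_right)

lemma psum_single:
  "x \<in> carrier A \<Longrightarrow> psum (\<lambda>k. if k = m then x else \<zero>) k = (if m < k then x else \<zero>)"
  by (induction k) auto

end

context seminormed_algebra
begin

lemma p_psum_minus:
  assumes "\<And>k. s k \<in> carrier A"
  shows "p (psum s (k + j) \<ominus> psum s k) \<le> (\<Sum>i=k..<k + j. p (s i))"
proof (induction j)
  case 0
  then show ?case using assms by (simp add: psum_closed minus_eq r_neg)
next
  case (Suc j)
  \<comment> \<open>The artificial summand \<zero> brings the difference into the shape of
    \<open>p_add_diff\<close>.\<close>
  have "p (psum s (k + Suc j) \<ominus> psum s k) =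
      p ((psum s (k + j) \<oplus> s (k + j)) \<ominus> (psum s k \<oplus> \<zero>))"
    using assms by (simp add: psum_closed)
  also have "\<dots> \<le> p (psum s (k + j) \<ominus> psum s k) + p (s (k + j) \<ominus> \<zero>)"
    using assms by (intro p_add_diff psum_closed) auto
  finally show ?case using Suc assms by (simp add: minus_eq)
qed

lemma p_psum: "(\<And>k. s k \<in> carrier A) \<Longrightarrow> p (psum s k) \<le> (\<Sum>i<k. p (s i))"
  using p_psum_minus[of s 0 k] by (simp add: psum_closed minus_eq atLeast0LessThan)

lemma psum_cauchy:
  assumes s: "\<And>k. s k \<in> carrier A" and summable: "summable (\<lambda>k. p (s k))" and e: "0 < e"
  shows "\<exists>K. \<forall>j\<ge>K. \<forall>k\<ge>K. p (psum s j \<ominus> psum s k) < e"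
proof -
  obtain K where K: "\<And>m n. K \<le> m \<Longrightarrow> norm (\<Sum>i=m..<n. p (s i)) < e"
    using summable[unfolded summable_Cauchy] e by blast
  have le: "p (psum s j \<ominus> psum s k) < e" if "K \<le> k" "k \<le> j" for j k
  proof -
    have "p (psum s j \<ominus> psum s k) \<le> (\<Sum>i=k..<j. p (s i))"
      using p_psum_minus[of s k "j - k", OF s] that by simp
    then show ?thesis using K[OF that(1), of j] by simp
  qed
  have "p (psum s j \<ominus> psum s k) < e" if "K \<le> j" "K \<le> k" for j k
    using le[of k j] le[of j k] that p_minus_commute[of "psum s j" "psum s k"] psum_closed[of s] s
    by (cases "k \<le> j") auto
  then show ?thesis by blast
qed

end

section \<open>Convergence of sequences in an Arens-Michael algebra\<close>

locale arens_michael_algebra = multinormed_algebra A P for A (structure) and P +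
  assumes Hausdorff: "Hausdorff_space (topo A)" and complete: "complete_top_algebra A"
begin

definition converges :: "(nat \<Rightarrow> 'a) \<Rightarrow> 'a \<Rightarrow> bool" where
  "converges s x \<longleftrightarrow> (\<forall>k. s k \<in> carrier A) \<and> x \<in> carrier A \<and>
     (\<forall>p\<in>P. (\<lambda>k. p (s k \<ominus> x)) \<longlonglongrightarrow> 0)"

lemma eqI:
  assumes "x \<in> carrier A" "y \<in> carrier A" "\<And>p. p \<in> P \<Longrightarrow> p (x \<ominus> y) = 0" shows "x = y"
  by (rule minus_eq_zeroD[OF assms(1,2) separated[OF Hausdorff minus_closed[OF assms(1,2)]]])
     (rule assms(3))

lemma convergesI:
  assumes "\<And>k. s k \<in> carrier A" "x \<in> carrier A"
    "\<And>p k. p \<in> P \<Longrightarrow> p (s k \<ominus> x) \<le> g p k" "\<And>p. p \<in> P \<Longrightarrow> g p \<longlonglongrightarrow> 0"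
  shows "converges s x"
  unfolding converges_def
proof (intro conjI allI ballI)
  fix p assume p: "p \<in> P"
  interpret p: seminormed_algebra A p by (rule seminormed) fact
  show "(\<lambda>k. p (s k \<ominus> x)) \<longlonglongrightarrow> 0"
    by (rule tendsto_sandwich[OF _ _ tendsto_const assms(4)[OF p]])
       (use assms p in \<open>auto intro!: always_eventually p.p_nonneg\<close>)
qed (use assms in auto)

lemma converges_unique:
  assumes "converges s x" "converges s y" shows "x = y"
proof (rule eqI)
  fix p assume p: "p \<in> P"
  interpret p: seminormed_algebra A p by (rule seminormed) fact
  have xy: "\<And>k. s k \<in> carrier A" "x \<in> carrier A" "y \<in> carrier A"
    and lim: "(\<lambda>k. p (s k \<ominus> x)) \<longlonglongrightarrow> 0" "(\<lambda>k. p (s k \<ominus> y)) \<longlonglongrightarrow> 0"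
    using assms p by (auto simp: converges_def)
  have "p (x \<ominus> y) \<le> p (s k \<ominus> x) + p (s k \<ominus> y)" for k
    using p.p_triangle[of x "s k" y] p.p_minus_commute[of x "s k"] xy by simp
  then have "p (x \<ominus> y) \<le> 0 + 0"
    by (intro tendsto_lowerbound[OF tendsto_add[OF lim]] always_eventually) auto
  then show "p (x \<ominus> y) = 0" using p.p_nonneg[of "x \<ominus> y"] xy by simp
qed (use assms in \<open>auto simp: converges_def\<close>)

lemma converges_add:
  assumes "converges s x" "converges t y" shows "converges (\<lambda>k. s k \<oplus> t k) (x \<oplus> y)"
proof (rule convergesI)
  fix p assume p: "p \<in> P"
  show "p ((s k \<oplus> t k) \<ominus> (x \<oplus> y)) \<le> p (s k \<ominus> x) + p (t k \<ominus> y)" for k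
    using assms by (intro seminormed_algebra.p_add_diff[OF seminormed[OF p]]) (auto simp: converges_def)
  show "(\<lambda>k. p (s k \<ominus> x) + p (t k \<ominus> y)) \<longlonglongrightarrow> 0"
    using tendsto_add[of "\<lambda>k. p (s k \<ominus> x)" 0 _ "\<lambda>k. p (t k \<ominus> y)" 0] assms p
    by (auto simp: converges_def)
qed (use assms in \<open>auto simp: converges_def\<close>)

lemma converges_smult:
  assumes "converges s x" shows "converges (\<lambda>k. c \<odot> s k) (c \<odot> x)"
proof (rule convergesI)
  fix p assume p: "p \<in> P"
  show "p (c \<odot> s k \<ominus> c \<odot> x) \<le> cmod c * p (s k \<ominus> x)" for k
    using assms seminormed_algebra.p_smult_diff[OF seminormed[OF p]] by (simp add: converges_def)
  show "(\<lambda>k. cmod c * p (s k \<ominus> x)) \<longlonglongrightarrow> 0"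
    using tendsto_mult_right_zero[of "\<lambda>k. p (s k \<ominus> x)" _ "cmod c"] assms p
    by (auto simp: converges_def)
qed (use assms in \<open>auto simp: converges_def\<close>)

lemma converges_bound:
  assumes "converges s x" "p \<in> P" "\<And>k. p (s k) \<le> M" shows "p x \<le> M"
proof -
  interpret p: seminormed_algebra A p by (rule seminormed) fact
  have s: "\<And>k. s k \<in> carrier A" "x \<in> carrier A" "(\<lambda>k. p (s k \<ominus> x)) \<longlonglongrightarrow> 0"
    using assms by (auto simp: converges_def)
  have "p x \<le> p (s k \<ominus> x) + M" for k
    using p.p_le_add_diff[of x "s k"] p.p_minus_commute[of x "s k"] s assms(3)[of k] by simp
  then have "p x \<le> 0 + M"
    by (intro tendsto_lowerbound[OF tendsto_add[OF s(3) tendsto_const]] always_eventually) auto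
  then show ?thesis by simp
qed

lemma psum_converges:
  assumes "\<And>k. s k \<in> carrier A" "\<And>p. p \<in> P \<Longrightarrow> summable (\<lambda>k. p (s k))"
  shows "\<exists>x. converges (psum s) x"
proof -
  have "\<exists>x\<in>carrier A. \<forall>p\<in>P. (\<lambda>k. p (psum s k \<ominus> x)) \<longlonglongrightarrow> 0"
    using assms seminormed_algebra.psum_cauchy[OF seminormed]
    by (intro sequentially_complete[OF complete] psum_closed) auto
  then show ?thesis using psum_closed[OF assms(1)] by (auto simp: converges_def)
qed

end

lemma arens_michael_obtain:
  assumes "arens_michael A" obtains P where "arens_michael_algebra A P"
proof -
  obtain P where "multinormed_algebra A P" using arens_michael_multinormed[OF assms] by blast
  then show thesis
    using that[of P] assms
    by (simp add: arens_michael_algebra_def arens_michael_algebra_axioms_def arens_michael_def)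
qed

section \<open>Evaluation of free power series\<close>

text \<open>The assumption \<open>word_bound\<close> is what is retained of spectral contractivity;
  \<rho> and K may vary with p.\<close>

locale series_evaluation = arens_michael_algebra A P for A (structure) and P +
  fixes n :: nat and r :: ereal and a :: "nat \<Rightarrow> 'a"
  assumes a: "a \<in> {1..n} \<rightarrow> carrier A"
    and word_bound: "p \<in> P \<Longrightarrow> \<exists>\<rho> K. 0 < \<rho> \<and> ereal \<rho> < r \<and> 0 < K \<and>
      (\<forall>\<alpha>\<in>words n. p (word_eval A a \<alpha>) \<le> K * \<rho> ^ length \<alpha>)"
begin

abbreviation (input) "\<T> \<equiv> taylor_algebra n r"

text \<open>All lists are enumerated, not only words: for n = 0 the empty word is the only one, so
  \<open>words n\<close> need not be in bijection with \<open>nat\<close>. At lists that are not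
  words \<open>series_term\<close> is \<zero>.\<close>

definition word_enum :: "nat \<Rightarrow> nat list" where
  "word_enum = from_nat_into UNIV"

lemma bij_word_enum: "bij word_enum"
proof -
  have "infinite (UNIV :: nat list set)" by (rule infinite_UNIV_listI)
  then show ?thesis unfolding word_enum_def by (intro bij_betw_from_nat_into) auto
qed

definition series_term :: "(nat list \<Rightarrow> complex) \<Rightarrow> nat \<Rightarrow> 'a" where
  "series_term f k = (if word_enum k \<in> words n
     then f (word_enum k) \<odot> word_eval A a (word_enum k) else \<zero>)"

definition evaluate :: "(nat list \<Rightarrow> complex) \<Rightarrow> 'a" where
  "evaluate f = (SOME x. converges (psum (series_term f)) x)"

lemma word_closed: "\<alpha> \<in> words n \<Longrightarrow> word_eval A a \<alpha> \<in> carrier A"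
  by (rule word_eval_Pi[OF ring_axioms a])

lemma series_term_closed: "series_term f k \<in> carrier A"
  by (simp add: series_term_def word_closed)

text \<open>The right-hand side does not depend on k. Hence the estimate yields convergence of the
  series and afterwards the bound on its sum.\<close>

lemma series_term_partial_sum_bound:
  assumes f: "f \<in> carrier \<T>" and p: "p \<in> P" and \<rho>: "0 < \<rho>" "ereal \<rho> < r" and K: "0 < K"
    and word: "\<And>\<alpha>. \<alpha> \<in> words n \<Longrightarrow> p (word_eval A a \<alpha>) \<le> K * \<rho> ^ length \<alpha>"
  shows "(\<Sum>i<k. p (series_term f i)) \<le> K * poly_norm n \<rho> f"
proof -
  interpret p: seminormed_algebra A p by (rule seminormed) fact
  let ?I = "{i\<in>{..<k}. word_enum i \<in> words n}"
  have "(\<Sum>i<k. p (series_term f i)) = (\<Sum>i\<in>?I. p (series_term f i))"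
    by (rule sum.mono_neutral_right) (auto simp: series_term_def)
  also have "\<dots> \<le> (\<Sum>i\<in>?I. K * weighted \<rho> f (word_enum i))"
  proof (rule sum_mono)
    fix i assume "i \<in> ?I"
    then have i: "word_enum i \<in> words n" by simp
    have "p (series_term f i) = cmod (f (word_enum i)) * p (word_eval A a (word_enum i))"
      using i by (simp add: series_term_def p.p_smult word_closed)
    also have "\<dots> \<le> cmod (f (word_enum i)) * (K * \<rho> ^ length (word_enum i))"
      by (intro mult_left_mono word i) simp
    finally show "p (series_term f i) \<le> K * weighted \<rho> f (word_enum i)"
      by (simp add: weighted_def mult_ac)
  qed
  also have "\<dots> = K * sum (weighted \<rho> f) (word_enum ` ?I)"
    using bij_word_enum
    by (subst sum.reindex) (auto simp: sum_distrib_left intro: inj_on_subset bij_is_inj)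
  also have "\<dots> \<le> K * poly_norm n \<rho> f"
    using f \<rho> K by (intro mult_left_mono sum_weighted_le) (auto simp: in_taylor_iff)
  finally show ?thesis .
qed

lemma evaluate_converges:
  assumes "f \<in> carrier \<T>" shows "converges (psum (series_term f)) (evaluate f)"
proof -
  have "summable (\<lambda>k. p (series_term f k))" if p: "p \<in> P" for p
  proof -
    obtain \<rho> K where "0 < \<rho>" "ereal \<rho> < r" "0 < K"
        "\<And>\<alpha>. \<alpha> \<in> words n \<Longrightarrow> p (word_eval A a \<alpha>) \<le> K * \<rho> ^ length \<alpha>"
      using word_bound[OF p] by blast
    then show ?thesis
      using series_term_partial_sum_bound[OF assms p]
        seminormed_algebra.p_nonneg[OF seminormed[OF p] series_term_closed]
      by (intro summableI_nonneg_bounded) auto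
  qed
  then have "\<exists>x. converges (psum (series_term f)) x" by (intro psum_converges series_term_closed)
  then show ?thesis unfolding evaluate_def by (rule someI_ex)
qed

lemma evaluate_eqI:
  "\<lbrakk>f \<in> carrier \<T>; converges (psum (series_term f)) x\<rbrakk> \<Longrightarrow> evaluate f = x"
  using converges_unique evaluate_converges by blast

lemma evaluate_closed: "f \<in> carrier \<T> \<Longrightarrow> evaluate f \<in> carrier A"
  using evaluate_converges by (simp add: converges_def)

lemma evaluate_bounded:
  assumes p: "p \<in> P"
  obtains \<rho> K where "0 < \<rho>" "ereal \<rho> < r" "0 < K"
    "\<And>f. f \<in> carrier \<T> \<Longrightarrow> p (evaluate f) \<le> K * poly_norm n \<rho> f"
proof -
  obtain \<rho> K where \<rho>: "0 < \<rho>" "ereal \<rho> < r" "0 < K"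
      "\<And>\<alpha>. \<alpha> \<in> words n \<Longrightarrow> p (word_eval A a \<alpha>) \<le> K * \<rho> ^ length \<alpha>"
    using word_bound[OF p] by blast
  show thesis
  proof (rule that[OF \<rho>(1-3)])
    fix f assume f: "f \<in> carrier \<T>"
    have "p (psum (series_term f) k) \<le> K * poly_norm n \<rho> f" for k
      using seminormed_algebra.p_psum[OF seminormed[OF p] series_term_closed]
        series_term_partial_sum_bound[OF f p \<rho>] by (rule order_trans)
    then show "p (evaluate f) \<le> K * poly_norm n \<rho> f"
      by (rule converges_bound[OF evaluate_converges[OF f] p])
  qed
qed

lemma evaluate_add:
  assumes "f \<in> carrier \<T>" "g \<in> carrier \<T>"
  shows "evaluate (\<lambda>\<alpha>. f \<alpha> + g \<alpha>) = evaluate f \<oplus> evaluate g"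
proof -
  have *: "series_term (\<lambda>\<alpha>. f \<alpha> + g \<alpha>) = (\<lambda>k. series_term f k \<oplus> series_term g k)"
    by (auto simp: fun_eq_iff series_term_def csmult_rules word_closed)
  have "psum (series_term (\<lambda>\<alpha>. f \<alpha> + g \<alpha>)) = (\<lambda>k. psum (series_term f) k \<oplus> psum (series_term g) k)"
    unfolding * by (intro ext psum_add series_term_closed)
  then show ?thesis
    using converges_add[OF assms[THEN evaluate_converges]]
    by (intro evaluate_eqI taylor_add assms) simp
qed

lemma evaluate_smult:
  assumes "f \<in> carrier \<T>" shows "evaluate (\<lambda>\<alpha>. c * f \<alpha>) = c \<odot> evaluate f"
proof -
  have *: "series_term (\<lambda>\<alpha>. c * f \<alpha>) = (\<lambda>k. c \<odot> series_term f k)"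
    by (auto simp: fun_eq_iff series_term_def csmult_rules word_closed csmult_zero_right)
  have "psum (series_term (\<lambda>\<alpha>. c * f \<alpha>)) = (\<lambda>k. c \<odot> psum (series_term f) k)"
    unfolding * by (intro ext psum_smult series_term_closed)
  then show ?thesis
    using converges_smult[OF evaluate_converges[OF assms]]
    by (intro evaluate_eqI taylor_smult assms) simp
qed

text \<open>Only the term at the index m of \<alpha> can be nonzero, so the partial sums are
  constant beyond m.\<close>

lemma evaluate_delta:
  assumes \<alpha>: "\<alpha> \<in> words n" shows "evaluate (delta \<alpha>) = word_eval A a \<alpha>"
proof (rule evaluate_eqI)
  obtain m where m: "\<alpha> = word_enum m" using bij_word_enum by (metis bij_pointE)
  have "series_term (delta \<alpha>) = (\<lambda>k. if k = m then word_eval A a \<alpha> else \<zero>)"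
    using \<alpha> unfolding m
    by (auto simp: fun_eq_iff series_term_def delta_def csmult_rules csmult_zero_left word_closed
        inj_eq[OF bij_is_inj[OF bij_word_enum]])
  then have psum: "psum (series_term (delta \<alpha>)) k = (if m < k then word_eval A a \<alpha> else \<zero>)" for k
    by (simp add: psum_single word_closed \<alpha>)
  have "(\<lambda>k. p (psum (series_term (delta \<alpha>)) k \<ominus> word_eval A a \<alpha>)) \<longlonglongrightarrow> 0" if p: "p \<in> P" for p
  proof (rule tendsto_eventually)
    show "eventually (\<lambda>k. p (psum (series_term (delta \<alpha>)) k \<ominus> word_eval A a \<alpha>) = 0) sequentially"
      using eventually_gt_at_top[of m]
      by eventually_elim
         (simp add: psum minus_eq r_neg word_closed \<alpha> seminormed_algebra.p_zero[OF seminormed[OF p]])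
  qed
  then show "converges (psum (series_term (delta \<alpha>))) (word_eval A a \<alpha>)"
    by (simp add: converges_def psum_closed series_term_closed word_closed \<alpha>)
qed (rule taylor_delta[OF \<alpha>])

text \<open>The defect of multiplicativity is bilinear, bounded, and vanishes on pairs of words.\<close>

lemma evaluate_conv:
  assumes f: "f \<in> carrier \<T>" and g: "g \<in> carrier \<T>"
  shows "evaluate (conv f g) = evaluate f \<otimes> evaluate g"
proof (rule eqI)
  show closed: "evaluate (conv f g) \<in> carrier A" "evaluate f \<otimes> evaluate g \<in> carrier A"
    using f g by (auto intro: evaluate_closed taylor_conv)
  fix p assume p: "p \<in> P"
  interpret p: seminormed_algebra A p by (rule seminormed) fact
  obtain \<rho> K where \<rho>: "0 < \<rho>" "ereal \<rho> < r" "0 < K"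
      "\<And>f. f \<in> carrier \<T> \<Longrightarrow> p (evaluate f) \<le> K * poly_norm n \<rho> f"
    using evaluate_bounded[OF p] by blast
  define D where "D f g = evaluate (conv f g) \<ominus> evaluate f \<otimes> evaluate g" for f g
  have D_closed: "D f g \<in> carrier A" if "f \<in> carrier \<T>" "g \<in> carrier \<T>" for f g
    using that by (simp add: D_def evaluate_closed taylor_conv)
  have D_add: "D (\<lambda>\<alpha>. f \<alpha> + g \<alpha>) h = D f h \<oplus> D g h" "D h (\<lambda>\<alpha>. f \<alpha> + g \<alpha>) = D h f \<oplus> D h g"
    if "f \<in> carrier \<T>" "g \<in> carrier \<T>" "h \<in> carrier \<T>" for f g h
    using that
    by (simp_all add: D_def conv_distrib evaluate_add evaluate_closed taylor_conv l_distr r_distr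
        add_minus_add)
  have D_smult: "D (\<lambda>\<alpha>. c * f \<alpha>) h = c \<odot> D f h" "D h (\<lambda>\<alpha>. c * f \<alpha>) = c \<odot> D h f"
    if "f \<in> carrier \<T>" "h \<in> carrier \<T>" for c f h
    using that
    by (simp_all add: D_def conv_distrib evaluate_smult evaluate_closed taylor_conv csmult_minus
        smult_mult_left smult_mult_right)
  \<comment> \<open>K comes from evaluating the product series, \<open>K * K\<close> from the
    product of the two evaluations.\<close>
  have D_bound: "p (D f g) \<le> (K + K * K) * poly_norm n \<rho> f * poly_norm n \<rho> g"
    if fg: "f \<in> carrier \<T>" "g \<in> carrier \<T>" for f g
  proof -
    note e = evaluate_closed[OF fg(1)] evaluate_closed[OF fg(2)] evaluate_closed[OF taylor_conv[OF fg]]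
    have "p (D f g) \<le> p (evaluate (conv f g)) + p (evaluate f \<otimes> evaluate g)"
      unfolding D_def minus_eq
      using p.p_add[of "evaluate (conv f g)" "\<ominus> (evaluate f \<otimes> evaluate g)"] e
      by (simp add: p.p_uminus)
    also have "p (evaluate f \<otimes> evaluate g) \<le> p (evaluate f) * p (evaluate g)"
      using e by (intro p.p_mult)
    also have "\<dots> \<le> (K * poly_norm n \<rho> f) * (K * poly_norm n \<rho> g)"
      using \<rho> fg e by (intro mult_mono) (auto intro: p.p_nonneg poly_norm_nonneg mult_nonneg_nonneg)
    also have "p (evaluate (conv f g)) \<le> K * poly_norm n \<rho> (conv f g)"
      by (intro \<rho> taylor_conv fg)
    also have "\<dots> \<le> K * (poly_norm n \<rho> f * poly_norm n \<rho> g)"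
      using \<rho> fg weighted_conv[OF \<rho>(1)] by (intro mult_left_mono) (auto simp: in_taylor_iff)
    finally show ?thesis by (simp add: algebra_simps)
  qed
  have D_delta: "p (D (delta \<alpha>) (delta \<beta>)) = 0" if "\<alpha> \<in> words n" "\<beta> \<in> words n" for \<alpha> \<beta>
    using that word_eval_append[OF ring_axioms a that]
    by (simp add: D_def conv_delta_delta evaluate_delta minus_eq r_neg word_closed)
  \<comment> \<open>Density is applied in one variable at a time: here with a monomial on the right,
    afterwards with f fixed on the left. The norm of the fixed argument is absorbed into the
    constant.\<close>
  have "p (D f (delta \<beta>)) = 0" if \<beta>: "\<beta> \<in> words n" for \<beta>
  proof (rule taylor_seminorm_zero[OF p.seminormed_algebra_axioms \<rho>(1,2), where L = "\<lambda>f. D f (delta \<beta>)"])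
    note \<beta>' = taylor_delta[OF \<beta>, of r]
    show "p (D h (delta \<beta>)) \<le> ((K + K * K) * poly_norm n \<rho> (delta \<beta>)) * poly_norm n \<rho> h"
      if "h \<in> carrier \<T>" for h
      using D_bound[OF that \<beta>'] by (simp add: mult_ac)
    show "p (D (delta \<alpha>) (delta \<beta>)) = 0" if "\<alpha> \<in> words n" for \<alpha>
      using that \<beta> by (rule D_delta)
    show "D h (delta \<beta>) \<in> carrier A" if "h \<in> carrier \<T>" for h
      using that \<beta>' by (rule D_closed)
    show "D (\<lambda>\<alpha>. h \<alpha> + h' \<alpha>) (delta \<beta>) = D h (delta \<beta>) \<oplus> D h' (delta \<beta>)"
      if "h \<in> carrier \<T>" "h' \<in> carrier \<T>" for h h'
      using that \<beta>' by (rule D_add)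
    show "D (\<lambda>\<alpha>. c * h \<alpha>) (delta \<beta>) = c \<odot> D h (delta \<beta>)" if "h \<in> carrier \<T>" for c h
      using that \<beta>' by (rule D_smult)
  qed (fact f)
  then have "p (D f g) = 0"
    by (intro taylor_seminorm_zero[OF p.seminormed_algebra_axioms \<rho>(1,2) D_closed D_add(2) D_smult(2)
          D_bound _ g, of f]) (use f in auto)
  then show "p (evaluate (conv f g) \<ominus> evaluate f \<otimes> evaluate g) = 0" by (simp add: D_def)
qed

lemma evaluate_hom: "restrict evaluate (carrier \<T>) \<in> cont_hom \<T> A"
proof -
  interpret T: complex_algebra \<T> by (rule taylor_complex_algebra)
  let ?g = "restrict evaluate (carrier \<T>)"
  have minus: "?g (x \<ominus>\<^bsub>\<T>\<^esub> y) = ?g x \<ominus> ?g y" if xy: "x \<in> carrier \<T>" "y \<in> carrier \<T>" for x y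
  proof -
    \<comment> \<open>The continuity criterion asks for subtraction, whereas additivity and
      homogeneity are known; hence this form of the difference.\<close>
    have "x \<ominus>\<^bsub>\<T>\<^esub> y = (\<lambda>\<alpha>. x \<alpha> + (-1) * y \<alpha>)"
      using xy T.csmult_minus_one[of y] by (simp add: T.minus_eq flip: T.csmult_minus_one)
    then have "evaluate (x \<ominus>\<^bsub>\<T>\<^esub> y) = evaluate x \<oplus> (-1) \<odot> evaluate y"
      using evaluate_add[OF xy(1) taylor_smult[OF xy(2), of "-1"]] evaluate_smult[OF xy(2), of "-1"]
      by simp
    then show ?thesis using xy T.minus_closed[OF xy]
      by (simp add: csmult_minus_one evaluate_closed minus_eq)
  qed
  have "continuous_map (topo \<T>) (topo A) ?g"
  proof (rule continuous_map_if_bounded[OF taylor_multinormed multinormed_algebra_axioms])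
    fix p assume "p \<in> P"
    then obtain \<rho> K where \<rho>: "0 < \<rho>" "ereal \<rho> < r"
        "\<And>f. f \<in> carrier \<T> \<Longrightarrow> p (evaluate f) \<le> K * poly_norm n \<rho> f"
      using evaluate_bounded by metis
    then show "\<exists>q\<in>poly_norms n r. \<exists>C. \<forall>x\<in>carrier \<T>. p (?g x) \<le> C * q x"
      by (intro bexI[of _ "poly_norm n \<rho>"] exI[of _ K]) auto
  qed (use minus in \<open>auto simp: evaluate_closed\<close>)
  moreover have "evaluate (delta []) = \<one>" by (simp add: evaluate_delta words_def)
  moreover have "delta [] \<in> carrier \<T>" by (simp add: taylor_delta words_def)
  ultimately show ?thesis
    by (auto simp: cont_hom_def ring_hom_def evaluate_closed evaluate_add evaluate_conv evaluate_smult
        taylor_add taylor_conv taylor_smult)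
qed

lemma evaluate_zeta: "i \<in> {1..n} \<Longrightarrow> restrict evaluate (carrier \<T>) (zeta i) = a i"
  using a by (auto simp: zeta_delta evaluate_delta taylor_delta words_def Pi_def)

end

section \<open>The universal property\<close>

lemma taylor_zeta: "i \<in> {1..n} \<Longrightarrow> zeta i \<in> carrier (taylor_algebra n r)"
  by (simp add: zeta_delta taylor_delta words_def)

section \<open>Continuous homomorphisms from the free polydisk algebra\<close>

text \<open>Continuity gives a bound by finitely many defining norms. These increase with the
  radius, so the largest radius serves for all; if there are none, 0 < r still provides a radius.
  The number of norms enters the constant.\<close>

lemma taylor_hom_bounded:
  assumes "0 < r" "multinormed_algebra B Q" "\<phi> \<in> cont_hom (taylor_algebra n r) B" "q \<in> Q"
  obtains \<rho> C where "0 < \<rho>" "ereal \<rho> < r" "0 \<le> C"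
    "\<And>f. f \<in> carrier (taylor_algebra n r) \<Longrightarrow> q (\<phi> f) \<le> C * poly_norm n \<rho> f"
proof -
  let ?T = "taylor_algebra n r"
  obtain F C where F: "finite F" "F \<subseteq> poly_norms n r" "0 \<le> C"
      "\<And>f. f \<in> carrier ?T \<Longrightarrow> q (\<phi> f) \<le> C * (\<Sum>p\<in>F. p f)"
    using cont_hom_bounded[OF taylor_multinormed assms(2-4)] by blast
  have "\<exists>\<rho>>0. ereal \<rho> < r \<and> (\<forall>p\<in>F. \<forall>f\<in>carrier ?T. p f \<le> poly_norm n \<rho> f)"
    using F(1,2)
  proof (induction F)
    case empty
    obtain \<rho> where "0 < \<rho>" "ereal \<rho> < r" using assms(1) ereal_dense2[of 0 r] by auto
    then show ?case by auto
  next
    case (insert p F)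
    then obtain \<rho> where \<rho>: "0 < \<rho>" "ereal \<rho> < r" "\<And>p f. \<lbrakk>p \<in> F; f \<in> carrier ?T\<rbrakk> \<Longrightarrow> p f \<le> poly_norm n \<rho> f"
      by auto
    obtain \<sigma> where \<sigma>: "0 < \<sigma>" "ereal \<sigma> < r" "p = poly_norm n \<sigma>" using insert by auto
    have m: "0 < max \<rho> \<sigma>" "ereal (max \<rho> \<sigma>) < r" using \<rho> \<sigma> by (auto simp: max_def)
    have mono: "poly_norm n \<tau> f \<le> poly_norm n (max \<rho> \<sigma>) f"
      if "f \<in> carrier ?T" "\<tau> \<in> {\<rho>, \<sigma>}" for f \<tau>
      using that m \<rho> \<sigma> by (intro poly_norm_mono) (auto simp: in_taylor_iff)
    have "q f \<le> poly_norm n (max \<rho> \<sigma>) f" if "q \<in> insert p F" "f \<in> carrier ?T" for q f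
      using that(1)
    proof
      assume "q = p" then show ?thesis using that \<sigma>(3) mono by simp
    next
      assume "q \<in> F"
      from order_trans[OF \<rho>(3)[OF this that(2)]] show ?thesis using that(2) mono by simp
    qed
    then show ?case using m by blast
  qed
  then obtain \<rho> where \<rho>: "0 < \<rho>" "ereal \<rho> < r" "\<And>p f. \<lbrakk>p \<in> F; f \<in> carrier ?T\<rbrakk> \<Longrightarrow> p f \<le> poly_norm n \<rho> f"
    by blast
  show thesis
  proof (rule that[OF \<rho>(1,2), of "C * real (card F)"])
    fix f assume f: "f \<in> carrier ?T"
    have "(\<Sum>p\<in>F. p f) \<le> real (card F) * poly_norm n \<rho> f"
      using \<rho>(3) f by (intro sum_bounded_above) auto
    then show "q (\<phi> f) \<le> C * real (card F) * poly_norm n \<rho> f"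
      using F(4)[OF f] mult_left_mono[OF _ F(3)] by (fastforce simp: mult.assoc)
  qed (use F in simp)
qed

lemma taylor_hom_delta:
  assumes "g \<in> cont_hom (taylor_algebra n r) A" "\<alpha> \<in> words n"
  shows "g (delta \<alpha>) = word_eval A (g \<circ> zeta) \<alpha>"
  using word_eval_hom[OF taylor_complex_algebra assms(1) _ assms(2), of zeta] taylor_zeta
  by (auto simp: word_eval_zeta[OF assms(2)])

lemma word_eval_cong:
  "\<lbrakk>\<alpha> \<in> words n; \<And>i. i \<in> {1..n} \<Longrightarrow> a i = b i\<rbrakk> \<Longrightarrow> word_eval A a \<alpha> = word_eval A b \<alpha>"
  by (induction \<alpha>) (auto simp: words_def)

text \<open>The difference of the two homomorphisms is linear, bounded by one defining norm and zero
  on monomials, which is all that the density lemma asks for.\<close>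

lemma taylor_hom_unique:
  fixes A (structure)
  assumes r: "0 < r" and A: "arens_michael A"
    and g: "g \<in> cont_hom (taylor_algebra n r) A" and h: "h \<in> cont_hom (taylor_algebra n r) A"
    and eq: "\<And>i. i \<in> {1..n} \<Longrightarrow> g (zeta i) = h (zeta i)"
  shows "g = h"
proof (rule extensionalityI[OF cont_hom_rules(7)[OF g] cont_hom_rules(7)[OF h]])
  let ?T = "taylor_algebra n r"
  obtain P where "arens_michael_algebra A P" using arens_michael_obtain[OF A] .
  then interpret arens_michael_algebra A P .
  note g' = cont_hom_rules[OF g] and h' = cont_hom_rules[OF h]
  fix f assume f: "f \<in> carrier ?T"
  show "g f = h f"
  proof (rule eqI[OF g'(1)[OF f] h'(1)[OF f]])
    fix p assume p: "p \<in> P"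
    interpret p: seminormed_algebra A p by (rule seminormed) fact
    obtain \<rho> C where \<rho>: "0 < \<rho>" "ereal \<rho> < r" "0 \<le> C"
        "\<And>f. f \<in> carrier ?T \<Longrightarrow> p (g f) \<le> C * poly_norm n \<rho> f"
      using taylor_hom_bounded[OF r multinormed_algebra_axioms g p] by blast
    obtain \<sigma> E where \<sigma>: "0 < \<sigma>" "ereal \<sigma> < r" "0 \<le> E"
        "\<And>f. f \<in> carrier ?T \<Longrightarrow> p (h f) \<le> E * poly_norm n \<sigma> f"
      using taylor_hom_bounded[OF r multinormed_algebra_axioms h p] by blast
    \<comment> \<open>The two bounds come with different radii; the larger one gives a norm that
      controls both maps.\<close>
    define \<tau> where "\<tau> = max \<rho> \<sigma>"
    have \<tau>: "0 < \<tau>" "ereal \<tau> < r" "\<rho> \<le> \<tau>" "\<sigma> \<le> \<tau>" using \<rho> \<sigma> by (auto simp: \<tau>_def max_def)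
    show "p (g f \<ominus> h f) = 0"
    proof (rule taylor_seminorm_zero[OF p.seminormed_algebra_axioms \<tau>(1,2) _ _ _ _ _ f,
          where L = "\<lambda>f. g f \<ominus> h f"])
      show "g (\<lambda>\<alpha>. u \<alpha> + v \<alpha>) \<ominus> h (\<lambda>\<alpha>. u \<alpha> + v \<alpha>) = (g u \<ominus> h u) \<oplus> (g v \<ominus> h v)"
        if "u \<in> carrier ?T" "v \<in> carrier ?T" for u v
        using g'(2)[OF that] h'(2)[OF that] that g'(1) h'(1) by (simp add: add_minus_add)
      show "g (\<lambda>\<alpha>. c * u \<alpha>) \<ominus> h (\<lambda>\<alpha>. c * u \<alpha>) = c \<odot> (g u \<ominus> h u)" if "u \<in> carrier ?T" for u c
        using g'(5)[OF that, of c] h'(5)[OF that, of c] that g'(1) h'(1) by (simp add: csmult_minus)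
      show "p (g (delta \<alpha>) \<ominus> h (delta \<alpha>)) = 0" if "\<alpha> \<in> words n" for \<alpha>
      proof -
        have "g (delta \<alpha>) = h (delta \<alpha>)"
          unfolding taylor_hom_delta[OF g that] taylor_hom_delta[OF h that]
          using eq by (intro word_eval_cong[OF that]) simp
        then show ?thesis using h'(1)[OF taylor_delta[OF that]] by (simp add: minus_eq r_neg)
      qed
      show "p (g u \<ominus> h u) \<le> (C + E) * poly_norm n \<tau> u" if u: "u \<in> carrier ?T" for u
      proof -
        have "p (g u \<ominus> h u) \<le> p (g u) + p (h u)"
          using p.p_add[of "g u" "\<ominus> h u"] u g'(1) h'(1) by (simp add: minus_eq p.p_uminus)
        also have "\<dots> \<le> C * poly_norm n \<rho> u + E * poly_norm n \<sigma> u"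
          by (intro add_mono \<rho> \<sigma> u)
        also have "\<dots> \<le> C * poly_norm n \<tau> u + E * poly_norm n \<tau> u"
          using \<rho> \<sigma> \<tau> u by (intro add_mono mult_left_mono poly_norm_mono) (auto simp: in_taylor_iff)
        finally show ?thesis by (simp add: algebra_simps)
      qed
    qed (use g'(1) h'(1) in auto)
  qed
qed

lemma taylor_hom_exists:
  assumes A: "arens_michael A" and a: "strictly_spectrally_contractive A n r a"
  shows "\<exists>g. g \<in> cont_hom (taylor_algebra n r) A \<and> (\<forall>i\<in>{1..n}. g (zeta i) = a i)"
proof -
  obtain P where "arens_michael_algebra A P" using arens_michael_obtain[OF A] .
  then interpret arens_michael_algebra A P .
  have aA: "a \<in> {1..n} \<rightarrow> carrier A" using a by (auto simp: strictly_spectrally_contractive_def)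
  interpret series_evaluation A P n r a
  proof unfold_locales
    fix p assume p: "p \<in> P"
    \<comment> \<open>The completion has the type over which contractivity quantifies, so the
      definition applies to it directly. The identity N (\<phi> x) = p x carries the word estimate
      back to A.\<close>
    obtain B :: "(nat \<Rightarrow> 'a) top_algebra" and N \<phi> where
        B: "banach_algebra B N" "\<phi> \<in> cont_hom A B" "\<And>x. x \<in> carrier A \<Longrightarrow> N (\<phi> x) = p x"
      using banach_completion[OF multinormed_algebra_axioms p] by metis
    interpret B: seminormed_algebra B N using B(1) by (rule banach_seminormed)
    have "joint_spectral_radius B {N} n (\<phi> \<circ> a) < r"
      using a B by (auto simp: strictly_spectrally_contractive_def)
    moreover have "\<phi> \<circ> a \<in> {1..n} \<rightarrow> carrier B" by (simp add: Pi_iff cont_hom_rules(1)[OF B(2)] Pi_mem[OF aA])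
    ultimately obtain \<rho> K where \<rho>: "0 < \<rho>" "ereal \<rho> < r" "0 < K"
        "\<And>\<alpha>. \<alpha> \<in> words n \<Longrightarrow> N (word_eval B (\<phi> \<circ> a) \<alpha>) \<le> K * \<rho> ^ length \<alpha>"
      using B.joint_spectral_radius_lessD by metis
    have "p (word_eval A a \<alpha>) \<le> K * \<rho> ^ length \<alpha>" if "\<alpha> \<in> words n" for \<alpha>
      using \<rho>(4)[OF that] word_eval_hom[OF complex_algebra_axioms B(2) aA that]
        B(3)[OF word_eval_Pi[OF ring_axioms aA that]] by simp
    then show "\<exists>\<rho> K. 0 < \<rho> \<and> ereal \<rho> < r \<and> 0 < K \<and>
        (\<forall>\<alpha>\<in>words n. p (word_eval A a \<alpha>) \<le> K * \<rho> ^ length \<alpha>)"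
      using \<rho> by blast
  qed (rule aA)
  show ?thesis using evaluate_hom evaluate_zeta by blast
qed

text \<open>The tuple a is kept apart from \<open>g \<circ> zeta\<close>, because tuples are
  extensional on {1..n}. The lemma serves surjectivity as well as naturality.\<close>

lemma taylor_hom_contractive:
  fixes A :: "'a top_algebra"
  assumes r: "0 < r" and A: "arens_michael A" and g: "g \<in> cont_hom (taylor_algebra n r) A"
    and a: "a \<in> {1..n} \<rightarrow>\<^sub>E carrier A" "\<And>i. i \<in> {1..n} \<Longrightarrow> a i = g (zeta i)"
  shows "strictly_spectrally_contractive A n r a"
  unfolding strictly_spectrally_contractive_def
proof (intro conjI allI impI)
  fix B :: "(nat \<Rightarrow> 'a) top_algebra" and N \<phi>
  assume B: "banach_algebra B N" and \<phi>: "\<phi> \<in> cont_hom A B"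
  let ?T = "taylor_algebra n r"
  interpret B: seminormed_algebra B N using B by (rule banach_seminormed)
  have A': "complex_algebra A" using A by (simp add: arens_michael_def)
  have aA: "a \<in> {1..n} \<rightarrow> carrier A" using a(1) by (auto simp: PiE_def)
  have "compose (carrier ?T) \<phi> g \<in> cont_hom ?T B"
    by (rule cont_hom_compose[OF taylor_multinormed g \<phi>])
  then obtain \<rho> C where \<rho>: "0 < \<rho>" "ereal \<rho> < r" "0 \<le> C"
      "\<And>f. f \<in> carrier ?T \<Longrightarrow> N (compose (carrier ?T) \<phi> g f) \<le> C * poly_norm n \<rho> f"
    using taylor_hom_bounded[OF r banach_multinormed[OF B]] by blast
  show "joint_spectral_radius B {N} n (\<phi> \<circ> a) < r"
  \<comment> \<open>C may be 0, whereas a positive constant is required here.\<close>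
  proof (rule B.joint_spectral_radius_less[OF _ \<rho>(1,2), where K = "C + 1"])
    show "\<phi> \<circ> a \<in> {1..n} \<rightarrow> carrier B" by (simp add: Pi_iff cont_hom_rules(1)[OF \<phi>] Pi_mem[OF aA])
    show "0 < C + 1" using \<rho>(3) by simp
    fix \<alpha> assume \<alpha>: "\<alpha> \<in> words n"
    have "word_eval A a \<alpha> = g (delta \<alpha>)"
      unfolding taylor_hom_delta[OF g \<alpha>] using a(2) by (intro word_eval_cong[OF \<alpha>]) simp
    then have "word_eval B (\<phi> \<circ> a) \<alpha> = compose (carrier ?T) \<phi> g (delta \<alpha>)"
      using word_eval_hom[OF A' \<phi> aA \<alpha>] taylor_delta[OF \<alpha>, of r] by (simp add: compose_eq)
    then have "N (word_eval B (\<phi> \<circ> a) \<alpha>) \<le> C * poly_norm n \<rho> (delta \<alpha>)"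
      using \<rho>(4)[OF taylor_delta[OF \<alpha>]] by simp
    also have "\<dots> \<le> (C + 1) * \<rho> ^ length \<alpha>"
      using weighted_delta[OF \<rho>(1)] \<rho> by (intro mult_mono) (auto intro: poly_norm_nonneg)
    finally show "N (word_eval B (\<phi> \<circ> a) \<alpha>) \<le> (C + 1) * \<rho> ^ length \<alpha>" .
  qed
qed (rule a(1))

section \<open>The homomorphism attached to a tuple\<close>

lemma taylor_hom_ex1:
  assumes "0 < r" "arens_michael A" "strictly_spectrally_contractive A n r a"
  shows "\<exists>!g. g \<in> cont_hom (taylor_algebra n r) A \<and> (\<forall>i\<in>{1..n}. g (zeta i) = a i)"
proof (rule ex_ex1I[OF taylor_hom_exists[OF assms(2,3)]])
  fix g h
  assume "g \<in> cont_hom (taylor_algebra n r) A \<and> (\<forall>i\<in>{1..n}. g (zeta i) = a i)"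
    and "h \<in> cont_hom (taylor_algebra n r) A \<and> (\<forall>i\<in>{1..n}. h (zeta i) = a i)"
  then show "g = h" by (intro taylor_hom_unique[OF assms(1,2)]) auto
qed

lemma
  assumes "0 < r" "arens_michael A" "strictly_spectrally_contractive A n r a"
  shows gamma_hom: "gamma n r A a \<in> cont_hom (taylor_algebra n r) A"
    and gamma_zeta: "i \<in> {1..n} \<Longrightarrow> gamma n r A a (zeta i) = a i"
  using theI'[OF taylor_hom_ex1[OF assms]] by (auto simp: gamma_def)

lemma gamma_eqI:
  assumes "0 < r" "arens_michael A" "strictly_spectrally_contractive A n r a"
    "g \<in> cont_hom (taylor_algebra n r) A" "\<And>i. i \<in> {1..n} \<Longrightarrow> g (zeta i) = a i"
  shows "gamma n r A a = g"
  unfolding gamma_def using assms by (intro the1_equality taylor_hom_ex1) auto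

text \<open>Naturality is expressed elementwise, for an algebra over a possibly different type. That
  \<psi> maps contractive tuples to contractive tuples belongs to the claim, as it makes the
  naturality square meaningful.\<close>

theorem proposition3p16:
  fixes n :: nat and r :: ereal and A :: "'a top_algebra"
  assumes "0 < r" and "arens_michael A"
  shows "(\<forall>a. strictly_spectrally_contractive A n r a \<longrightarrow>
            (\<exists>!g. g \<in> cont_hom (taylor_algebra n r) A \<and> (\<forall>i\<in>{1..n}. g (zeta i) = a i))) \<and>
         bij_betw (gamma n r A) {a. strictly_spectrally_contractive A n r a}
            (cont_hom (taylor_algebra n r) A) \<and>
         (\<forall>(A' :: 'c top_algebra) \<psi> a.
            arens_michael A' \<longrightarrow> \<psi> \<in> cont_hom A A' \<longrightarrow> strictly_spectrally_contractive A n r a \<longrightarrow>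
              strictly_spectrally_contractive A' n r (compose {1..n} \<psi> a) \<and>
              gamma n r A' (compose {1..n} \<psi> a) =
                compose (carrier (taylor_algebra n r)) \<psi> (gamma n r A a))"
proof (intro conjI allI impI)
  let ?T = "taylor_algebra n r"
  show "\<exists>!g. g \<in> cont_hom ?T A \<and> (\<forall>i\<in>{1..n}. g (zeta i) = a i)"
    if "strictly_spectrally_contractive A n r a" for a
    using taylor_hom_ex1[OF assms that] .
  show "bij_betw (gamma n r A) {a. strictly_spectrally_contractive A n r a} (cont_hom ?T A)"
    unfolding bij_betw_def
  proof
    show "inj_on (gamma n r A) {a. strictly_spectrally_contractive A n r a}"
    proof (rule inj_onI, clarify)
      fix a b assume a: "strictly_spectrally_contractive A n r a"
        and b: "strictly_spectrally_contractive A n r b" and eq: "gamma n r A a = gamma n r A b"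
      show "a = b"
      proof (rule PiE_ext)
        show "a \<in> {1..n} \<rightarrow>\<^sub>E carrier A" "b \<in> {1..n} \<rightarrow>\<^sub>E carrier A"
          using a b by (simp_all add: strictly_spectrally_contractive_def)
        show "a i = b i" if "i \<in> {1..n}" for i
          using gamma_zeta[OF assms a that] gamma_zeta[OF assms b that] eq by simp
      qed
    qed
    show "gamma n r A ` {a. strictly_spectrally_contractive A n r a} = cont_hom ?T A"
    proof (intro equalityI subsetI)
      fix g assume g: "g \<in> cont_hom ?T A"
      \<comment> \<open>The inverse of \<open>gamma\<close> reads off the images of the variables;
        the restriction makes the tuple extensional.\<close>
      let ?a = "restrict (\<lambda>i. g (zeta i)) {1..n}"
      have "strictly_spectrally_contractive A n r ?a"
        using cont_hom_rules(1)[OF g taylor_zeta] by (intro taylor_hom_contractive[OF assms g]) auto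
      moreover from this have "gamma n r A ?a = g" using g by (intro gamma_eqI assms) auto
      ultimately show "g \<in> gamma n r A ` {a. strictly_spectrally_contractive A n r a}"
        by (intro image_eqI[of _ _ ?a]) auto
    qed (auto intro: gamma_hom[OF assms])
  qed
  fix A' :: "'c top_algebra" and \<psi> a
  assume A': "arens_michael A'" and \<psi>: "\<psi> \<in> cont_hom A A'"
    and a: "strictly_spectrally_contractive A n r a"
  let ?g = "compose (carrier ?T) \<psi> (gamma n r A a)"
  have aA: "a i \<in> carrier A" if "i \<in> {1..n}" for i
    using a that by (auto simp: strictly_spectrally_contractive_def)
  have g: "?g \<in> cont_hom ?T A'"
    by (rule cont_hom_compose[OF taylor_multinormed gamma_hom[OF assms a] \<psi>])
  have zeta: "?g (zeta i) = compose {1..n} \<psi> a i" if "i \<in> {1..n}" for i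
    using that by (simp add: compose_eq taylor_zeta gamma_zeta[OF assms a])
  have "compose {1..n} \<psi> a \<in> {1..n} \<rightarrow>\<^sub>E carrier A'"
    using cont_hom_rules(1)[OF \<psi> aA] by (auto simp: compose_def)
  \<comment> \<open>The image tuple consists of the values of \<open>?g\<close> at the variables, so
    the converse direction, applied to this homomorphism, gives its contractivity.\<close>
  then show c: "strictly_spectrally_contractive A' n r (compose {1..n} \<psi> a)"
    using zeta by (intro taylor_hom_contractive[OF assms(1) A' g]) auto
  show "gamma n r A' (compose {1..n} \<psi> a) = ?g"
    by (rule gamma_eqI[OF assms(1) A' c g zeta])
qed

end
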